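(* The left adjoint in the adjunction $\Sigma^\infty:\mathsf{sSet}_*\rightleftarrows\mathsf{Sp}^\Sigma:\Omega^\infty$ is comonadic, and therefore the comparison adjunction $\mathrm{Can}_{\mathbb{K}_\infty}:\mathsf{sSet}_*\rightleftarrows\mathsf{coAlg}_{\mathbb{K}_\infty}:V_{\mathbb{K}_\infty}$ is an equivalence of categories.
   Context: $\mathsf{sSet}_*$ is the category of pointed simplicial sets and $\mathsf{Sp}^\Sigma$ is the category of symmetric spectra of pointed simplicial sets (Hovey-Shipley-Smith), built from a fixed simplicial model $S^1$ of the circle. $\Sigma^\infty$ is the suspension spectrum functor, $(\Sigma^\infty X)_n=X\wedge (S^1)^{\wedge n}$, and its right adjoint $\Omega^\infty$ is evaluation at level $0$. Given an adjunction $L:\mathsf{N}\rightleftarrows\mathsf{M}:R$ with unit $\eta$ and counit $\epsilon$, the associated comonad on $\mathsf{M}$ is $\mathbb{K}=(K=LR,\Delta=L\eta_R,\epsilon)$. A $\mathbb{K}$-coalgebra is a pair $(Y,\delta)$ with $\delta:Y\to KY$ in $\mathsf{M}$ such that $K\delta\circ\delta=\Delta_Y\circ\delta$ and $\epsilon_Y\circ\delta=\mathrm{id}_Y$; morphisms are morphisms in $\mathsf{M}$ commuting with coactions; they form the category $\mathsf{coAlg}_{\mathbb{K}}$. The comparison functor is $\mathrm{Can}_{\mathbb{K}}(X)=(LX,L\eta_X)$, with right adjoint $V_{\mathbb{K}}(Y,\delta)=\mathrm{equal}(R\delta,\eta_{RY}:RY\rightrightarrows RLRY)$. The functor $L$ is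 comonadic if $\mathrm{Can}_{\mathbb{K}}$ is an equivalence of categories. $\mathbb{K}_\infty$ denotes the comonad on $\mathsf{Sp}^\Sigma$ associated to $\Sigma^\infty\dashv\Omega^\infty$. *)

theory Defs
  imports "HOL-Homology.Simplices" "HOL-Combinatorics.Permutations"
begin

section \<open>Categories, adjunctions and comonads\<close>

record ('o, 'm) category =
  Ob :: "'o set"
  Ar :: "'m set"
  Dm :: "'m \<Rightarrow> 'o"
  Cd :: "'m \<Rightarrow> 'o"
  Idt :: "'o \<Rightarrow> 'm"
  Cmp :: "'m \<Rightarrow> 'm \<Rightarrow> 'm" (infixl "\<cdot>\<index>" 70)

definition Hom :: "('o, 'm, 'z) category_scheme \<Rightarrow> 'o \<Rightarrow> 'o \<Rightarrow> 'm set" where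
  "Hom C a b = {f \<in> Ar C. Dm C f = a \<and> Cd C f = b}"

definition is_category :: "('o, 'm, 'z) category_scheme \<Rightarrow> bool" where
  "is_category C \<longleftrightarrow>
     (\<forall>f\<in>Ar C. Dm C f \<in> Ob C \<and> Cd C f \<in> Ob C) \<and>
     (\<forall>a\<in>Ob C. Idt C a \<in> Hom C a a) \<and>
     (\<forall>a\<in>Ob C. \<forall>b\<in>Ob C. \<forall>c\<in>Ob C. \<forall>f\<in>Hom C a b. \<forall>g\<in>Hom C b c. g \<cdot>\<^bsub>C\<^esub> f \<in> Hom C a c) \<and>
     (\<forall>a\<in>Ob C. \<forall>b\<in>Ob C. \<forall>f\<in>Hom C a b. f \<cdot>\<^bsub>C\<^esub> Idt C a = f \<and> Idt C b \<cdot>\<^bsub>C\<^esub> f = f) \<and>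
     (\<forall>a\<in>Ob C. \<forall>b\<in>Ob C. \<forall>c\<in>Ob C. \<forall>d\<in>Ob C. \<forall>f\<in>Hom C a b. \<forall>g\<in>Hom C b c. \<forall>h\<in>Hom C c d.
        h \<cdot>\<^bsub>C\<^esub> (g \<cdot>\<^bsub>C\<^esub> f) = (h \<cdot>\<^bsub>C\<^esub> g) \<cdot>\<^bsub>C\<^esub> f)"

definition is_iso :: "('o, 'm, 'z) category_scheme \<Rightarrow> 'm \<Rightarrow> bool" where
  "is_iso C f \<longleftrightarrow> f \<in> Ar C \<and>
     (\<exists>g\<in>Hom C (Cd C f) (Dm C f). g \<cdot>\<^bsub>C\<^esub> f = Idt C (Dm C f) \<and> f \<cdot>\<^bsub>C\<^esub> g = Idt C (Cd C f))"

definition is_equalizer :: "('o, 'm, 'z) category_scheme \<Rightarrow> 'm \<Rightarrow> 'm \<Rightarrow> 'm \<Rightarrow> bool" where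
  "is_equalizer C f g e \<longleftrightarrow>
     e \<in> Ar C \<and> Cd C e = Dm C f \<and> f \<cdot>\<^bsub>C\<^esub> e = g \<cdot>\<^bsub>C\<^esub> e \<and>
     (\<forall>k\<in>Ar C. Cd C k = Dm C f \<and> f \<cdot>\<^bsub>C\<^esub> k = g \<cdot>\<^bsub>C\<^esub> k \<longrightarrow>
        (\<exists>!h. h \<in> Hom C (Dm C k) (Dm C e) \<and> e \<cdot>\<^bsub>C\<^esub> h = k))"

text \<open>The map into an equalizer \<open>e\<close> induced by \<open>k\<close>.\<close>

definition factor_through :: "('o, 'm, 'z) category_scheme \<Rightarrow> 'm \<Rightarrow> 'm \<Rightarrow> 'm" where
  "factor_through C e k = (THE h. h \<in> Hom C (Dm C k) (Dm C e) \<and> e \<cdot>\<^bsub>C\<^esub> h = k)"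

record ('o1, 'm1, 'o2, 'm2) func =
  fob :: "'o1 \<Rightarrow> 'o2"
  far :: "'m1 \<Rightarrow> 'm2"

definition is_functor ::
  "('o1, 'm1) category \<Rightarrow> ('o2, 'm2) category \<Rightarrow> ('o1, 'm1, 'o2, 'm2) func \<Rightarrow> bool" where
  "is_functor C D F \<longleftrightarrow> is_category C \<and> is_category D \<and>
     (\<forall>a\<in>Ob C. fob F a \<in> Ob D) \<and>
     (\<forall>a\<in>Ob C. \<forall>b\<in>Ob C. \<forall>f\<in>Hom C a b. far F f \<in> Hom D (fob F a) (fob F b)) \<and>
     (\<forall>a\<in>Ob C. far F (Idt C a) = Idt D (fob F a)) \<and>
     (\<forall>a\<in>Ob C. \<forall>b\<in>Ob C. \<forall>c\<in>Ob C. \<forall>f\<in>Hom C a b. \<forall>g\<in>Hom C b c.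
        far F (g \<cdot>\<^bsub>C\<^esub> f) = far F g \<cdot>\<^bsub>D\<^esub> far F f)"

definition id_func :: "('o, 'm, 'o, 'm) func" where
  "id_func = \<lparr>fob = id, far = id\<rparr>"

definition comp_func ::
  "('o2, 'm2, 'o3, 'm3) func \<Rightarrow> ('o1, 'm1, 'o2, 'm2) func \<Rightarrow> ('o1, 'm1, 'o3, 'm3) func"
  (infixl "\<circ>\<^sub>F" 65) where
  "G \<circ>\<^sub>F F = \<lparr>fob = fob G \<circ> fob F, far = far G \<circ> far F\<rparr>"

definition is_natural ::
  "('o1, 'm1) category \<Rightarrow> ('o2, 'm2) category \<Rightarrow> ('o1, 'm1, 'o2, 'm2) func \<Rightarrow>
   ('o1, 'm1, 'o2, 'm2) func \<Rightarrow> ('o1 \<Rightarrow> 'm2) \<Rightarrow> bool" where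
  "is_natural C D F G \<tau> \<longleftrightarrow> is_functor C D F \<and> is_functor C D G \<and>
     (\<forall>a\<in>Ob C. \<tau> a \<in> Hom D (fob F a) (fob G a)) \<and>
     (\<forall>a\<in>Ob C. \<forall>b\<in>Ob C. \<forall>f\<in>Hom C a b. \<tau> b \<cdot>\<^bsub>D\<^esub> far F f = far G f \<cdot>\<^bsub>D\<^esub> \<tau> a)"

definition is_natural_iso ::
  "('o1, 'm1) category \<Rightarrow> ('o2, 'm2) category \<Rightarrow> ('o1, 'm1, 'o2, 'm2) func \<Rightarrow>
   ('o1, 'm1, 'o2, 'm2) func \<Rightarrow> ('o1 \<Rightarrow> 'm2) \<Rightarrow> bool" where
  "is_natural_iso C D F G \<tau> \<longleftrightarrow> is_natural C D F G \<tau> \<and> (\<forall>a\<in>Ob C. is_iso D (\<tau> a))"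

definition is_equivalence ::
  "('o1, 'm1) category \<Rightarrow> ('o2, 'm2) category \<Rightarrow> ('o1, 'm1, 'o2, 'm2) func \<Rightarrow> bool" where
  "is_equivalence C D F \<longleftrightarrow> is_functor C D F \<and>
     (\<exists>G \<alpha> \<beta>. is_functor D C G \<and>
        is_natural_iso C C id_func (G \<circ>\<^sub>F F) \<alpha> \<and> is_natural_iso D D (F \<circ>\<^sub>F G) id_func \<beta>)"

text \<open>\<open>L : N \<rightarrow> M\<close> is left adjoint to \<open>R : M \<rightarrow> N\<close>, with unit \<open>\<eta>\<close> and counit \<open>\<epsilon>\<close>.\<close>

definition is_adjunction ::
  "('o1, 'm1) category \<Rightarrow> ('o2, 'm2) category \<Rightarrow> ('o1, 'm1, 'o2, 'm2) func \<Rightarrow>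
   ('o2, 'm2, 'o1, 'm1) func \<Rightarrow> ('o1 \<Rightarrow> 'm1) \<Rightarrow> ('o2 \<Rightarrow> 'm2) \<Rightarrow> bool" where
  "is_adjunction N M L R \<eta> \<epsilon> \<longleftrightarrow> is_functor N M L \<and> is_functor M N R \<and>
     is_natural N N id_func (R \<circ>\<^sub>F L) \<eta> \<and> is_natural M M (L \<circ>\<^sub>F R) id_func \<epsilon> \<and>
     (\<forall>X\<in>Ob N. \<epsilon> (fob L X) \<cdot>\<^bsub>M\<^esub> far L (\<eta> X) = Idt M (fob L X)) \<and>
     (\<forall>Y\<in>Ob M. far R (\<epsilon> Y) \<cdot>\<^bsub>N\<^esub> \<eta> (fob R Y) = Idt N (fob R Y))"

definition is_adjoint_equivalence ::
  "('o1, 'm1) category \<Rightarrow> ('o2, 'm2) category \<Rightarrow> ('o1, 'm1, 'o2, 'm2) func \<Rightarrow>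
   ('o2, 'm2, 'o1, 'm1) func \<Rightarrow> ('o1 \<Rightarrow> 'm1) \<Rightarrow> ('o2 \<Rightarrow> 'm2) \<Rightarrow> bool" where
  "is_adjoint_equivalence N M L R \<eta> \<epsilon> \<longleftrightarrow> is_adjunction N M L R \<eta> \<epsilon> \<and>
     (\<forall>X\<in>Ob N. is_iso N (\<eta> X)) \<and> (\<forall>Y\<in>Ob M. is_iso M (\<epsilon> Y))"

text \<open>Arrows of the concrete categories below carry their source and target.\<close>

record ('o, 'd) arrow =
  src :: 'o
  tgt :: 'o
  dat :: 'd

record ('o, 'm) comonad =
  cm_fun :: "('o, 'm, 'o, 'm) func"
  cm_comult :: "'o \<Rightarrow> 'm"
  cm_counit :: "'o \<Rightarrow> 'm"

definition adj_comonad ::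
  "('o1, 'm1, 'o2, 'm2) func \<Rightarrow> ('o2, 'm2, 'o1, 'm1) func \<Rightarrow> ('o1 \<Rightarrow> 'm1) \<Rightarrow>
   ('o2 \<Rightarrow> 'm2) \<Rightarrow> ('o2, 'm2) comonad" where
  "adj_comonad L R \<eta> \<epsilon> =
     \<lparr>cm_fun = L \<circ>\<^sub>F R, cm_comult = (\<lambda>Y. far L (\<eta> (fob R Y))), cm_counit = \<epsilon>\<rparr>"

definition is_coalgebra :: "('o, 'm) category \<Rightarrow> ('o, 'm) comonad \<Rightarrow> 'o \<times> 'm \<Rightarrow> bool" where
  "is_coalgebra M K = (\<lambda>(Y, \<delta>).
     Y \<in> Ob M \<and> \<delta> \<in> Hom M Y (fob (cm_fun K) Y) \<and>
     far (cm_fun K) \<delta> \<cdot>\<^bsub>M\<^esub> \<delta> = cm_comult K Y \<cdot>\<^bsub>M\<^esub> \<delta> \<and>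
     cm_counit K Y \<cdot>\<^bsub>M\<^esub> \<delta> = Idt M Y)"

definition coAlg ::
  "('o, 'm) category \<Rightarrow> ('o, 'm) comonad \<Rightarrow> ('o \<times> 'm, ('o \<times> 'm, 'm) arrow) category" where
  "coAlg M K =
     \<lparr>Ob = {A. is_coalgebra M K A},
      Ar = {f. is_coalgebra M K (src f) \<and> is_coalgebra M K (tgt f) \<and>
               dat f \<in> Hom M (fst (src f)) (fst (tgt f)) \<and>
               far (cm_fun K) (dat f) \<cdot>\<^bsub>M\<^esub> snd (src f) = snd (tgt f) \<cdot>\<^bsub>M\<^esub> dat f},
      Dm = src, Cd = tgt,
      Idt = (\<lambda>A. \<lparr>src = A, tgt = A, dat = Idt M (fst A)\<rparr>),
      Cmp = (\<lambda>g f. \<lparr>src = src f, tgt = tgt g, dat = dat g \<cdot>\<^bsub>M\<^esub> dat f\<rparr>)\<rparr>"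

definition Can ::
  "('o1, 'm1) category \<Rightarrow> ('o1, 'm1, 'o2, 'm2) func \<Rightarrow> ('o1 \<Rightarrow> 'm1) \<Rightarrow>
   ('o1, 'm1, 'o2 \<times> 'm2, ('o2 \<times> 'm2, 'm2) arrow) func" where
  "Can N L \<eta> =
     \<lparr>fob = (\<lambda>X. (fob L X, far L (\<eta> X))),
      far = (\<lambda>f. \<lparr>src = (fob L (Dm N f), far L (\<eta> (Dm N f))),
                  tgt = (fob L (Cd N f), far L (\<eta> (Cd N f))),
                  dat = far L f\<rparr>)\<rparr>"

definition comonadic ::
  "('o1, 'm1) category \<Rightarrow> ('o2, 'm2) category \<Rightarrow> ('o1, 'm1, 'o2, 'm2) func \<Rightarrow>
   ('o2, 'm2, 'o1, 'm1) func \<Rightarrow> ('o1 \<Rightarrow> 'm1) \<Rightarrow> ('o2 \<Rightarrow> 'm2) \<Rightarrow> bool" where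
  "comonadic N M L R \<eta> \<epsilon> \<longleftrightarrow> is_equivalence N (coAlg M (adj_comonad L R \<eta> \<epsilon>)) (Can N L \<eta>)"

text \<open>
  \<open>E f g\<close> is a chosen equalizer arrow of the parallel pair \<open>f\<close>, \<open>g\<close> of \<open>N\<close>.  The functor \<open>V\<close> sends
  \<open>(Y, \<delta>)\<close> to the source of \<open>E (R \<delta>) (\<eta> (R Y))\<close>, and a coalgebra morphism \<open>f\<close> to the restriction
  of \<open>R f\<close> to these equalizers.
\<close>

definition V_incl ::
  "('m1 \<Rightarrow> 'm1 \<Rightarrow> 'm1) \<Rightarrow> ('o2, 'm2, 'o1, 'm1) func \<Rightarrow> ('o1 \<Rightarrow> 'm1) \<Rightarrow> 'o2 \<times> 'm2 \<Rightarrow> 'm1" where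
  "V_incl E R \<eta> = (\<lambda>(Y, \<delta>). E (far R \<delta>) (\<eta> (fob R Y)))"

definition V_func ::
  "('o1, 'm1) category \<Rightarrow> ('m1 \<Rightarrow> 'm1 \<Rightarrow> 'm1) \<Rightarrow> ('o2, 'm2, 'o1, 'm1) func \<Rightarrow> ('o1 \<Rightarrow> 'm1) \<Rightarrow>
   ('o2 \<times> 'm2, ('o2 \<times> 'm2, 'm2) arrow, 'o1, 'm1) func" where
  "V_func N E R \<eta> =
     \<lparr>fob = (\<lambda>A. Dm N (V_incl E R \<eta> A)),
      far = (\<lambda>f. factor_through N (V_incl E R \<eta> (tgt f))
                   (far R (dat f) \<cdot>\<^bsub>N\<^esub> V_incl E R \<eta> (src f)))\<rparr>"

text \<open>
  Unit and counit of the comparison adjunction: \<open>X \<rightarrow> V (Can X)\<close> is induced by \<open>\<eta> X\<close>, and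
  \<open>Can (V (Y, \<delta>)) \<rightarrow> (Y, \<delta>)\<close> is the adjunct \<open>L (V (Y, \<delta>)) \<rightarrow> L (R Y) \<rightarrow> Y\<close> of the inclusion.
\<close>

definition comparison_unit ::
  "('o1, 'm1) category \<Rightarrow> ('m1 \<Rightarrow> 'm1 \<Rightarrow> 'm1) \<Rightarrow> ('o1, 'm1, 'o2, 'm2) func \<Rightarrow>
   ('o2, 'm2, 'o1, 'm1) func \<Rightarrow> ('o1 \<Rightarrow> 'm1) \<Rightarrow> 'o1 \<Rightarrow> 'm1" where
  "comparison_unit N E L R \<eta> X =
     factor_through N (V_incl E R \<eta> (fob (Can N L \<eta>) X)) (\<eta> X)"

definition comparison_counit ::
  "('o1, 'm1) category \<Rightarrow> ('o2, 'm2) category \<Rightarrow> ('m1 \<Rightarrow> 'm1 \<Rightarrow> 'm1) \<Rightarrow>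
   ('o1, 'm1, 'o2, 'm2) func \<Rightarrow> ('o2, 'm2, 'o1, 'm1) func \<Rightarrow> ('o1 \<Rightarrow> 'm1) \<Rightarrow>
   ('o2 \<Rightarrow> 'm2) \<Rightarrow> 'o2 \<times> 'm2 \<Rightarrow> ('o2 \<times> 'm2, 'm2) arrow" where
  "comparison_counit N M E L R \<eta> \<epsilon> A =
     \<lparr>src = fob (Can N L \<eta>) (fob (V_func N E R \<eta>) A), tgt = A,
      dat = \<epsilon> (fst A) \<cdot>\<^bsub>M\<^esub> far L (V_incl E R \<eta> A)\<rparr>"


section \<open>Pointed simplicial sets\<close>

text \<open>
  The simplices of all simplicial sets are taken from the type \<open>'a elem\<close>, which plays the role of
  a universe of size \<open>max(\<aleph>\<^sub>0, |'a|)\<close>: every simplicial set of at most this size is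
  isomorphic to one with simplices in \<open>'a elem\<close>, and smash products stay inside the universe.
\<close>

datatype 'a elem =
    Pt
  | Atom 'a
  | Vertex nat
  | Smash "'a elem" "'a elem"
  | Tup "'a elem list"

text \<open>The maps \<open>[m] \<rightarrow> [n]\<close> of the simplex category.\<close>

definition Delta :: "nat \<Rightarrow> nat \<Rightarrow> (nat \<Rightarrow> nat) set" where
  "Delta m n = {\<theta> \<in> {..m} \<rightarrow>\<^sub>E {..n}. mono_on {..m} \<theta>}"

text \<open>
  \<open>sact X m n \<theta>\<close> is the map \<open>X\<^sub>n \<rightarrow> X\<^sub>m\<close> induced by \<open>\<theta> : [m] \<rightarrow> [n]\<close>, and \<open>pt X n\<close> is the base
  point in dimension \<open>n\<close>.  Values off the simplices are unconstrained, so records that differ only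
  there are distinct but isomorphic objects; maps, on the other hand, are extensional, so that
  equality of maps is equality on simplices.
\<close>

record 'a psset =
  simp :: "nat \<Rightarrow> 'a elem set"
  sact :: "nat \<Rightarrow> nat \<Rightarrow> (nat \<Rightarrow> nat) \<Rightarrow> 'a elem \<Rightarrow> 'a elem"
  pt :: "nat \<Rightarrow> 'a elem"

definition is_psset :: "'a psset \<Rightarrow> bool" where
  "is_psset X \<longleftrightarrow>
     (\<forall>m n. \<forall>\<theta>\<in>Delta m n. \<forall>x\<in>simp X n. sact X m n \<theta> x \<in> simp X m) \<and>
     (\<forall>n. \<forall>x\<in>simp X n. sact X n n (restrict id {..n}) x = x) \<and>
     (\<forall>l m n. \<forall>\<phi>\<in>Delta l m. \<forall>\<theta>\<in>Delta m n. \<forall>x\<in>simp X n.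
        sact X l n (compose {..l} \<theta> \<phi>) x = sact X l m \<phi> (sact X m n \<theta> x)) \<and>
     (\<forall>n. pt X n \<in> simp X n) \<and>
     (\<forall>m n. \<forall>\<theta>\<in>Delta m n. sact X m n \<theta> (pt X n) = pt X m)"

type_synonym 'a psmap = "('a psset, nat \<Rightarrow> 'a elem \<Rightarrow> 'a elem) arrow"

definition is_psmap :: "'a psmap \<Rightarrow> bool" where
  "is_psmap f \<longleftrightarrow> is_psset (src f) \<and> is_psset (tgt f) \<and>
     (\<forall>n. dat f n \<in> simp (src f) n \<rightarrow>\<^sub>E simp (tgt f) n) \<and>
     (\<forall>n. dat f n (pt (src f) n) = pt (tgt f) n) \<and>
     (\<forall>m n. \<forall>\<theta>\<in>Delta m n. \<forall>x\<in>simp (src f) n.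
        dat f m (sact (src f) m n \<theta> x) = sact (tgt f) m n \<theta> (dat f n x))"

definition psset_id :: "'a psset \<Rightarrow> 'a psmap" where
  "psset_id X = \<lparr>src = X, tgt = X, dat = (\<lambda>n. restrict id (simp X n))\<rparr>"

definition psset_comp :: "'a psmap \<Rightarrow> 'a psmap \<Rightarrow> 'a psmap" (infixl "\<circ>\<^sub>s" 70) where
  "g \<circ>\<^sub>s f = \<lparr>src = src f, tgt = tgt g, dat = (\<lambda>n. compose (simp (src f) n) (dat g n) (dat f n))\<rparr>"

definition sSet_pt :: "('a psset, 'a psmap) category" where
  "sSet_pt = \<lparr>Ob = {X. is_psset X}, Ar = {f. is_psmap f}, Dm = src, Cd = tgt,
              Idt = psset_id, Cmp = psset_comp\<rparr>"

definition psset_equalizer :: "'a psmap \<Rightarrow> 'a psmap \<Rightarrow> 'a psmap" where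
  "psset_equalizer f g =
     (let U = (src f)\<lparr>simp := \<lambda>n. {x \<in> simp (src f) n. dat f n x = dat g n x}\<rparr>
      in \<lparr>src = U, tgt = src f, dat = (\<lambda>n. restrict id (simp U n))\<rparr>)"

lemma psset_equalizer_is_equalizer:
  assumes "f \<in> Hom sSet_pt X Y" "g \<in> Hom sSet_pt X Y"
  shows "is_equalizer sSet_pt f g (psset_equalizer f g)"
proof -
  have f: "is_psmap f" "src f = X" "tgt f = Y" and g: "is_psmap g" "src g = X" "tgt g = Y"
    using assms by (auto simp: Hom_def sSet_pt_def)
  define U where "U = X\<lparr>simp := \<lambda>n. {x \<in> simp X n. dat f n x = dat g n x}\<rparr>"
  have U: "simp U n = {x \<in> simp X n. dat f n x = dat g n x}" "sact U = sact X" "pt U = pt X" for n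
    by (simp_all add: U_def)
  define e where "e = psset_equalizer f g"
  have e: "src e = U" "tgt e = X" "dat e n = restrict id (simp U n)" for n
    by (simp_all add: e_def psset_equalizer_def U_def f Let_def)
  have psX: "is_psset X" using f unfolding is_psmap_def by auto
  have fg: "dat f m (sact X m n \<theta> x) = dat g m (sact X m n \<theta> x)"
    if "\<theta> \<in> Delta m n" "x \<in> simp X n" "dat f n x = dat g n x" for m n \<theta> x
    using f g that unfolding is_psmap_def by metis
  have pt_eq: "dat f n (pt X n) = dat g n (pt X n)" for n
    using f g unfolding is_psmap_def by metis
  have psU: "is_psset U"
    using psX fg pt_eq unfolding is_psset_def U by simp
  have pse: "is_psmap e"
    using psX psU unfolding is_psmap_def e is_psset_def U by (auto simp: U)
  have feq: "f \<circ>\<^sub>s e = g \<circ>\<^sub>s e"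
    unfolding psset_comp_def e f g by (auto simp: U compose_def restrict_def fun_eq_iff)
  have "\<exists>!h. h \<in> Hom sSet_pt (src k) U \<and> e \<circ>\<^sub>s h = k"
    if k: "is_psmap k" "tgt k = X" and eq: "f \<circ>\<^sub>s k = g \<circ>\<^sub>s k" for k
  proof (rule ex1I)
    have kX: "dat k n x \<in> simp X n" if "x \<in> simp (src k) n" for n x
      using k that unfolding is_psmap_def by blast
    have kU: "dat k n x \<in> simp U n" if "x \<in> simp (src k) n" for n x
    proof -
      have "dat (f \<circ>\<^sub>s k) n x = dat (g \<circ>\<^sub>s k) n x" using eq by simp
      then show ?thesis using that kX[OF that] by (simp add: psset_comp_def compose_def U)
    qed
    have kE: "dat k n \<in> extensional (simp (src k) n)" for n
      using k unfolding is_psmap_def PiE_def by blast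
    let ?h = "k\<lparr>tgt := U\<rparr>"
    have "is_psmap ?h"
      using k psU kU kE unfolding is_psmap_def U(2,3) by (auto simp: PiE_def U(2,3))
    moreover have "dat (e \<circ>\<^sub>s ?h) n = dat k n" for n
      by (rule extensionalityI[of _ "simp (src k) n"])
        (use kU kE in \<open>auto simp: psset_comp_def compose_def e\<close>)
    then have "e \<circ>\<^sub>s ?h = k"
      using k(2) by (cases k) (simp add: psset_comp_def e fun_eq_iff)
    ultimately show "?h \<in> Hom sSet_pt (src k) U \<and> e \<circ>\<^sub>s ?h = k"
      by (simp add: Hom_def sSet_pt_def)
    fix h assume h: "h \<in> Hom sSet_pt (src k) U \<and> e \<circ>\<^sub>s h = k"
    then have h': "is_psmap h" "src h = src k" "tgt h = U" by (auto simp: Hom_def sSet_pt_def)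
    have hU: "dat h n x \<in> simp U n" if "x \<in> simp (src k) n" for n x
      using h' that unfolding is_psmap_def by (metis PiE_mem)
    have hE: "dat h n \<in> extensional (simp (src k) n)" for n
      using h' unfolding is_psmap_def PiE_def by auto
    have "dat h n = dat k n" for n
    proof (rule extensionalityI[OF hE kE])
      fix x assume x: "x \<in> simp (src k) n"
      have "dat (e \<circ>\<^sub>s h) n x = dat k n x" using h by simp
      then show "dat h n x = dat k n x"
        using x hU[OF x] by (simp add: psset_comp_def compose_def e h')
    qed
    then show "h = ?h" using h' by (cases h; cases k) auto
  qed
  then show ?thesis
    using pse feq unfolding is_equalizer_def e_def[symmetric]
    by (simp add: sSet_pt_def e f)
qed

text \<open>The image of \<open>(x, y)\<close> in \<open>X \<and> Y\<close>, in dimension \<open>n\<close>.\<close>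

definition smash_elt :: "'a psset \<Rightarrow> 'a psset \<Rightarrow> nat \<Rightarrow> 'a elem \<Rightarrow> 'a elem \<Rightarrow> 'a elem" where
  "smash_elt X Y n x y = (if x = pt X n \<or> y = pt Y n then Pt else Smash x y)"

definition smash :: "'a psset \<Rightarrow> 'a psset \<Rightarrow> 'a psset" where
  "smash X Y =
     \<lparr>simp = (\<lambda>n. {smash_elt X Y n x y | x y. x \<in> simp X n \<and> y \<in> simp Y n}),
      sact = (\<lambda>m n \<theta> z. case z of
                  Smash x y \<Rightarrow> smash_elt X Y m (sact X m n \<theta> x) (sact Y m n \<theta> y)
                | _ \<Rightarrow> Pt),
      pt = (\<lambda>n. Pt)\<rparr>"

definition smash_map :: "'a psmap \<Rightarrow> 'a psmap \<Rightarrow> 'a psmap" where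
  "smash_map f g =
     \<lparr>src = smash (src f) (src g), tgt = smash (tgt f) (tgt g),
      dat = (\<lambda>n. \<lambda>z\<in>simp (smash (src f) (src g)) n. case z of
                 Smash x y \<Rightarrow> smash_elt (tgt f) (tgt g) n (dat f n x) (dat g n y)
               | _ \<Rightarrow> Pt)\<rparr>"

text \<open>
  The \<open>p\<close>-fold smash power \<open>S \<and> \<dots> \<and> S\<close>, as the quotient of the \<open>p\<close>-fold cartesian power by the
  tuples that contain a base point; \<open>tup_elt S n ss\<close> is the image of the tuple \<open>ss\<close>.  For \<open>p = 0\<close>
  this is the unit \<open>S\<^sup>0\<close> of the smash product.
\<close>

definition tup_elt :: "'a psset \<Rightarrow> nat \<Rightarrow> 'a elem list \<Rightarrow> 'a elem" where
  "tup_elt S n ss = (if pt S n \<in> set ss then Pt else Tup ss)"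

definition smash_power :: "'a psset \<Rightarrow> nat \<Rightarrow> 'a psset" where
  "smash_power S p =
     \<lparr>simp = (\<lambda>n. insert Pt {tup_elt S n ss | ss. length ss = p \<and> set ss \<subseteq> simp S n}),
      sact = (\<lambda>m n \<theta> z. case z of
                  Tup ss \<Rightarrow> tup_elt S m (map (sact S m n \<theta>) ss)
                | _ \<Rightarrow> Pt),
      pt = (\<lambda>n. Pt)\<rparr>"

text \<open>
  The left action of \<open>\<pi> \<in> \<Sigma>\<^sub>p\<close>, moving the factor in position \<open>i\<close> to position \<open>\<pi> i\<close>
  (positions \<open>0, \<dots>, p - 1\<close>).
\<close>

definition smash_power_perm :: "'a psset \<Rightarrow> nat \<Rightarrow> (nat \<Rightarrow> nat) \<Rightarrow> 'a psmap" where
  "smash_power_perm S p \<pi> =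
     \<lparr>src = smash_power S p, tgt = smash_power S p,
      dat = (\<lambda>n. \<lambda>z\<in>simp (smash_power S p) n. case z of
                 Tup ss \<Rightarrow> Tup (permute_list (inv_into UNIV \<pi>) ss)
               | _ \<Rightarrow> Pt)\<rparr>"


section \<open>Simplicial models of the circle\<close>

text \<open>
  The geometric realization is the quotient of the disjoint union of the \<open>{n} \<times> {x} \<times> \<Delta>\<^sup>n\<close>,
  \<open>x \<in> X\<^sub>n\<close>, that identifies \<open>(n, x, \<theta>\<^sub>* t)\<close> with \<open>(m, \<theta>\<^sup>* x, t)\<close> for \<open>\<theta> : [m] \<rightarrow> [n]\<close>.
\<close>

definition simplex_push :: "nat \<Rightarrow> (nat \<Rightarrow> nat) \<Rightarrow> (nat \<Rightarrow> real) \<Rightarrow> nat \<Rightarrow> real" where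
  "simplex_push m \<theta> t = (\<lambda>j. \<Sum>i\<in>{i. i \<le> m \<and> \<theta> i = j}. t i)"

inductive realization_glue ::
  "'a psset \<Rightarrow> nat \<times> 'a elem \<times> (nat \<Rightarrow> real) \<Rightarrow> nat \<times> 'a elem \<times> (nat \<Rightarrow> real) \<Rightarrow> bool"
  for X where
  "\<lbrakk>\<theta> \<in> Delta m n; x \<in> simp X n; t \<in> standard_simplex m\<rbrakk> \<Longrightarrow>
     realization_glue X (n, x, simplex_push m \<theta> t) (m, sact X m n \<theta> x, t)"

definition realization_class ::
  "'a psset \<Rightarrow> nat \<Rightarrow> 'a elem \<Rightarrow> (nat \<Rightarrow> real) \<Rightarrow> (nat \<times> 'a elem \<times> (nat \<Rightarrow> real)) set" where
  "realization_class X n x t = {q. equivclp (realization_glue X) (n, x, t) q}"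

definition realization_points :: "'a psset \<Rightarrow> (nat \<times> 'a elem \<times> (nat \<Rightarrow> real)) set set" where
  "realization_points X =
     {realization_class X n x t | n x t. x \<in> simp X n \<and> t \<in> standard_simplex n}"

definition realization_open :: "'a psset \<Rightarrow> (nat \<times> 'a elem \<times> (nat \<Rightarrow> real)) set set \<Rightarrow> bool" where
  "realization_open X U \<longleftrightarrow> U \<subseteq> realization_points X \<and>
     (\<forall>n. \<forall>x\<in>simp X n.
        openin (subtopology (powertop_real UNIV) (standard_simplex n))
               {t \<in> standard_simplex n. realization_class X n x t \<in> U})"

definition realization :: "'a psset \<Rightarrow> (nat \<times> 'a elem \<times> (nat \<Rightarrow> real)) set topology" where
  "realization X = topology (realization_open X)"

lemma openin_realization: "openin (realization X) = realization_open X"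
proof -
  let ?T = "\<lambda>n. subtopology (powertop_real UNIV) (standard_simplex n)"
  let ?A = "\<lambda>n x U. {t \<in> standard_simplex n. realization_class X n x t \<in> U}"
  have "istopology (realization_open X)"
    unfolding istopology_def
  proof (intro conjI allI impI)
    fix U W assume "realization_open X U" "realization_open X W"
    moreover have "?A n x (U \<inter> W) = ?A n x U \<inter> ?A n x W" for n x by blast
    ultimately show "realization_open X (U \<inter> W)"
      unfolding realization_open_def by auto
  next
    fix \<U> assume *: "Ball \<U> (realization_open X)"
    have "?A n x (\<Union>\<U>) = (\<Union>U\<in>\<U>. ?A n x U)" for n x by blast
    moreover have "openin (?T n) (\<Union>U\<in>\<U>. ?A n x U)" if "x \<in> simp X n" for n x
      using * that unfolding realization_open_def by blast
    ultimately show "realization_open X (\<Union>\<U>)"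
      using * unfolding realization_open_def by auto
  qed
  then show ?thesis unfolding realization_def by (rule topology_inverse')
qed

definition circle_model :: "'a psset \<Rightarrow> bool" where
  "circle_model S \<longleftrightarrow> is_psset S \<and>
     realization S homotopy_equivalent_space top_of_set (sphere (0::complex) 1)"

text \<open>
  The standard model \<open>\<Delta>[1] / \<partial>\<Delta>[1]\<close>: an \<open>n\<close>-simplex of \<open>\<Delta>[1]\<close> is given by the list of its
  \<open>n + 1\<close> vertices, and \<open>circle_elt\<close> collapses the simplices of the boundary.
\<close>

definition circle_elt :: "'a elem list \<Rightarrow> 'a elem" where
  "circle_elt vs = (if \<forall>v\<in>set vs. v = hd vs then Pt else Tup vs)"

definition standard_circle :: "'a psset" where
  "standard_circle =
     \<lparr>simp = (\<lambda>n. {circle_elt (map (\<lambda>i. Vertex (\<alpha> i)) [0..<Suc n]) | \<alpha>. \<alpha> \<in> Delta n 1}),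
      sact = (\<lambda>m n \<theta> z. case z of
                  Tup vs \<Rightarrow> circle_elt (map (\<lambda>i. vs ! \<theta> i) [0..<Suc m])
                | _ \<Rightarrow> Pt),
      pt = (\<lambda>n. Pt)\<rparr>"


definition circle_simplex :: "nat \<Rightarrow> (nat \<Rightarrow> nat) \<Rightarrow> 'a elem" where
  "circle_simplex n \<alpha> = circle_elt (map (\<lambda>i. Vertex (\<alpha> i)) [0..<Suc n])"

definition vertices_const :: "nat \<Rightarrow> (nat \<Rightarrow> nat) \<Rightarrow> bool" where
  "vertices_const n \<alpha> \<longleftrightarrow> (\<exists>c. \<forall>i\<le>n. \<alpha> i = c)"

lemma circle_simplex_eq: "circle_simplex n \<alpha> = (if vertices_const n \<alpha> then Pt else Tup (map (\<lambda>i. Vertex (\<alpha> i) :: 'a elem) [0..<Suc n]))"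
proof -
  let ?vs = "map (\<lambda>i. Vertex (\<alpha> i) :: 'a elem) [0..<Suc n]"
  have h: "hd ?vs = Vertex (\<alpha> 0)" by (simp add: hd_map del: upt_Suc)
  have s: "set ?vs = (\<lambda>i. Vertex (\<alpha> i)) ` {..n}" by (simp add: atLeast0LessThan lessThan_Suc_atMost del: upt_Suc)
  have "(\<forall>v\<in>set ?vs. v = Vertex c) \<longleftrightarrow> (\<forall>i\<le>n. \<alpha> i = c)" for c :: nat unfolding s by blast
  moreover have "(\<forall>i\<le>n. \<alpha> i = \<alpha> 0) \<longleftrightarrow> vertices_const n \<alpha>" unfolding vertices_const_def by (metis le0)
  ultimately have "(\<forall>v\<in>set ?vs. v = hd ?vs) \<longleftrightarrow> vertices_const n \<alpha>" unfolding h by blast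
  then show ?thesis unfolding circle_simplex_def circle_elt_def by (simp only:)
qed

lemma simp_standard_circle: "simp standard_circle n = circle_simplex n ` Delta n 1"
  by (auto simp: standard_circle_def circle_simplex_def)

lemma circle_simplex_cong: "(\<And>i. i \<le> n \<Longrightarrow> \<alpha> i = \<beta> i) \<Longrightarrow> circle_simplex n \<alpha> = circle_simplex n \<beta>"
  unfolding circle_simplex_def by (intro arg_cong[where f=circle_elt] map_cong refl) (simp add: less_Suc_eq_le del: upt_Suc)

lemma Delta_le: "\<theta> \<in> Delta m n \<Longrightarrow> i \<le> m \<Longrightarrow> \<theta> i \<le> n"
  by (auto simp: Delta_def)

lemma sact_standard_circle:
  assumes "\<theta> \<in> Delta m n"
  shows "sact standard_circle m n \<theta> (circle_simplex n \<alpha>) = (circle_simplex m (\<lambda>i. \<alpha> (\<theta> i)) :: 'a elem)"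
proof (cases "vertices_const n \<alpha>")
  case True
  then have "vertices_const m (\<lambda>i. \<alpha> (\<theta> i))" using Delta_le[OF assms] unfolding vertices_const_def by blast
  with True show ?thesis by (simp add: circle_simplex_eq standard_circle_def)
next
  case False
  have "map (\<lambda>i. map (\<lambda>i. Vertex (\<alpha> i)) [0..<Suc n] ! \<theta> i) [0..<Suc m] = map (\<lambda>i. Vertex (\<alpha> (\<theta> i)) :: 'a elem) [0..<Suc m]"
    using Delta_le[OF assms] by (auto simp: nth_map less_Suc_eq_le simp del: upt_Suc)
  moreover have "circle_simplex n \<alpha> = Tup (map (\<lambda>i. Vertex (\<alpha> i) :: 'a elem) [0..<Suc n])" using False by (simp add: circle_simplex_eq del: upt_Suc)
  ultimately have "sact standard_circle m n \<theta> (circle_simplex n \<alpha> :: 'a elem) = circle_elt (map (\<lambda>i. Vertex (\<alpha> (\<theta> i))) [0..<Suc m])"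
    by (simp only: standard_circle_def psset.simps elem.case)
  then show ?thesis by (simp only: circle_simplex_def)
qed

lemma Delta_compose:
  assumes "\<phi> \<in> Delta l m" "\<theta> \<in> Delta m n" shows "compose {..l} \<theta> \<phi> \<in> Delta l n"
  using assms by (auto simp: Delta_def mono_on_def compose_def PiE_iff Pi_iff)

lemma is_psset_standard_circle: "is_psset standard_circle"
  unfolding is_psset_def
proof (intro conjI allI ballI)
  fix m n \<theta> and x :: "'a elem" assume t: "\<theta> \<in> Delta m n" "x \<in> simp standard_circle n"
  then obtain \<alpha> where a: "x = circle_simplex n \<alpha>" "\<alpha> \<in> Delta n 1" by (auto simp: simp_standard_circle)
  have "sact standard_circle m n \<theta> x = circle_simplex m (compose {..m} \<alpha> \<theta>)"
    unfolding a sact_standard_circle[OF t(1)] by (rule circle_simplex_cong) (simp add: compose_def)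
  then show "sact standard_circle m n \<theta> x \<in> simp standard_circle m"
    using Delta_compose[OF t(1) a(2)] by (simp add: simp_standard_circle)
next
  fix n and x :: "'a elem" assume "x \<in> simp standard_circle n"
  then obtain \<alpha> where a: "x = circle_simplex n \<alpha>" by (auto simp: simp_standard_circle)
  have "restrict id {..n} \<in> Delta n n" by (auto simp: Delta_def mono_on_def)
  then show "sact standard_circle n n (restrict id {..n}) x = x"
    unfolding a by (subst sact_standard_circle) (auto intro: circle_simplex_cong)
next
  fix l m n \<phi> \<theta> and x :: "'a elem"
  assume t: "\<phi> \<in> Delta l m" "\<theta> \<in> Delta m n" "x \<in> simp standard_circle n"
  then obtain \<alpha> where a: "x = circle_simplex n \<alpha>" by (auto simp: simp_standard_circle)
  show "sact standard_circle l n (compose {..l} \<theta> \<phi>) x =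
      sact standard_circle l m \<phi> (sact standard_circle m n \<theta> x)"
    unfolding a sact_standard_circle[OF t(1)] sact_standard_circle[OF t(2)] sact_standard_circle[OF Delta_compose[OF t(1,2)]]
    by (rule circle_simplex_cong) (simp add: compose_def)
next
  fix n
  have "vertices_const n (\<lambda>i\<in>{..n}. 0)" unfolding vertices_const_def by (rule exI[of _ 0]) simp
  then have "circle_simplex n (\<lambda>i\<in>{..n}. 0) = (Pt :: 'a elem)" by (simp add: circle_simplex_eq)
  moreover have "(\<lambda>i\<in>{..n}. 0) \<in> Delta n 1" by (auto simp: Delta_def mono_on_def)
  ultimately have "(Pt :: 'a elem) \<in> circle_simplex n ` Delta n 1" by (metis imageI)
  then show "pt standard_circle n \<in> simp (standard_circle :: 'a psset) n"
    unfolding simp_standard_circle by (simp add: standard_circle_def)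
qed (auto simp: standard_circle_def)

text \<open>
  The homeomorphism from the realization to the circle sends the class of \<open>(n, \<alpha>, t)\<close> to
  \<open>exp (2 \<pi> i s)\<close>, where \<open>s\<close> is the sum of the \<open>t i\<close> with \<open>\<alpha> i = 1\<close>.
\<close>

definition upper_weight :: "nat \<Rightarrow> (nat \<Rightarrow> nat) \<Rightarrow> (nat \<Rightarrow> real) \<Rightarrow> real" where
  "upper_weight n \<alpha> t = (\<Sum>i\<le>n. if \<alpha> i = 1 then t i else 0)"

fun circle_angle :: "nat \<times> 'a elem \<times> (nat \<Rightarrow> real) \<Rightarrow> complex" where
  "circle_angle (n, Tup vs, t) = cis (2 * pi * (\<Sum>i\<le>n. if vs ! i = Vertex 1 then t i else 0))"
| "circle_angle (n, _, t) = 1"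

lemma circle_angle_simplex:
  assumes "\<alpha> \<in> Delta n 1" "t \<in> standard_simplex n"
  shows "circle_angle (n, circle_simplex n \<alpha> :: 'a elem, t) = cis (2 * pi * upper_weight n \<alpha> t)"
proof (cases "vertices_const n \<alpha>")
  case True
  then obtain c where c: "\<And>i. i \<le> n \<Longrightarrow> \<alpha> i = c" by (auto simp: vertices_const_def)
  have "c = 0 \<or> c = 1" using Delta_le[OF assms(1), of 0] c[of 0] by auto
  moreover have "upper_weight n \<alpha> t = (\<Sum>i\<le>n. if c = 1 then t i else 0)"
    unfolding upper_weight_def using c by (intro sum.cong) auto
  ultimately have "upper_weight n \<alpha> t = 0 \<or> upper_weight n \<alpha> t = 1" using assms(2) by (auto simp: standard_simplex_def)
  then have "cis (2 * pi * upper_weight n \<alpha> t) = 1" by auto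
  with True show ?thesis by (simp add: circle_simplex_eq)
next
  case False
  then have "circle_simplex n \<alpha> = Tup (map (\<lambda>i. Vertex (\<alpha> i) :: 'a elem) [0..<Suc n])" by (simp add: circle_simplex_eq del: upt_Suc)
  moreover have "(\<Sum>i\<le>n. if map (\<lambda>i. Vertex (\<alpha> i) :: 'a elem) [0..<Suc n] ! i = Vertex 1 then t i else 0) = upper_weight n \<alpha> t"
    unfolding upper_weight_def by (intro sum.cong) (auto simp: nth_map less_Suc_eq_le simp del: upt_Suc)
  ultimately show ?thesis by (simp only: circle_angle.simps)
qed

lemma simplex_push_sum:
  assumes "\<And>i. i \<le> m \<Longrightarrow> \<theta> i \<le> n"
  shows "(\<Sum>j\<le>n. if P j then simplex_push m \<theta> t j else 0) = (\<Sum>i\<le>m. if P (\<theta> i) then t i else 0)"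
proof -
  have "(\<Sum>j\<le>n. if P j then simplex_push m \<theta> t j else 0) = (\<Sum>j\<le>n. \<Sum>i\<in>{i \<in> {..m}. \<theta> i = j}. if P (\<theta> i) then t i else 0)"
  proof (rule sum.cong[OF refl])
    fix j assume "j \<in> {..n}"
    have "{i. i \<le> m \<and> \<theta> i = j} = {i \<in> {..m}. \<theta> i = j}" by auto
    then show "(if P j then simplex_push m \<theta> t j else 0) = (\<Sum>i\<in>{i \<in> {..m}. \<theta> i = j}. if P (\<theta> i) then t i else 0)"
      unfolding simplex_push_def by (cases "P j") simp_all
  qed
  also have "\<dots> = (\<Sum>i\<le>m. if P (\<theta> i) then t i else 0)"
    by (rule sum.group) (use assms in auto)
  finally show ?thesis .
qed

lemma simplex_push_in:
  assumes "\<theta> \<in> Delta m n" "t \<in> standard_simplex m"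
  shows "simplex_push m \<theta> t \<in> standard_simplex n"
proof -
  have t: "0 \<le> t i" "(\<Sum>i\<le>m. t i) = 1" for i using assms by (auto simp: standard_simplex_def)
  have "simplex_push m \<theta> t j \<le> (\<Sum>i\<le>m. t i)" for j
    unfolding simplex_push_def by (rule sum_mono2) (use t in auto)
  moreover have "0 \<le> simplex_push m \<theta> t j" for j unfolding simplex_push_def by (rule sum_nonneg) (use t in auto)
  moreover have "simplex_push m \<theta> t j = 0" if "j > n" for j
    unfolding simplex_push_def using that Delta_le[OF assms(1)] by (intro sum.neutral) force
  moreover have "(\<Sum>j\<le>n. simplex_push m \<theta> t j) = 1"
    using simplex_push_sum[of m \<theta> n "\<lambda>_. True" t] Delta_le[OF assms(1)] t by simp
  ultimately show ?thesis using t by (simp add: standard_simplex_def)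
qed

lemma circle_angle_glue:
  assumes "realization_glue standard_circle p q" shows "circle_angle p = circle_angle q"
  using assms
proof cases
  case (1 \<theta> m n x t)
  then obtain \<alpha> where a: "x = circle_simplex n \<alpha>" "\<alpha> \<in> Delta n 1" by (auto simp: simp_standard_circle)
  have s: "sact standard_circle m n \<theta> x = circle_simplex m (compose {..m} \<alpha> \<theta>)"
    unfolding a sact_standard_circle[OF 1(3)] by (rule circle_simplex_cong) (simp add: compose_def)
  have "upper_weight n \<alpha> (simplex_push m \<theta> t) = upper_weight m (compose {..m} \<alpha> \<theta>) t"
    unfolding upper_weight_def using Delta_le[OF 1(3)] by (subst simplex_push_sum) (auto simp: compose_def intro!: sum.cong)
  then show ?thesis unfolding 1(1,2) s
    by (simp add: a circle_angle_simplex[OF a(2) simplex_push_in[OF 1(3,5)]] circle_angle_simplex[OF Delta_compose[OF 1(3) a(2)] 1(5)])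
qed

lemma circle_angle_equiv: "equivclp (realization_glue standard_circle) p q \<Longrightarrow> circle_angle p = circle_angle q"
  by (induction rule: equivclp_induct) (auto dest: circle_angle_glue)

definition edge_pt :: "real \<Rightarrow> nat \<Rightarrow> real" where
  "edge_pt s = (\<lambda>i. if i = 0 then 1 - s else if i = 1 then s else 0)"

definition edge_class :: "real \<Rightarrow> (nat \<times> 'a elem \<times> (nat \<Rightarrow> real)) set" where
  "edge_class s = realization_class standard_circle 1 (circle_simplex 1 (restrict id {..1})) (edge_pt s)"

lemma edge_pt_in: "s \<in> {0..1} \<Longrightarrow> edge_pt s \<in> standard_simplex 1"
  by (auto simp: standard_simplex_def edge_pt_def)

lemma realization_class_eqI: 
  assumes "realization_glue X (n, x, t) (m, y, u)"
  shows "realization_class X n x t = realization_class X m y u"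
proof -
  have e: "equivclp (realization_glue X) (n, x, t) (m, y, u)" using assms by (rule r_into_equivclp)
  have "equivclp (realization_glue X) (n, x, t) q \<longleftrightarrow> equivclp (realization_glue X) (m, y, u) q" for q
    using equivclp_trans[OF e, of q] equivclp_trans[OF equivclp_sym[OF e], of q] by (rule iffI[rotated])
  then show ?thesis unfolding realization_class_def by (rule Collect_cong)
qed

lemma Delta_id_1: "restrict id {..1} \<in> Delta (1::nat) 1" by (auto simp: Delta_def mono_on_def)

lemma upper_weight_bounds: assumes "t \<in> standard_simplex n" shows "upper_weight n \<alpha> t \<in> {0..1}"
proof -
  have t: "0 \<le> t i" "(\<Sum>i\<le>n. t i) = 1" for i using assms by (auto simp: standard_simplex_def)
  have "upper_weight n \<alpha> t \<le> (\<Sum>i\<le>n. t i)" unfolding upper_weight_def by (rule sum_mono) (use t in auto)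
  moreover have "0 \<le> upper_weight n \<alpha> t" unfolding upper_weight_def by (rule sum_nonneg) (use t in auto)
  ultimately show ?thesis using t by simp
qed

lemma realization_class_edge:
  assumes "\<alpha> \<in> Delta n 1" "t \<in> standard_simplex n"
  shows "realization_class standard_circle n (circle_simplex n \<alpha> :: 'a elem) t = edge_class (upper_weight n \<alpha> t)"
proof -
  have p: "simplex_push n \<alpha> t \<in> standard_simplex 1" by (rule simplex_push_in[OF assms])
  have 1: "simplex_push n \<alpha> t 1 = upper_weight n \<alpha> t"
    unfolding simplex_push_def upper_weight_def by (subst sum.inter_filter[symmetric]) (auto intro!: sum.cong)
  have "simplex_push n \<alpha> t 0 + simplex_push n \<alpha> t 1 = 1" using p by (simp add: standard_simplex_def)
  moreover have "simplex_push n \<alpha> t i = 0" if "i > 1" for i using p that by (simp add: standard_simplex_def)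
  ultimately have e: "simplex_push n \<alpha> t = edge_pt (upper_weight n \<alpha> t)"
    using 1 by (auto simp: edge_pt_def fun_eq_iff)
  have "sact standard_circle n 1 \<alpha> (circle_simplex 1 (restrict id {..1}) :: 'a elem) = circle_simplex n \<alpha>"
    unfolding sact_standard_circle[OF assms(1)] by (rule circle_simplex_cong) (use Delta_le[OF assms(1)] in auto)
  moreover have "realization_glue standard_circle (1, circle_simplex 1 (restrict id {..1}) :: 'a elem, simplex_push n \<alpha> t)
     (n, sact standard_circle n 1 \<alpha> (circle_simplex 1 (restrict id {..1})), t)"
    using Delta_id_1 assms by (intro realization_glue.intros) (auto simp: simp_standard_circle)
  ultimately show ?thesis unfolding edge_class_def e by (metis realization_class_eqI)
qed

lemma edge_ends: "edge_class 0 = (edge_class 1 :: (nat \<times> 'a elem \<times> (nat \<Rightarrow> real)) set)"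
proof -
  let ?t = "\<lambda>i::nat. if i = 0 then 1 else 0 :: real"
  have t: "?t \<in> standard_simplex 0" by (auto simp: standard_simplex_def)
  have c: "(\<lambda>i\<in>{..0}. c) \<in> Delta 0 1" if "c \<le> 1" for c using that by (auto simp: Delta_def mono_on_def)
  have "realization_class standard_circle 0 (circle_simplex 0 (\<lambda>i\<in>{..0}. c) :: 'a elem) ?t = edge_class (if c = 1 then 1 else 0)" if "c \<le> 1" for c
    using realization_class_edge[OF c[OF that] t] unfolding upper_weight_def by (cases "c = 1") simp_all
  from this[of 0] this[of 1] show ?thesis by (simp add: circle_simplex_eq vertices_const_def)
qed

lemma realization_points_circle: "realization_points standard_circle = edge_class ` {0..1}"
proof (intro subset_antisym subsetI)
  fix c :: "(nat \<times> 'a elem \<times> (nat \<Rightarrow> real)) set"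
  assume "c \<in> realization_points standard_circle"
  then obtain n \<alpha> t where "c = realization_class standard_circle n (circle_simplex n \<alpha>) t" and h: "\<alpha> \<in> Delta n 1" "t \<in> standard_simplex n"
    unfolding realization_points_def simp_standard_circle by blast
  then have "c = edge_class (upper_weight n \<alpha> t)" using realization_class_edge[OF h] by simp
  then show "c \<in> edge_class ` {0..1}" using upper_weight_bounds[OF h(2)] by blast
next
  fix c :: "(nat \<times> 'a elem \<times> (nat \<Rightarrow> real)) set"
  assume "c \<in> edge_class ` {0..1}"
  then obtain s where "c = edge_class s" "s \<in> {0..1}" by blast
  then show "c \<in> realization_points standard_circle"
    using edge_pt_in[of s] Delta_id_1 unfolding realization_points_def edge_class_def simp_standard_circle by blast
qed

definition circle_coord :: "(nat \<times> 'a elem \<times> (nat \<Rightarrow> real)) set \<Rightarrow> complex" where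
  "circle_coord c = circle_angle (SOME q. q \<in> c)"

lemma circle_coord_class: "circle_coord (realization_class standard_circle n x t) = circle_angle (n, x, t)"
proof -
  have "(n, x, t) \<in> realization_class standard_circle n x t" by (simp add: realization_class_def)
  then have "(SOME q. q \<in> realization_class standard_circle n x t) \<in> realization_class standard_circle n x t" by (rule someI)
  then have "equivclp (realization_glue standard_circle) (n, x, t) (SOME q. q \<in> realization_class standard_circle n x t)"
    unfolding realization_class_def by (rule CollectD)
  then show ?thesis unfolding circle_coord_def using circle_angle_equiv by metis
qed

lemma circle_coord_edge: "s \<in> {0..1} \<Longrightarrow> circle_coord (edge_class s) = cis (2 * pi * s)"
proof -
  assume s: "s \<in> {0..1}"
  have "upper_weight 1 (restrict id {..1}) (edge_pt s) = s" by (simp add: upper_weight_def edge_pt_def)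
  then show ?thesis using circle_angle_simplex[OF Delta_id_1 edge_pt_in[OF s]] unfolding edge_class_def circle_coord_class by (simp only:)
qed

lemma topspace_realization: "topspace (realization X) = realization_points X"
proof -
  have "realization_open X (realization_points X)"
  proof -
    have "{t \<in> standard_simplex n. realization_class X n x t \<in> realization_points X} = standard_simplex n" if "x \<in> simp X n" for n x
      using that by (auto simp: realization_points_def)
    moreover have "openin (subtopology (powertop_real UNIV) (standard_simplex n)) (standard_simplex n)" for n
      using openin_topspace[of "subtopology (powertop_real UNIV) (standard_simplex n)"] by (simp add: topspace_subtopology)
    ultimately show ?thesis unfolding realization_open_def by simp
  qed
  moreover have "U \<subseteq> realization_points X" if "realization_open X U" for U
    using that unfolding realization_open_def by (rule conjunct1)
  ultimately show ?thesis
    unfolding topspace_def openin_realization by blast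
qed

lemma circle_coord_continuous: "continuous_map (realization standard_circle) (top_of_set (sphere 0 1)) circle_coord"
proof -
  have "continuous_map (realization (standard_circle::'a psset)) euclidean circle_coord"
    unfolding continuous_map_def
  proof (intro conjI allI impI)
    fix U :: "complex set" assume "openin euclidean U"
    have c: "openin (subtopology (powertop_real UNIV) (standard_simplex n)) {t \<in> standard_simplex n. cis (2 * pi * upper_weight n \<alpha> t) \<in> U}" for n \<alpha>
    proof -
      have "continuous_map (powertop_real UNIV) euclideanreal (upper_weight n \<alpha>)"
        unfolding upper_weight_def [abs_def]
        by (intro continuous_map_sum) (auto intro: continuous_map_product_projection)
      then have "continuous_map (powertop_real UNIV) euclidean ((\<lambda>x. cis (2 * pi * x)) \<circ> upper_weight n \<alpha>)"
        by (rule continuous_map_compose) (auto intro!: continuous_intros)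
      then have "continuous_map (subtopology (powertop_real UNIV) (standard_simplex n)) euclidean ((\<lambda>x. cis (2 * pi * x)) \<circ> upper_weight n \<alpha>)"
        by (rule continuous_map_from_subtopology)
      then show ?thesis using \<open>openin euclidean U\<close>
        unfolding continuous_map_def by (auto simp: topspace_subtopology PiE_def)
    qed
    have "{t \<in> standard_simplex n. realization_class standard_circle n x t \<in> {c \<in> realization_points standard_circle. circle_coord c \<in> U}} = {t \<in> standard_simplex n. cis (2 * pi * upper_weight n \<alpha> t) \<in> U}"
      if "x = circle_simplex n \<alpha>" "\<alpha> \<in> Delta n 1" for n \<alpha> and x :: "'a elem"
      using that by (auto simp: circle_coord_class circle_angle_simplex realization_points_def simp_standard_circle)
    then show "openin (realization (standard_circle::'a psset)) {c \<in> topspace (realization standard_circle). circle_coord c \<in> U}"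
      unfolding topspace_realization openin_realization realization_open_def simp_standard_circle
      using c by (auto 0 0 simp del: One_nat_def mem_Collect_eq)
  qed simp
  moreover have "circle_coord \<in> topspace (realization (standard_circle::'a psset)) \<rightarrow> sphere 0 1"
    by (auto simp: topspace_realization realization_points_circle circle_coord_edge)
  ultimately show ?thesis by (simp add: continuous_map_in_subtopology)
qed

lemma compact_realization_circle: "compact_space (realization standard_circle)"
proof -
  have e: "continuous_map (top_of_set {0..1}) (subtopology (powertop_real UNIV) (standard_simplex 1)) edge_pt"
    unfolding continuous_map_in_subtopology continuous_map_componentwise_UNIV
  proof (intro conjI allI)
    show "edge_pt \<in> topspace (top_of_set {0..1}) \<rightarrow> standard_simplex 1"
      unfolding topspace_euclidean_subtopology by (rule funcsetI) (rule edge_pt_in)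
    fix k :: nat
    have "k = 0 \<or> k = 1 \<or> k > 1" by linarith
    then show "continuous_map (top_of_set {0..1}) euclideanreal (\<lambda>x. edge_pt x k)"
      by (auto simp: edge_pt_def intro!: continuous_intros)
  qed
  have "continuous_map (top_of_set {0..1}) (realization (standard_circle::'a psset)) edge_class"
    unfolding continuous_map_def
  proof (intro conjI allI impI)
    show "edge_class \<in> topspace (top_of_set {0..1}) \<rightarrow> topspace (realization (standard_circle::'a psset))"
      by (auto simp: topspace_realization realization_points_circle)
    fix U :: "(nat \<times> 'a elem \<times> (nat \<Rightarrow> real)) set set"
    assume "openin (realization standard_circle) U"
    then have "openin (subtopology (powertop_real UNIV) (standard_simplex 1))
      {t \<in> standard_simplex 1. realization_class standard_circle 1 (circle_simplex 1 (restrict id {..1})) t \<in> U}"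
      using Delta_id_1 unfolding openin_realization realization_open_def simp_standard_circle by blast
    from openin_continuous_map_preimage[OF e this]
    have "openin (top_of_set {0..1}) {s \<in> {0..1}. edge_class s \<in> U}"
      by (rule back_subst[of "openin _"]) (use edge_pt_in in \<open>auto simp: edge_class_def simp del: One_nat_def\<close>)
    then show "openin (top_of_set {0..1}) {s \<in> topspace (top_of_set {0..1}). edge_class s \<in> U}" by simp
  qed
  then have "compactin (realization (standard_circle::'a psset)) (edge_class ` {0..1})"
    by (rule image_compactin[rotated]) (simp add: compactin_subtopology)
  then show ?thesis by (simp add: compact_space_def topspace_realization realization_points_circle)
qed

lemma circle_model_standard: "circle_model standard_circle"
proof -
  have "homeomorphic_map (realization (standard_circle::'a psset)) (top_of_set (sphere 0 1)) circle_coord"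
  proof (rule continuous_imp_homeomorphic_map[OF circle_coord_continuous compact_realization_circle])
    show "Hausdorff_space (top_of_set (sphere (0::complex) 1))" by (simp add: Hausdorff_space_subtopology)
    show "circle_coord ` topspace (realization (standard_circle::'a psset)) = topspace (top_of_set (sphere 0 1))"
    proof
      show "circle_coord ` topspace (realization (standard_circle::'a psset)) \<subseteq> topspace (top_of_set (sphere 0 1))"
        by (auto simp: topspace_realization realization_points_circle circle_coord_edge)
      show "topspace (top_of_set (sphere 0 1)) \<subseteq> circle_coord ` topspace (realization (standard_circle::'a psset))"
      proof
        fix z :: complex assume "z \<in> topspace (top_of_set (sphere 0 1))"
        then have "norm z = 1" by simp
        then obtain a where a: "0 \<le> a" "a < 2 * pi" "z = cis a"
          using complex_unimodular_polar[of z] by (metis cis.code)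
        then have "z = circle_coord (edge_class (a / (2 * pi)) :: (nat \<times> 'a elem \<times> (nat \<Rightarrow> real)) set)" "a / (2 * pi) \<in> {0..1}"
          by (auto simp: circle_coord_edge)
        then show "z \<in> circle_coord ` topspace (realization (standard_circle::'a psset))"
          by (auto simp: topspace_realization realization_points_circle)
      qed
    qed
    have inj: "edge_class s = (edge_class u :: (nat \<times> 'a elem \<times> (nat \<Rightarrow> real)) set)" 
      if su: "s \<in> {0..1}" "u \<in> {0..1}" and cis: "cis (2 * pi * s) = cis (2 * pi * u)" for s u
    proof -
      have "sin (2 * pi * s) = sin (2 * pi * u) \<and> cos (2 * pi * s) = cos (2 * pi * u)"
        using arg_cong[OF cis, of Re] arg_cong[OF cis, of Im] by (simp only: cis.sel simp_thms)
      then obtain k :: int where "2 * pi * s = 2 * pi * u + 2 * pi * k" unfolding sin_cos_eq_iff by blast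
      then have "2 * pi * s = 2 * pi * (u + k)" by (simp add: algebra_simps)
      then have k: "s = u + k" using pi_gt_zero by (simp only: mult_cancel_left) simp
      then have "real_of_int k \<le> 1" "-1 \<le> real_of_int k" using su by auto
      then have "k = 0 \<or> k = 1 \<or> k = -1" by linarith
      with k su have "s = u \<or> s = 1 \<and> u = 0 \<or> s = 0 \<and> u = 1" by auto
      then show ?thesis using edge_ends by metis
    qed
    show "inj_on circle_coord (topspace (realization (standard_circle::'a psset)))"
      unfolding topspace_realization realization_points_circle
    proof (rule inj_onI, elim imageE)
      fix c d :: "(nat \<times> 'a elem \<times> (nat \<Rightarrow> real)) set" and s u
      assume "circle_coord c = circle_coord d" and h: "c = edge_class s" "s \<in> {0..1}" "d = edge_class u" "u \<in> {0..1}"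
      then have "cis (2 * pi * s) = cis (2 * pi * u)" by (simp only: circle_coord_edge)
      with inj h show "c = d" by blast
    qed
  qed
  then show ?thesis
    unfolding circle_model_def using is_psset_standard_circle
    by (blast intro: homeomorphic_imp_homotopy_equivalent_space homeomorphic_map_imp_homeomorphic_space)
qed


section \<open>Symmetric spectra\<close>

text \<open>
  Levels \<open>X\<^sub>n\<close>, left actions of \<open>\<Sigma>\<^sub>n\<close> (permutations of \<open>{..<n}\<close>) and structure maps
  \<open>X\<^sub>n \<and> S \<rightarrow> X\<^sub>n\<^sub>+\<^sub>1\<close>.  The sphere acts from the right, so that the suspension spectrum of \<open>X\<close> is
  \<open>X \<and> S \<and> \<dots> \<and> S\<close> with \<open>\<Sigma>\<^sub>n\<close> permuting the \<open>n\<close> factors \<open>S\<close>.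
\<close>

record 'a spectrum =
  lev :: "nat \<Rightarrow> 'a psset"
  perm :: "nat \<Rightarrow> (nat \<Rightarrow> nat) \<Rightarrow> 'a psmap"
  str :: "nat \<Rightarrow> 'a psmap"

text \<open>
  The iterated structure map \<open>X\<^sub>n \<and> S\<^sup>p \<rightarrow> X\<^sub>n\<^sub>+\<^sub>1 \<and> S\<^sup>p\<^sup>-\<^sup>1 \<rightarrow> \<dots> \<rightarrow> X\<^sub>n\<^sub>+\<^sub>p\<close>, first on the
  simplices \<open>x \<and> s\<^sub>1 \<and> \<dots> \<and> s\<^sub>p\<close> of dimension \<open>k\<close> and then as a map.
\<close>

fun iter_elt ::
  "'a psset \<Rightarrow> 'a spectrum \<Rightarrow> nat \<Rightarrow> nat \<Rightarrow> 'a elem \<Rightarrow> 'a elem list \<Rightarrow> 'a elem" where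
  "iter_elt S X k n x [] = x"
| "iter_elt S X k n x (s # ss) =
     iter_elt S X k (Suc n) (dat (str X n) k (smash_elt (lev X n) S k x s)) ss"

definition iter_str :: "'a psset \<Rightarrow> 'a spectrum \<Rightarrow> nat \<Rightarrow> nat \<Rightarrow> 'a psmap" where
  "iter_str S X n p =
     \<lparr>src = smash (lev X n) (smash_power S p), tgt = lev X (n + p),
      dat = (\<lambda>k. \<lambda>z\<in>simp (smash (lev X n) (smash_power S p)) k. case z of
                 Smash x (Tup ss) \<Rightarrow> iter_elt S X k n x ss
               | _ \<Rightarrow> pt (lev X (n + p)) k)\<rparr>"

text \<open>The inclusion \<open>\<Sigma>\<^sub>n \<times> \<Sigma>\<^sub>p \<rightarrow> \<Sigma>\<^sub>n\<^sub>+\<^sub>p\<close>.\<close>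

definition block_perm :: "nat \<Rightarrow> (nat \<Rightarrow> nat) \<Rightarrow> (nat \<Rightarrow> nat) \<Rightarrow> nat \<Rightarrow> nat" where
  "block_perm n \<pi> \<rho> = (\<lambda>i. if i < n then \<pi> i else n + \<rho> (i - n))"

definition is_spectrum :: "'a psset \<Rightarrow> 'a spectrum \<Rightarrow> bool" where
  "is_spectrum S X \<longleftrightarrow>
     (\<forall>n. lev X n \<in> Ob sSet_pt) \<and>
     (\<forall>n. str X n \<in> Hom sSet_pt (smash (lev X n) S) (lev X (Suc n))) \<and>
     (\<forall>n \<pi>. \<pi> permutes {..<n} \<longrightarrow> perm X n \<pi> \<in> Hom sSet_pt (lev X n) (lev X n)) \<and>
     (\<forall>n. perm X n id = psset_id (lev X n)) \<and>
     (\<forall>n \<pi> \<rho>. \<pi> permutes {..<n} \<and> \<rho> permutes {..<n} \<longrightarrow>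
        perm X n (\<pi> \<circ> \<rho>) = perm X n \<pi> \<circ>\<^sub>s perm X n \<rho>) \<and>
     (\<forall>n p \<pi> \<rho>. \<pi> permutes {..<n} \<and> \<rho> permutes {..<p} \<longrightarrow>
        iter_str S X n p \<circ>\<^sub>s smash_map (perm X n \<pi>) (smash_power_perm S p \<rho>) =
        perm X (n + p) (block_perm n \<pi> \<rho>) \<circ>\<^sub>s iter_str S X n p)"

type_synonym 'a spmap = "('a spectrum, nat \<Rightarrow> 'a psmap) arrow"

definition is_spmap :: "'a psset \<Rightarrow> 'a spmap \<Rightarrow> bool" where
  "is_spmap S f \<longleftrightarrow> is_spectrum S (src f) \<and> is_spectrum S (tgt f) \<and>
     (\<forall>n. dat f n \<in> Hom sSet_pt (lev (src f) n) (lev (tgt f) n)) \<and>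
     (\<forall>n \<pi>. \<pi> permutes {..<n} \<longrightarrow>
        dat f n \<circ>\<^sub>s perm (src f) n \<pi> = perm (tgt f) n \<pi> \<circ>\<^sub>s dat f n) \<and>
     (\<forall>n. dat f (Suc n) \<circ>\<^sub>s str (src f) n = str (tgt f) n \<circ>\<^sub>s smash_map (dat f n) (psset_id S))"

definition Sp_Sigma :: "'a psset \<Rightarrow> ('a spectrum, 'a spmap) category" where
  "Sp_Sigma S =
     \<lparr>Ob = {X. is_spectrum S X}, Ar = {f. is_spmap S f}, Dm = src, Cd = tgt,
      Idt = (\<lambda>X. \<lparr>src = X, tgt = X, dat = (\<lambda>n. psset_id (lev X n))\<rparr>),
      Cmp = (\<lambda>g f. \<lparr>src = src f, tgt = tgt g, dat = (\<lambda>n. dat g n \<circ>\<^sub>s dat f n)\<rparr>)\<rparr>"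

definition susp_spectrum :: "'a psset \<Rightarrow> 'a psset \<Rightarrow> 'a spectrum" where
  "susp_spectrum S X =
     \<lparr>lev = (\<lambda>n. smash X (smash_power S n)),
      perm = (\<lambda>n \<pi>. smash_map (psset_id X) (smash_power_perm S n \<pi>)),
      str = (\<lambda>n. \<lparr>src = smash (smash X (smash_power S n)) S,
                  tgt = smash X (smash_power S (Suc n)),
                  dat = (\<lambda>k. \<lambda>z\<in>simp (smash (smash X (smash_power S n)) S) k. case z of
                             Smash (Smash x (Tup ss)) s \<Rightarrow> Smash x (Tup (ss @ [s]))
                           | _ \<Rightarrow> Pt)\<rparr>)\<rparr>"

definition Susp :: "'a psset \<Rightarrow> ('a psset, 'a psmap, 'a spectrum, 'a spmap) func" where
  "Susp S =
     \<lparr>fob = susp_spectrum S,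
      far = (\<lambda>f. \<lparr>src = susp_spectrum S (src f), tgt = susp_spectrum S (tgt f),
                  dat = (\<lambda>n. smash_map f (psset_id (smash_power S n)))\<rparr>)\<rparr>"

definition Ev0 :: "('a spectrum, 'a spmap, 'a psset, 'a psmap) func" where
  "Ev0 = \<lparr>fob = (\<lambda>X. lev X 0), far = (\<lambda>f. dat f 0)\<rparr>"

text \<open>The unit is the canonical isomorphism \<open>X \<cong> X \<and> S\<^sup>0\<close>.\<close>

definition susp_unit :: "'a psset \<Rightarrow> 'a psset \<Rightarrow> 'a psmap" where
  "susp_unit S X =
     \<lparr>src = X, tgt = smash X (smash_power S 0),
      dat = (\<lambda>n. \<lambda>x\<in>simp X n. smash_elt X (smash_power S 0) n x (Tup []))\<rparr>"

definition susp_counit :: "'a psset \<Rightarrow> 'a spectrum \<Rightarrow> 'a spmap" where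
  "susp_counit S Y =
     \<lparr>src = susp_spectrum S (lev Y 0), tgt = Y, dat = (\<lambda>n. iter_str S Y 0 n)\<rparr>"

end

theory Submission
  imports Defs
begin

text \<open>
  The unit \<open>X \<rightarrow> X \<and> S\<^sup>0\<close> of the suspension spectrum adjunction is an isomorphism.  For any
  adjunction with invertible unit \<open>\<eta>\<close>, both \<open>R \<delta>\<close> and \<open>\<eta> (R Y)\<close> are inverse to \<open>R (\<epsilon> Y)\<close> when \<open>(Y, \<delta>)\<close> is a coalgebra.  So they
  are equal, their equalizer is an isomorphism, and naturality of \<open>\<epsilon>\<close> makes \<open>\<delta>\<close> inverse to \<open>\<epsilon> Y\<close>.  Hence
  the unit and counit of the comparison adjunction are invertible.
\<close>

section \<open>Comonadicity of coreflections\<close>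

text \<open>An invertible unit makes \<open>L\<close> fully faithful and \<open>N\<close> a
  coreflective part of \<open>M\<close>: carrying a coaction is then a property of an object and not
  extra structure. For suspension spectra the unit is invertible because the right adjoint is plain
  evaluation, without loop spaces or a colimit, and because \<open>S^0\<close> is neutral for the
  smash product. The comparison adjunction is set up for any adjunction with chosen equalizers;
  invertibility of the unit enters only after that. The longer task is to show that suspension and
  evaluation are adjoint in the encoded categories. There a smash power is a single quotient of
  tuples instead of an iterated binary product, so that structure maps append to lists, permutations
  permute lists, and equations of maps become equations of lists.\<close>

lemma category_HomD:
  assumes "is_category C" "f \<in> Hom C a b"
  shows "a \<in> Ob C" "b \<in> Ob C" "f \<in> Ar C" "Dm C f = a" "Cd C f = b"
  using assms unfolding is_category_def Hom_def by auto

lemma category_id: "is_category C \<Longrightarrow> a \<in> Ob C \<Longrightarrow> Idt C a \<in> Hom C a a"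
  by (auto simp: is_category_def)

text \<open>The ends of an arrow lie in \<open>Ob\<close>, so the object premises of the axioms
  follow from membership in a hom-set. This lemma and the laws below therefore ask for arrows
  only.\<close>

lemma category_comp:
  assumes "is_category C" "f \<in> Hom C a b" "g \<in> Hom C b c"
  shows "g \<cdot>\<^bsub>C\<^esub> f \<in> Hom C a c"
proof -
  have "\<forall>a\<in>Ob C. \<forall>b\<in>Ob C. \<forall>c\<in>Ob C. \<forall>f\<in>Hom C a b. \<forall>g\<in>Hom C b c. g \<cdot>\<^bsub>C\<^esub> f \<in> Hom C a c"
    using assms(1) unfolding is_category_def by (elim conjE)
  then show ?thesis
    using category_HomD[OF assms(1,2)] category_HomD[OF assms(1,3)] assms(2,3) by blast
qed

lemma category_id_right:
  assumes "is_category C" "f \<in> Hom C a b" shows "f \<cdot>\<^bsub>C\<^esub> Idt C a = f"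
proof -
  have "\<forall>a\<in>Ob C. \<forall>b\<in>Ob C. \<forall>f\<in>Hom C a b. f \<cdot>\<^bsub>C\<^esub> Idt C a = f \<and> Idt C b \<cdot>\<^bsub>C\<^esub> f = f"
    using assms(1) unfolding is_category_def by (elim conjE)
  then show ?thesis using category_HomD[OF assms] assms(2) by blast
qed

lemma category_id_left:
  assumes "is_category C" "f \<in> Hom C a b" shows "Idt C b \<cdot>\<^bsub>C\<^esub> f = f"
proof -
  have "\<forall>a\<in>Ob C. \<forall>b\<in>Ob C. \<forall>f\<in>Hom C a b. f \<cdot>\<^bsub>C\<^esub> Idt C a = f \<and> Idt C b \<cdot>\<^bsub>C\<^esub> f = f"
    using assms(1) unfolding is_category_def by (elim conjE)
  then show ?thesis using category_HomD[OF assms] assms(2) by blast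
qed

text \<open>Oriented against the axiom, so that its instances rewrite composites to right-nested
  form.\<close>

lemma category_assoc:
  assumes "is_category C" "f \<in> Hom C a b" "g \<in> Hom C b c" "h \<in> Hom C c d"
  shows "(h \<cdot>\<^bsub>C\<^esub> g) \<cdot>\<^bsub>C\<^esub> f = h \<cdot>\<^bsub>C\<^esub> (g \<cdot>\<^bsub>C\<^esub> f)"
proof -
  have "\<forall>a\<in>Ob C. \<forall>b\<in>Ob C. \<forall>c\<in>Ob C. \<forall>d\<in>Ob C. \<forall>f\<in>Hom C a b. \<forall>g\<in>Hom C b c. \<forall>h\<in>Hom C c d.
        h \<cdot>\<^bsub>C\<^esub> (g \<cdot>\<^bsub>C\<^esub> f) = (h \<cdot>\<^bsub>C\<^esub> g) \<cdot>\<^bsub>C\<^esub> f"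
    using assms(1) unfolding is_category_def by (elim conjE)
  then show ?thesis
    using category_HomD[OF assms(1,2)] category_HomD[OF assms(1,4)] category_HomD[OF assms(1,3)]
      assms(2-4) by simp
qed

lemma is_isoI:
  assumes "f \<in> Hom C a b" "g \<in> Hom C b a" "g \<cdot>\<^bsub>C\<^esub> f = Idt C a" "f \<cdot>\<^bsub>C\<^esub> g = Idt C b"
  shows "is_iso C f"
  using assms unfolding is_iso_def Hom_def by auto

lemma is_isoE:
  assumes "is_iso C f" "f \<in> Hom C a b"
  obtains g where "g \<in> Hom C b a" "g \<cdot>\<^bsub>C\<^esub> f = Idt C a" "f \<cdot>\<^bsub>C\<^esub> g = Idt C b"
  using assms unfolding is_iso_def Hom_def by auto

section \<open>Functors and natural transformations\<close>

lemma functor_ob: "is_functor C D F \<Longrightarrow> a \<in> Ob C \<Longrightarrow> fob F a \<in> Ob D"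
  by (simp add: is_functor_def)

lemma functor_id: "is_functor C D F \<Longrightarrow> a \<in> Ob C \<Longrightarrow> far F (Idt C a) = Idt D (fob F a)"
  by (simp add: is_functor_def)

lemma functor_ar:
  assumes "is_functor C D F" "f \<in> Hom C a b"
  shows "far F f \<in> Hom D (fob F a) (fob F b)"
proof -
  have "is_category C" "\<forall>a\<in>Ob C. \<forall>b\<in>Ob C. \<forall>f\<in>Hom C a b. far F f \<in> Hom D (fob F a) (fob F b)"
    using assms(1) unfolding is_functor_def by blast+
  then show ?thesis using category_HomD[OF _ assms(2)] assms(2) by blast
qed

lemma functor_comp:
  assumes "is_functor C D F" "f \<in> Hom C a b" "g \<in> Hom C b c"
  shows "far F (g \<cdot>\<^bsub>C\<^esub> f) = far F g \<cdot>\<^bsub>D\<^esub> far F f"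
proof -
  have "is_category C" "\<forall>a\<in>Ob C. \<forall>b\<in>Ob C. \<forall>c\<in>Ob C. \<forall>f\<in>Hom C a b. \<forall>g\<in>Hom C b c.
        far F (g \<cdot>\<^bsub>C\<^esub> f) = far F g \<cdot>\<^bsub>D\<^esub> far F f"
    using assms(1) unfolding is_functor_def by blast+
  then show ?thesis using category_HomD[OF _ assms(2)] category_HomD[OF _ assms(3)] assms(2,3) by blast
qed

lemma is_functorI:
  assumes "is_category C" "is_category D"
    and "\<And>a. a \<in> Ob C \<Longrightarrow> fob F a \<in> Ob D"
    and "\<And>a b f. f \<in> Hom C a b \<Longrightarrow> far F f \<in> Hom D (fob F a) (fob F b)"
    and "\<And>a. a \<in> Ob C \<Longrightarrow> far F (Idt C a) = Idt D (fob F a)"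
    and "\<And>a b c f g. f \<in> Hom C a b \<Longrightarrow> g \<in> Hom C b c \<Longrightarrow>
           far F (g \<cdot>\<^bsub>C\<^esub> f) = far F g \<cdot>\<^bsub>D\<^esub> far F f"
  shows "is_functor C D F"
  unfolding is_functor_def using assms by blast

lemma functor_compose:
  assumes "is_functor C D F" "is_functor D E G"
  shows "is_functor C E (G \<circ>\<^sub>F F)"
proof (rule is_functorI)
  show "is_category C" "is_category E" using assms by (auto simp: is_functor_def)
qed (use assms in \<open>auto simp: comp_func_def functor_ob functor_id functor_comp[of C D F]
      functor_comp[of D E G] intro!: functor_ar[of D E G] dest: functor_ar[of C D F]
      functor_comp[of D E G, OF _ functor_ar[of C D F] functor_ar[of C D F]]\<close>)

lemma id_functor: "is_category C \<Longrightarrow> is_functor C C id_func"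
  by (auto intro!: is_functorI simp: id_func_def)

lemma is_naturalI:
  assumes "is_functor C D F" "is_functor C D G"
    and "\<And>a. a \<in> Ob C \<Longrightarrow> \<tau> a \<in> Hom D (fob F a) (fob G a)"
    and "\<And>a b f. f \<in> Hom C a b \<Longrightarrow> \<tau> b \<cdot>\<^bsub>D\<^esub> far F f = far G f \<cdot>\<^bsub>D\<^esub> \<tau> a"
  shows "is_natural C D F G \<tau>"
  unfolding is_natural_def using assms by blast

lemma natural_square:
  assumes "is_natural C D F G \<tau>" "f \<in> Hom C a b"
  shows "\<tau> b \<cdot>\<^bsub>D\<^esub> far F f = far G f \<cdot>\<^bsub>D\<^esub> \<tau> a"
proof -
  have "is_category C" "\<forall>a\<in>Ob C. \<forall>b\<in>Ob C. \<forall>f\<in>Hom C a b. \<tau> b \<cdot>\<^bsub>D\<^esub> far F f = far G f \<cdot>\<^bsub>D\<^esub> \<tau> a"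
    using assms(1) unfolding is_natural_def is_functor_def by blast+
  then show ?thesis using category_HomD[OF _ assms(2)] assms(2) by blast
qed

lemma is_iso_comp:
  assumes C: "is_category C" and f: "f \<in> Hom C a b" and g: "g \<in> Hom C b c"
    and "is_iso C f" "is_iso C g"
  shows "is_iso C (g \<cdot>\<^bsub>C\<^esub> f)"
proof -
  obtain f' where f': "f' \<in> Hom C b a" "f' \<cdot>\<^bsub>C\<^esub> f = Idt C a" "f \<cdot>\<^bsub>C\<^esub> f' = Idt C b"
    using is_isoE[OF assms(4) f] .
  obtain g' where g': "g' \<in> Hom C c b" "g' \<cdot>\<^bsub>C\<^esub> g = Idt C b" "g \<cdot>\<^bsub>C\<^esub> g' = Idt C c"
    using is_isoE[OF assms(5) g] .
  show ?thesis
  proof (rule is_isoI[OF category_comp[OF C f g] category_comp[OF C g'(1) f'(1)]])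
    show "f' \<cdot>\<^bsub>C\<^esub> g' \<cdot>\<^bsub>C\<^esub> (g \<cdot>\<^bsub>C\<^esub> f) = Idt C a"
      using category_assoc[OF C category_comp[OF C f g] g'(1) f'(1)] category_assoc[OF C f g g'(1)]
        g'(2) f'(2) category_id_left[OF C f] by simp
    show "g \<cdot>\<^bsub>C\<^esub> f \<cdot>\<^bsub>C\<^esub> (f' \<cdot>\<^bsub>C\<^esub> g') = Idt C c"
      using category_assoc[OF C category_comp[OF C g'(1) f'(1)] f g] category_assoc[OF C g'(1) f'(1) f]
        g'(3) f'(3) category_id_left[OF C g'(1)] by simp
  qed
qed

lemma functor_iso:
  assumes F: "is_functor C D F" and f: "f \<in> Hom C a b" and "is_iso C f"
  shows "is_iso D (far F f)"
proof -
  have C: "is_category C" using F by (simp add: is_functor_def)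
  obtain g where g: "g \<in> Hom C b a" "g \<cdot>\<^bsub>C\<^esub> f = Idt C a" "f \<cdot>\<^bsub>C\<^esub> g = Idt C b"
    using is_isoE[OF assms(3) f] .
  show ?thesis
    by (rule is_isoI[OF functor_ar[OF F f] functor_ar[OF F g(1)]])
      (use functor_comp[OF F f g(1)] functor_comp[OF F g(1) f] g functor_id[OF F] category_HomD[OF C f] in auto)
qed

section \<open>Equalizers\<close>

lemma factor_through:
  assumes "is_equalizer C f g e" "k \<in> Hom C a (Dm C f)" "f \<cdot>\<^bsub>C\<^esub> k = g \<cdot>\<^bsub>C\<^esub> k"
  shows "factor_through C e k \<in> Hom C a (Dm C e)" "e \<cdot>\<^bsub>C\<^esub> factor_through C e k = k"
proof -
  have "\<exists>!h. h \<in> Hom C (Dm C k) (Dm C e) \<and> e \<cdot>\<^bsub>C\<^esub> h = k"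
    using assms unfolding is_equalizer_def Hom_def by blast
  from theI'[OF this] show "factor_through C e k \<in> Hom C a (Dm C e)" "e \<cdot>\<^bsub>C\<^esub> factor_through C e k = k"
    using assms(2) by (auto simp: factor_through_def Hom_def)
qed

text \<open>Both arrows factor the same composite through \<open>e\<close>, and this composite
  equalizes the pair because \<open>e\<close> does; uniqueness of factorizations identifies
  them.\<close>

lemma equalizer_mono:
  assumes "is_category C" "is_equalizer C f g e" "f \<in> Hom C b c" "g \<in> Hom C b c"
    and "h \<in> Hom C a (Dm C e)" "h' \<in> Hom C a (Dm C e)" "e \<cdot>\<^bsub>C\<^esub> h = e \<cdot>\<^bsub>C\<^esub> h'"
  shows "h = h'"
proof -
  have e: "e \<in> Hom C (Dm C e) b" "f \<cdot>\<^bsub>C\<^esub> e = g \<cdot>\<^bsub>C\<^esub> e"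
    using assms(2,3) unfolding is_equalizer_def Hom_def by auto
  let ?k = "e \<cdot>\<^bsub>C\<^esub> h"
  have k: "?k \<in> Hom C a b" using category_comp[OF assms(1,5) e(1)] .
  have "f \<cdot>\<^bsub>C\<^esub> ?k = g \<cdot>\<^bsub>C\<^esub> ?k"
    using category_assoc[OF assms(1,5) e(1)] assms(3,4) e(2) by metis
  then have "\<exists>!h. h \<in> Hom C (Dm C ?k) (Dm C e) \<and> e \<cdot>\<^bsub>C\<^esub> h = ?k"
    using assms(2,3) k unfolding is_equalizer_def Hom_def by blast
  moreover have "Dm C ?k = a" using k by (simp add: Hom_def)
  ultimately show ?thesis using assms(5-7) by metis
qed

text \<open>Every arrow into \<open>b\<close> equalizes \<open>f\<close> with itself, in particular
  the identity. Its factorization through \<open>e\<close> is a section of \<open>e\<close>, hence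
  an inverse, since \<open>e\<close> is monic.\<close>

lemma equalizer_same_iso:
  assumes C: "is_category C" and e: "is_equalizer C f f e" and f: "f \<in> Hom C b c"
  shows "is_iso C e"
proof -
  have b: "b \<in> Ob C" "Dm C f = b" using category_HomD[OF C f] by auto
  have eH: "e \<in> Hom C (Dm C e) b" using e f unfolding is_equalizer_def Hom_def by auto
  note ib = category_id[OF C b(1)]
  let ?g = "factor_through C e (Idt C b)"
  have g: "?g \<in> Hom C b (Dm C e)" "e \<cdot>\<^bsub>C\<^esub> ?g = Idt C b"
    using factor_through[OF e] ib b by auto
  have "e \<cdot>\<^bsub>C\<^esub> (?g \<cdot>\<^bsub>C\<^esub> e) = e \<cdot>\<^bsub>C\<^esub> Idt C (Dm C e)"
    using category_assoc[OF C eH g(1) eH] g(2) category_id_left[OF C eH] category_id_right[OF C eH] by simp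
  then have "?g \<cdot>\<^bsub>C\<^esub> e = Idt C (Dm C e)"
    using equalizer_mono[OF C e f f category_comp[OF C eH g(1)]] category_id[OF C] category_HomD[OF C eH]
    by blast
  then show ?thesis using is_isoI[OF eH g(1)] g(2) by blast
qed

text \<open>\<open>E\<close> is a choice of equalizers in \<open>N\<close>, which makes
  \<open>V\<close> a definite functor. Invertibility of \<eta> is not part of the locale, because
  the comparison adjunction exists for every adjunction of this kind; the results on equivalence add
  it as a premise.\<close>

locale comparison =
  fixes N :: "('o1, 'm1) category" and M :: "('o2, 'm2) category"
    and L :: "('o1, 'm1, 'o2, 'm2) func" and R :: "('o2, 'm2, 'o1, 'm1) func"
    and \<eta> :: "'o1 \<Rightarrow> 'm1" and \<epsilon> :: "'o2 \<Rightarrow> 'm2" and E :: "'m1 \<Rightarrow> 'm1 \<Rightarrow> 'm1"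
  assumes adj: "is_adjunction N M L R \<eta> \<epsilon>"
    and eqz: "\<And>f g a b. f \<in> Hom N a b \<Longrightarrow> g \<in> Hom N a b \<Longrightarrow> is_equalizer N f g (E f g)"
begin

lemma functors: "is_functor N M L" "is_functor M N R"
  using adj by (auto simp: is_adjunction_def)

lemma cats: "is_category N" "is_category M"
  using functors by (auto simp: is_functor_def)

abbreviation K where "K \<equiv> adj_comonad L R \<eta> \<epsilon>"

lemma K_simps:
  "fob (cm_fun K) Y = fob L (fob R Y)" "far (cm_fun K) f = far L (far R f)"
  "cm_comult K Y = far L (\<eta> (fob R Y))" "cm_counit K Y = \<epsilon> Y"
  by (auto simp: adj_comonad_def comp_func_def)

lemmas Nc = category_comp[OF cats(1)] and Mc = category_comp[OF cats(2)]
lemmas Na = category_assoc[OF cats(1)] and Ma = category_assoc[OF cats(2)]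
lemmas Ni = category_id[OF cats(1)] and Mi = category_id[OF cats(2)]
lemmas Lar = functor_ar[OF functors(1)] and Rar = functor_ar[OF functors(2)]
lemmas Lcomp = functor_comp[OF functors(1)] and Rcomp = functor_comp[OF functors(2)]

lemma eta: "X \<in> Ob N \<Longrightarrow> \<eta> X \<in> Hom N X (fob R (fob L X))"
  using adj by (auto simp: is_adjunction_def is_natural_def id_func_def comp_func_def)

lemma eps: "Y \<in> Ob M \<Longrightarrow> \<epsilon> Y \<in> Hom M (fob L (fob R Y)) Y"
  using adj by (auto simp: is_adjunction_def is_natural_def id_func_def comp_func_def)

lemma eta_nat: "f \<in> Hom N X X' \<Longrightarrow> \<eta> X' \<cdot>\<^bsub>N\<^esub> f = far R (far L f) \<cdot>\<^bsub>N\<^esub> \<eta> X"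
  using adj natural_square[of N N id_func "R \<circ>\<^sub>F L" \<eta> f X X']
  by (simp add: is_adjunction_def id_func_def comp_func_def)

lemma eps_nat: "f \<in> Hom M Y Y' \<Longrightarrow> \<epsilon> Y' \<cdot>\<^bsub>M\<^esub> far L (far R f) = f \<cdot>\<^bsub>M\<^esub> \<epsilon> Y"
  using adj natural_square[of M M "L \<circ>\<^sub>F R" id_func \<epsilon> f Y Y']
  by (simp add: is_adjunction_def id_func_def comp_func_def)

lemma triangle_L: "X \<in> Ob N \<Longrightarrow> \<epsilon> (fob L X) \<cdot>\<^bsub>M\<^esub> far L (\<eta> X) = Idt M (fob L X)"
  using adj by (simp add: is_adjunction_def)

lemma triangle_R: "Y \<in> Ob M \<Longrightarrow> far R (\<epsilon> Y) \<cdot>\<^bsub>N\<^esub> \<eta> (fob R Y) = Idt N (fob R Y)"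
  using adj by (simp add: is_adjunction_def)

section \<open>Coalgebras and their morphisms\<close>

lemma coalgD:
  assumes "is_coalgebra M K (Y, \<delta>)"
  shows "Y \<in> Ob M" "fob R Y \<in> Ob N" "\<delta> \<in> Hom M Y (fob L (fob R Y))"
    "far L (far R \<delta>) \<cdot>\<^bsub>M\<^esub> \<delta> = far L (\<eta> (fob R Y)) \<cdot>\<^bsub>M\<^esub> \<delta>" "\<epsilon> Y \<cdot>\<^bsub>M\<^esub> \<delta> = Idt M Y"
  using assms functor_ob[OF functors(2)] by (auto simp: is_coalgebra_def K_simps)

lemma Hom_coAlg:
  "f \<in> Hom (coAlg M K) (Y, \<delta>) (Y', \<delta>') \<longleftrightarrow>
     is_coalgebra M K (Y, \<delta>) \<and> is_coalgebra M K (Y', \<delta>') \<and> src f = (Y, \<delta>) \<and> tgt f = (Y', \<delta>') \<and>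
     dat f \<in> Hom M Y Y' \<and> far L (far R (dat f)) \<cdot>\<^bsub>M\<^esub> \<delta> = \<delta>' \<cdot>\<^bsub>M\<^esub> dat f"
  by (auto simp: Hom_def coAlg_def K_simps)

lemma coAlg_id: "is_coalgebra M K (Y, \<delta>) \<Longrightarrow> Idt (coAlg M K) (Y, \<delta>) \<in> Hom (coAlg M K) (Y, \<delta>) (Y, \<delta>)"
  unfolding Hom_coAlg using coalgD[of Y \<delta>]
  by (auto simp: coAlg_def Mi functor_id[OF functors(1)] functor_id[OF functors(2)]
      category_id_left[OF cats(2)] category_id_right[OF cats(2)])

lemma coAlg_comp:
  assumes f: "f \<in> Hom (coAlg M K) A B" and g: "g \<in> Hom (coAlg M K) B C"
  shows "g \<cdot>\<^bsub>coAlg M K\<^esub> f \<in> Hom (coAlg M K) A C"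
proof -
  obtain Y \<delta> Y' \<delta>' Y'' \<delta>'' where A: "A = (Y, \<delta>)" "B = (Y', \<delta>')" "C = (Y'', \<delta>'')"
    by (metis surj_pair)
  note f = f[unfolded A Hom_coAlg] and g = g[unfolded A Hom_coAlg]
  let ?f = "dat f" and ?g = "dat g" and ?K = "\<lambda>f. far L (far R f)"
  have h: "?f \<in> Hom M Y Y'" "?g \<in> Hom M Y' Y''" "\<delta> \<in> Hom M Y (fob L (fob R Y))"
    "\<delta>' \<in> Hom M Y' (fob L (fob R Y'))" "\<delta>'' \<in> Hom M Y'' (fob L (fob R Y''))"
    using f g coalgD by auto
  note Kf = Lar[OF Rar[OF h(1)]] and Kg = Lar[OF Rar[OF h(2)]]
  have "?K (?g \<cdot>\<^bsub>M\<^esub> ?f) \<cdot>\<^bsub>M\<^esub> \<delta> = ?K ?g \<cdot>\<^bsub>M\<^esub> (?K ?f \<cdot>\<^bsub>M\<^esub> \<delta>)"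
    using Rcomp[OF h(1,2)] Lcomp[OF Rar[OF h(1)] Rar[OF h(2)]] Ma[OF h(3) Kf Kg] by simp
  also have "\<dots> = (?K ?g \<cdot>\<^bsub>M\<^esub> \<delta>') \<cdot>\<^bsub>M\<^esub> ?f" using f Ma[OF h(1,4) Kg] by simp
  also have "\<dots> = \<delta>'' \<cdot>\<^bsub>M\<^esub> (?g \<cdot>\<^bsub>M\<^esub> ?f)" using g Ma[OF h(1,2,5)] by simp
  finally show ?thesis
    unfolding A Hom_coAlg using f g Mc[OF h(1,2)] by (simp add: coAlg_def)
qed

text \<open>The ends recorded in an arrow are fixed by the hom-set, so equations of coalgebra
  morphisms can be checked in \<open>M\<close>.\<close>

lemma coAlg_arrow_eqI:
  assumes "f \<in> Hom (coAlg M K) A B" "g \<in> Hom (coAlg M K) A B" "dat f = dat g"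
  shows "f = g"
  using assms by (cases f; cases g) (auto simp: Hom_def coAlg_def)

lemma dat_coAlg: "dat (Idt (coAlg M K) A) = Idt M (fst A)" "dat (g \<cdot>\<^bsub>coAlg M K\<^esub> f) = dat g \<cdot>\<^bsub>M\<^esub> dat f"
  by (auto simp: coAlg_def)

lemma dat_coAlg_Hom: "f \<in> Hom (coAlg M K) A B \<Longrightarrow> dat f \<in> Hom M (fst A) (fst B)"
  by (auto simp: Hom_def coAlg_def)

lemma coAlg_id': "A \<in> Ob (coAlg M K) \<Longrightarrow> Idt (coAlg M K) A \<in> Hom (coAlg M K) A A"
  using coAlg_id[of "fst A" "snd A"] by (simp add: coAlg_def)

lemma coAlg_category: "is_category (coAlg M K)"
  unfolding is_category_def
proof (intro conjI ballI)
  fix f assume "f \<in> Ar (coAlg M K)"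
  then show "Dm (coAlg M K) f \<in> Ob (coAlg M K)" "Cd (coAlg M K) f \<in> Ob (coAlg M K)"
    by (auto simp: coAlg_def)
next
  fix A assume "A \<in> Ob (coAlg M K)"
  then show "Idt (coAlg M K) A \<in> Hom (coAlg M K) A A" by (rule coAlg_id')
next
  fix A B C f g assume "f \<in> Hom (coAlg M K) A B" "g \<in> Hom (coAlg M K) B C"
  then show "g \<cdot>\<^bsub>coAlg M K\<^esub> f \<in> Hom (coAlg M K) A C" by (rule coAlg_comp)
next
  fix A B f assume o: "A \<in> Ob (coAlg M K)" "B \<in> Ob (coAlg M K)" and f: "f \<in> Hom (coAlg M K) A B"
  note d = dat_coAlg_Hom[OF f]
  show "f \<cdot>\<^bsub>coAlg M K\<^esub> Idt (coAlg M K) A = f"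
    by (rule coAlg_arrow_eqI[OF coAlg_comp[OF coAlg_id'[OF o(1)] f] f])
      (simp add: dat_coAlg category_id_right[OF cats(2) d])
  show "Idt (coAlg M K) B \<cdot>\<^bsub>coAlg M K\<^esub> f = f"
    by (rule coAlg_arrow_eqI[OF coAlg_comp[OF f coAlg_id'[OF o(2)]] f])
      (simp add: dat_coAlg category_id_left[OF cats(2) d])
next
  fix A B C D f g h
  assume f: "f \<in> Hom (coAlg M K) A B" and g: "g \<in> Hom (coAlg M K) B C" and h: "h \<in> Hom (coAlg M K) C D"
  show "h \<cdot>\<^bsub>coAlg M K\<^esub> (g \<cdot>\<^bsub>coAlg M K\<^esub> f) = h \<cdot>\<^bsub>coAlg M K\<^esub> g \<cdot>\<^bsub>coAlg M K\<^esub> f"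
    by (rule coAlg_arrow_eqI[OF coAlg_comp[OF coAlg_comp[OF f g] h] coAlg_comp[OF f coAlg_comp[OF g h]]])
      (simp add: dat_coAlg Ma[OF dat_coAlg_Hom[OF f] dat_coAlg_Hom[OF g] dat_coAlg_Hom[OF h]])
qed

text \<open>The forgetful functor to \<open>M\<close> reflects isomorphisms: composing the square of
  \<open>f\<close> with the inverse on both sides gives the square of the inverse.\<close>

lemma coAlg_isoI:
  assumes f: "f \<in> Hom (coAlg M K) A B" and "is_iso M (dat f)"
  shows "is_iso (coAlg M K) f"
proof -
  obtain Y \<delta> Y' \<delta>' where A: "A = (Y, \<delta>)" "B = (Y', \<delta>')" by (metis surj_pair)
  note f' = f[unfolded A Hom_coAlg]
  let ?f = "dat f" and ?K = "\<lambda>f. far L (far R f)"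
  obtain g where g: "g \<in> Hom M Y' Y" "g \<cdot>\<^bsub>M\<^esub> ?f = Idt M Y" "?f \<cdot>\<^bsub>M\<^esub> g = Idt M Y'"
    using is_isoE[OF assms(2)] f' by metis
  have h: "?f \<in> Hom M Y Y'" "\<delta> \<in> Hom M Y (fob L (fob R Y))" "\<delta>' \<in> Hom M Y' (fob L (fob R Y'))"
    using f' coalgD by auto
  note Kf = Lar[OF Rar[OF h(1)]] and Kg = Lar[OF Rar[OF g(1)]]
  \<comment> \<open>The identity, written as \<open>f\<close> after \<open>g\<close>, is inserted to
    the right of \<delta>', where the morphism equation for \<open>f\<close> applies.\<close>
  have "?K g \<cdot>\<^bsub>M\<^esub> \<delta>' = ?K g \<cdot>\<^bsub>M\<^esub> ((\<delta>' \<cdot>\<^bsub>M\<^esub> ?f) \<cdot>\<^bsub>M\<^esub> g)"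
    using Ma[OF g(1) h(1,3)] g(3) category_id_right[OF cats(2) h(3)] by simp
  also have "\<dots> = ?K g \<cdot>\<^bsub>M\<^esub> (?K ?f \<cdot>\<^bsub>M\<^esub> (\<delta> \<cdot>\<^bsub>M\<^esub> g))"
    using f' Ma[OF g(1) h(2) Kf] by simp
  also have "\<dots> = ?K (g \<cdot>\<^bsub>M\<^esub> ?f) \<cdot>\<^bsub>M\<^esub> (\<delta> \<cdot>\<^bsub>M\<^esub> g)"
    using Rcomp[OF h(1) g(1)] Lcomp[OF Rar[OF h(1)] Rar[OF g(1)]] Ma[OF Mc[OF g(1) h(2)] Kf Kg] by simp
  also have "\<dots> = \<delta> \<cdot>\<^bsub>M\<^esub> g"
    using g(2) category_id_left[OF cats(2) Mc[OF g(1) h(2)]] coalgD(1,2)[of Y \<delta>] f'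
    by (simp add: functor_id[OF functors(1)] functor_id[OF functors(2)])
  finally have G: "\<lparr>src = B, tgt = A, dat = g\<rparr> \<in> Hom (coAlg M K) B A"
    unfolding A Hom_coAlg using f' g by simp
  show ?thesis
    by (rule is_isoI[OF f G]) (use f' g in \<open>simp_all add: coAlg_def A\<close>)
qed

section \<open>The comparison functor\<close>

lemma Can_coalgebra: assumes "X \<in> Ob N" shows "is_coalgebra M K (fob L X, far L (\<eta> X))"
proof -
  note X = assms functor_ob[OF functors(1) assms] eta[OF assms]
  \<comment> \<open>Coassociativity is the image under \<open>L\<close> of naturality of \<eta> at
    the arrow \<eta> \<open>X\<close>. The counit law is the first triangle identity.\<close>
  have "far L (far R (far L (\<eta> X))) \<cdot>\<^bsub>M\<^esub> far L (\<eta> X) = far L (\<eta> (fob R (fob L X))) \<cdot>\<^bsub>M\<^esub> far L (\<eta> X)"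
    using eta_nat[OF X(3)] Lcomp[OF X(3) Rar[OF Lar[OF X(3)]]] 
      Lcomp[OF X(3) eta[OF functor_ob[OF functors(2) X(2)]]] by simp
  then show ?thesis
    using X(2) Lar[OF X(3)] triangle_L[OF X(1)] by (simp add: is_coalgebra_def K_simps)
qed

lemma Can_simps: "fob (Can N L \<eta>) X = (fob L X, far L (\<eta> X))" "dat (far (Can N L \<eta>) f) = far L f"
  by (auto simp: Can_def)

lemma Can_ar:
  assumes f: "f \<in> Hom N X X'"
  shows "far (Can N L \<eta>) f \<in> Hom (coAlg M K) (fob L X, far L (\<eta> X)) (fob L X', far L (\<eta> X'))"
proof -
  note X = category_HomD[OF cats(1) f]
  \<comment> \<open>This is \<open>L\<close> applied to naturality of \<eta> at
    \<open>f\<close>.\<close>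
  have "far L (far R (far L f)) \<cdot>\<^bsub>M\<^esub> far L (\<eta> X) = far L (\<eta> X') \<cdot>\<^bsub>M\<^esub> far L f"
    using eta_nat[OF f] Lcomp[OF eta[OF X(1)] Rar[OF Lar[OF f]]] Lcomp[OF f eta[OF X(2)]] by simp
  then show ?thesis
    unfolding Hom_coAlg using X Lar[OF f] Can_coalgebra by (simp add: Can_def)
qed

lemma Can_functor: "is_functor N (coAlg M K) (Can N L \<eta>)"
proof (rule is_functorI[OF cats(1) coAlg_category])
  fix X assume X: "X \<in> Ob N"
  show o: "fob (Can N L \<eta>) X \<in> Ob (coAlg M K)"
    using Can_coalgebra[OF X] by (simp add: coAlg_def Can_simps)
  show "far (Can N L \<eta>) (Idt N X) = Idt (coAlg M K) (fob (Can N L \<eta>) X)"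
    unfolding Can_simps
    by (rule coAlg_arrow_eqI[OF Can_ar[OF Ni[OF X]] coAlg_id'[OF o, unfolded Can_simps]])
      (simp add: Can_simps dat_coAlg functor_id[OF functors(1) X])
next
  fix X X' f assume "f \<in> Hom N X X'"
  then show "far (Can N L \<eta>) f \<in> Hom (coAlg M K) (fob (Can N L \<eta>) X) (fob (Can N L \<eta>) X')"
    unfolding Can_simps by (rule Can_ar)
next
  fix X X' X'' f g assume f: "f \<in> Hom N X X'" and g: "g \<in> Hom N X' X''"
  show "far (Can N L \<eta>) (g \<cdot>\<^bsub>N\<^esub> f) = far (Can N L \<eta>) g \<cdot>\<^bsub>coAlg M K\<^esub> far (Can N L \<eta>) f"
    by (rule coAlg_arrow_eqI[OF Can_ar[OF Nc[OF f g]] coAlg_comp[OF Can_ar[OF f] Can_ar[OF g]]])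
      (simp add: Can_simps dat_coAlg Lcomp[OF f g])
qed

section \<open>The functor \<open>V\<close>\<close>

abbreviation "incl \<equiv> V_incl E R \<eta>"
abbreviation "Vob A \<equiv> Dm N (incl A)"

lemma incl:
  assumes "is_coalgebra M K (Y, \<delta>)"
  shows "is_equalizer N (far R \<delta>) (\<eta> (fob R Y)) (incl (Y, \<delta>))"
    "far R \<delta> \<in> Hom N (fob R Y) (fob R (fob L (fob R Y)))"
    "\<eta> (fob R Y) \<in> Hom N (fob R Y) (fob R (fob L (fob R Y)))"
    "incl (Y, \<delta>) \<in> Hom N (Vob (Y, \<delta>)) (fob R Y)" "Vob (Y, \<delta>) \<in> Ob N"
    "far R \<delta> \<cdot>\<^bsub>N\<^esub> incl (Y, \<delta>) = \<eta> (fob R Y) \<cdot>\<^bsub>N\<^esub> incl (Y, \<delta>)"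
proof -
  note c = coalgD[OF assms]
  show d: "far R \<delta> \<in> Hom N (fob R Y) (fob R (fob L (fob R Y)))"
    "\<eta> (fob R Y) \<in> Hom N (fob R Y) (fob R (fob L (fob R Y)))"
    using Rar[OF c(3)] eta[OF c(2)] by auto
  show e: "is_equalizer N (far R \<delta>) (\<eta> (fob R Y)) (incl (Y, \<delta>))"
    using eqz[OF d] by (simp add: V_incl_def)
  show i: "incl (Y, \<delta>) \<in> Hom N (Vob (Y, \<delta>)) (fob R Y)"
    using e d unfolding is_equalizer_def Hom_def by auto
  show "Vob (Y, \<delta>) \<in> Ob N" using category_HomD[OF cats(1) i] by blast
  show "far R \<delta> \<cdot>\<^bsub>N\<^esub> incl (Y, \<delta>) = \<eta> (fob R Y) \<cdot>\<^bsub>N\<^esub> incl (Y, \<delta>)"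
    using e by (simp add: is_equalizer_def)
qed

text \<open>Equations between arrows into a value of \<open>V\<close> are checked after the
  inclusion, where \<open>V\<close> is described by \<open>R\<close>.\<close>

lemma incl_mono:
  assumes "is_coalgebra M K (Y, \<delta>)" "h \<in> Hom N X (Vob (Y, \<delta>))" "h' \<in> Hom N X (Vob (Y, \<delta>))"
    "incl (Y, \<delta>) \<cdot>\<^bsub>N\<^esub> h = incl (Y, \<delta>) \<cdot>\<^bsub>N\<^esub> h'"
  shows "h = h'"
  using equalizer_mono[OF cats(1) incl(1-3)[OF assms(1)] assms(2-4)] .

lemma incl_factor:
  assumes "is_coalgebra M K (Y, \<delta>)" "k \<in> Hom N X (fob R Y)" "far R \<delta> \<cdot>\<^bsub>N\<^esub> k = \<eta> (fob R Y) \<cdot>\<^bsub>N\<^esub> k"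
  shows "factor_through N (incl (Y, \<delta>)) k \<in> Hom N X (Vob (Y, \<delta>))"
    "incl (Y, \<delta>) \<cdot>\<^bsub>N\<^esub> factor_through N (incl (Y, \<delta>)) k = k"
proof -
  have "Dm N (far R \<delta>) = fob R Y" using incl(2)[OF assms(1)] by (simp add: Hom_def)
  then show "factor_through N (incl (Y, \<delta>)) k \<in> Hom N X (Vob (Y, \<delta>))"
    "incl (Y, \<delta>) \<cdot>\<^bsub>N\<^esub> factor_through N (incl (Y, \<delta>)) k = k"
    using factor_through[OF incl(1)[OF assms(1)]] assms(2,3) by auto
qed

abbreviation "V \<equiv> V_func N E R \<eta>"

text \<open>\<open>R f\<close> carries one equalizer into the other. Under \<open>R\<close>, the
  coalgebra square trades \<open>R \<delta>'\<close> after \<open>R f\<close> for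
  \<open>R L R f\<close> after \<open>R \<delta>\<close>; on the inclusion \<open>R \<delta>\<close>
  agrees with \<eta>; naturality of \<eta> at \<open>R f\<close> then moves \<eta> to the
  left.\<close>

lemma V_ar:
  assumes f: "f \<in> Hom (coAlg M K) (Y, \<delta>) (Y', \<delta>')"
  shows "far V f \<in> Hom N (Vob (Y, \<delta>)) (Vob (Y', \<delta>'))"
    "incl (Y', \<delta>') \<cdot>\<^bsub>N\<^esub> far V f = far R (dat f) \<cdot>\<^bsub>N\<^esub> incl (Y, \<delta>)"
proof -
  note f = f[unfolded Hom_coAlg]
  have A: "is_coalgebra M K (Y, \<delta>)" "is_coalgebra M K (Y', \<delta>')" using f by auto
  let ?f = "dat f" and ?i = "incl (Y, \<delta>)"
  have f': "?f \<in> Hom M Y Y'" using f by simp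
  note i = incl[OF A(1)] and i' = incl[OF A(2)]
  note c = coalgD[OF A(1)] and c' = coalgD[OF A(2)]
  let ?k = "far R ?f \<cdot>\<^bsub>N\<^esub> ?i"
  note k = Nc[OF i(4) Rar[OF f']]
  have "far R \<delta>' \<cdot>\<^bsub>N\<^esub> ?k = far R (\<delta>' \<cdot>\<^bsub>M\<^esub> ?f) \<cdot>\<^bsub>N\<^esub> ?i"
    using Na[OF i(4) Rar[OF f'] i'(2)] Rcomp[OF f' c'(3)] by simp
  also have "\<dots> = far R (far L (far R ?f) \<cdot>\<^bsub>M\<^esub> \<delta>) \<cdot>\<^bsub>N\<^esub> ?i" using f by simp
  also have "\<dots> = far R (far L (far R ?f)) \<cdot>\<^bsub>N\<^esub> (\<eta> (fob R Y) \<cdot>\<^bsub>N\<^esub> ?i)"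
    using Na[OF i(4) i(2) Rar[OF Lar[OF Rar[OF f']]]] Rcomp[OF c(3) Lar[OF Rar[OF f']]] i(6) by simp
  also have "\<dots> = \<eta> (fob R Y') \<cdot>\<^bsub>N\<^esub> ?k"
    using Na[OF i(4) i(3) Rar[OF Lar[OF Rar[OF f']]]] Na[OF i(4) Rar[OF f'] i'(3)] eta_nat[OF Rar[OF f']] by simp
  finally show "far V f \<in> Hom N (Vob (Y, \<delta>)) (Vob (Y', \<delta>'))" "incl (Y', \<delta>') \<cdot>\<^bsub>N\<^esub> far V f = ?k"
    using incl_factor[OF A(2) k] f by (auto simp: V_func_def)
qed

lemma V_ob: "fob V A = Vob A" by (simp add: V_func_def)

lemma V_functor: "is_functor (coAlg M K) N V"
proof (rule is_functorI[OF coAlg_category cats(1)])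
  fix A assume A': "A \<in> Ob (coAlg M K)"
  obtain Y \<delta> where A: "A = (Y, \<delta>)" by fastforce
  then have c: "is_coalgebra M K (Y, \<delta>)" using A' by (simp add: coAlg_def)
  note i = incl[OF c]
  show "fob V A \<in> Ob N" using i(5) A by (simp add: V_ob)
  have id: "dat (Idt (coAlg M K) (Y, \<delta>)) = Idt M Y" by (simp add: coAlg_def)
  note v = V_ar[OF coAlg_id[OF c], unfolded id functor_id[OF functors(2) coalgD(1)[OF c]]]
  show "far V (Idt (coAlg M K) A) = Idt N (fob V A)"
    unfolding A V_ob
    by (rule incl_mono[OF c v(1) Ni[OF i(5)]])
      (simp add: v(2) category_id_left[OF cats(1) i(4)] category_id_right[OF cats(1) i(4)])
next
  fix A B f assume "f \<in> Hom (coAlg M K) A B"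
  then show "far V f \<in> Hom N (fob V A) (fob V B)"
    unfolding V_ob using V_ar(1)[of f "fst A" "snd A" "fst B" "snd B"] by simp
next
  fix A B C f g assume f: "f \<in> Hom (coAlg M K) A B" and g: "g \<in> Hom (coAlg M K) B C"
  obtain Y \<delta> Y' \<delta>' Y'' \<delta>'' where A: "A = (Y, \<delta>)" "B = (Y', \<delta>')" "C = (Y'', \<delta>'')"
    by (metis surj_pair)
  note f = f[unfolded A] and g = g[unfolded A]
  note vf = V_ar[OF f] and vg = V_ar[OF g] and vgf = V_ar[OF coAlg_comp[OF f g], unfolded dat_coAlg]
  have c: "is_coalgebra M K (Y, \<delta>)" "is_coalgebra M K (Y', \<delta>')" "is_coalgebra M K (Y'', \<delta>'')"
    and d: "dat f \<in> Hom M Y Y'" "dat g \<in> Hom M Y' Y''"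
    using f g unfolding Hom_coAlg by auto
  note i = incl(4)[OF c(1)] incl(4)[OF c(2)] incl(4)[OF c(3)]
  show "far V (g \<cdot>\<^bsub>coAlg M K\<^esub> f) = far V g \<cdot>\<^bsub>N\<^esub> far V f"
  proof (rule incl_mono[OF c(3) vgf(1) Nc[OF vf(1) vg(1)]])
    have "incl (Y'', \<delta>'') \<cdot>\<^bsub>N\<^esub> (far V g \<cdot>\<^bsub>N\<^esub> far V f) = far R (dat g) \<cdot>\<^bsub>N\<^esub> (incl (Y', \<delta>') \<cdot>\<^bsub>N\<^esub> far V f)"
      using Na[OF vf(1) vg(1) i(3)] Na[OF vf(1) i(2) Rar[OF d(2)]] vg(2) by simp
    then show "incl (Y'', \<delta>'') \<cdot>\<^bsub>N\<^esub> far V (g \<cdot>\<^bsub>coAlg M K\<^esub> f) = incl (Y'', \<delta>'') \<cdot>\<^bsub>N\<^esub> (far V g \<cdot>\<^bsub>N\<^esub> far V f)"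
      using vgf(2) vf(2) Rcomp[OF d] Na[OF i(1) Rar[OF d(1)] Rar[OF d(2)]] by simp
  qed
qed

section \<open>The comparison adjunction\<close>

abbreviation "cunit \<equiv> comparison_unit N E L R \<eta>"
abbreviation "ccounit \<equiv> comparison_counit N M E L R \<eta> \<epsilon>"

text \<open>Naturality of \<eta> at \<eta> \<open>X\<close> says that \<eta> \<open>X\<close>
  equalizes the pair that defines \<open>V\<close> at \<open>Can X\<close>, so it factors through
  the inclusion.\<close>

lemma cunit:
  assumes X: "X \<in> Ob N"
  shows "cunit X \<in> Hom N X (Vob (fob L X, far L (\<eta> X)))"
    "incl (fob L X, far L (\<eta> X)) \<cdot>\<^bsub>N\<^esub> cunit X = \<eta> X"
  using incl_factor[OF Can_coalgebra[OF X] eta[OF X]] eta_nat[OF eta[OF X]]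
  by (auto simp: comparison_unit_def Can_simps)

text \<open>The third part identifies the counit as the adjunct of the inclusion. Applying
  \<open>L\<close> to it turns one side of the coalgebra square into \<open>L\<close> of the
  inclusion; the other side is reduced to the same arrow.\<close>

lemma ccounit:
  assumes c: "is_coalgebra M K (Y, \<delta>)"
  shows "ccounit (Y, \<delta>) \<in> Hom (coAlg M K) (fob (Can N L \<eta>) (Vob (Y, \<delta>))) (Y, \<delta>)"
    "dat (ccounit (Y, \<delta>)) = \<epsilon> Y \<cdot>\<^bsub>M\<^esub> far L (incl (Y, \<delta>))"
    "far R (dat (ccounit (Y, \<delta>))) \<cdot>\<^bsub>N\<^esub> \<eta> (Vob (Y, \<delta>)) = incl (Y, \<delta>)"
proof -
  note i = incl[OF c] and y = coalgD[OF c]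
  let ?i = "incl (Y, \<delta>)"
  note e = eps[OF y(1)] and Li = Lar[OF i(4)]
  note eLi = Mc[OF Li e] and ev = eta[OF i(5)]
  have LRY: "fob L (fob R Y) \<in> Ob M" using functor_ob[OF functors(1) y(2)] .
  show d: "dat (ccounit (Y, \<delta>)) = \<epsilon> Y \<cdot>\<^bsub>M\<^esub> far L ?i" by (simp add: comparison_counit_def)
  have "far R (\<epsilon> Y \<cdot>\<^bsub>M\<^esub> far L ?i) \<cdot>\<^bsub>N\<^esub> \<eta> (Vob (Y, \<delta>)) = far R (\<epsilon> Y) \<cdot>\<^bsub>N\<^esub> (\<eta> (fob R Y) \<cdot>\<^bsub>N\<^esub> ?i)"
    using Rcomp[OF Li e] Na[OF ev Rar[OF Li] Rar[OF e]] eta_nat[OF i(4)] by simp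
  also have "\<dots> = ?i"
    using Na[OF i(4) i(3) Rar[OF e]] triangle_R[OF y(1)] category_id_left[OF cats(1) i(4)] by simp
  finally show a: "far R (dat (ccounit (Y, \<delta>))) \<cdot>\<^bsub>N\<^esub> \<eta> (Vob (Y, \<delta>)) = ?i" unfolding d .
  \<comment> \<open>Naturality of \<epsilon> at \<delta> brings \<open>R \<delta>\<close> next to
    the inclusion. There the equalizer condition replaces it by \<eta>, and the first triangle
    identity cancels the rest.\<close>
  have "\<delta> \<cdot>\<^bsub>M\<^esub> (\<epsilon> Y \<cdot>\<^bsub>M\<^esub> far L ?i) = \<epsilon> (fob L (fob R Y)) \<cdot>\<^bsub>M\<^esub> (far L (far R \<delta>) \<cdot>\<^bsub>M\<^esub> far L ?i)"
    using Ma[OF Li e y(3)] Ma[OF Li Lar[OF i(2)] eps[OF LRY]] eps_nat[OF y(3)] by simp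
  also have "\<dots> = (\<epsilon> (fob L (fob R Y)) \<cdot>\<^bsub>M\<^esub> far L (\<eta> (fob R Y))) \<cdot>\<^bsub>M\<^esub> far L ?i"
    using Lcomp[OF i(4,2)] Lcomp[OF i(4,3)] i(6) Ma[OF Li Lar[OF i(3)] eps[OF LRY]] by simp
  also have "\<dots> = far L ?i"
    using triangle_L[OF y(2)] category_id_left[OF cats(2) Li] by simp
  finally have "far L (far R (dat (ccounit (Y, \<delta>)))) \<cdot>\<^bsub>M\<^esub> far L (\<eta> (Vob (Y, \<delta>))) = \<delta> \<cdot>\<^bsub>M\<^esub> dat (ccounit (Y, \<delta>))"
    using Lcomp[OF ev Rar[OF eLi]] a unfolding d by simp
  then show "ccounit (Y, \<delta>) \<in> Hom (coAlg M K) (fob (Can N L \<eta>) (Vob (Y, \<delta>))) (Y, \<delta>)"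
    unfolding Can_simps Hom_coAlg using Can_coalgebra[OF i(5)] c eLi d
    by (simp add: comparison_counit_def V_ob Can_simps)
qed

text \<open>Equations in \<open>N\<close> are compared after the monic inclusion, where they become
  naturality of \<eta> and the adjunct formula for the counit. Equations of coalgebra morphisms are
  compared in \<open>M\<close>, where they become naturality of \<epsilon> and the first triangle
  identity.\<close>

theorem comparison_adjunction: "is_adjunction N (coAlg M K) (Can N L \<eta>) V cunit ccounit"
  unfolding is_adjunction_def
proof (intro conjI ballI)
  let ?A = "\<lambda>X. (fob L X, far L (\<eta> X))"
  show "is_natural N N id_func (V \<circ>\<^sub>F Can N L \<eta>) cunit"
  proof (rule is_naturalI[OF id_functor[OF cats(1)] functor_compose[OF Can_functor V_functor]])
    fix X assume "X \<in> Ob N"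
    from cunit(1)[OF this] show "cunit X \<in> Hom N (fob id_func X) (fob (V \<circ>\<^sub>F Can N L \<eta>) X)"
      by (simp add: id_func_def comp_func_def V_ob Can_simps)
  next
    fix X X' f assume f: "f \<in> Hom N X X'"
    note X = category_HomD[OF cats(1) f]
    note u = cunit[OF X(1)] and u' = cunit[OF X(2)]
    note i = incl[OF Can_coalgebra[OF X(1)]] and i' = incl[OF Can_coalgebra[OF X(2)]]
    note v = V_ar[OF Can_ar[OF f], unfolded Can_simps]
    have "cunit X' \<cdot>\<^bsub>N\<^esub> f = far V (far (Can N L \<eta>) f) \<cdot>\<^bsub>N\<^esub> cunit X"
    proof (rule incl_mono[OF Can_coalgebra[OF X(2)] Nc[OF f u'(1)] Nc[OF u(1) v(1)]])
      show "incl (?A X') \<cdot>\<^bsub>N\<^esub> (cunit X' \<cdot>\<^bsub>N\<^esub> f) = incl (?A X') \<cdot>\<^bsub>N\<^esub> (far V (far (Can N L \<eta>) f) \<cdot>\<^bsub>N\<^esub> cunit X)"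
        using Na[OF f u'(1) i'(4)] Na[OF u(1) v(1) i'(4)] Na[OF u(1) i(4) Rar[OF Lar[OF f]]] v(2) u(2) u'(2)
          eta_nat[OF f] by simp
    qed
    then show "cunit X' \<cdot>\<^bsub>N\<^esub> far id_func f = far (V \<circ>\<^sub>F Can N L \<eta>) f \<cdot>\<^bsub>N\<^esub> cunit X"
      by (simp add: id_func_def comp_func_def)
  qed
  show "is_natural (coAlg M K) (coAlg M K) (Can N L \<eta> \<circ>\<^sub>F V) id_func ccounit"
  proof (rule is_naturalI[OF functor_compose[OF V_functor Can_functor] id_functor[OF coAlg_category]])
    fix A assume "A \<in> Ob (coAlg M K)"
    then show "ccounit A \<in> Hom (coAlg M K) (fob (Can N L \<eta> \<circ>\<^sub>F V) A) (fob id_func A)"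
      using ccounit(1)[of "fst A" "snd A"] by (simp add: coAlg_def id_func_def comp_func_def V_ob)
  next
    fix A B f assume f: "f \<in> Hom (coAlg M K) A B"
    obtain Y \<delta> Y' \<delta>' where A: "A = (Y, \<delta>)" "B = (Y', \<delta>')" by (metis surj_pair)
    note f = f[unfolded A]
    have c: "is_coalgebra M K (Y, \<delta>)" "is_coalgebra M K (Y', \<delta>')" and d: "dat f \<in> Hom M Y Y'"
      using f unfolding Hom_coAlg by auto
    note e = ccounit[OF c(1)] and e' = ccounit[OF c(2)]
    note i = incl[OF c(1)] and i' = incl[OF c(2)]
    note y = coalgD[OF c(1)] and y' = coalgD[OF c(2)]
    note v = V_ar[OF f]
    let ?C = "Can N L \<eta>"
    have CV: "far ?C (far V f) \<in> Hom (coAlg M K) (fob ?C (Vob (Y, \<delta>))) (fob ?C (Vob (Y', \<delta>')))"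
      unfolding Can_simps using Can_ar[OF v(1)] .
    have "ccounit B \<cdot>\<^bsub>coAlg M K\<^esub> far ?C (far V f) = f \<cdot>\<^bsub>coAlg M K\<^esub> ccounit A"
      unfolding A
    proof (rule coAlg_arrow_eqI[OF coAlg_comp[OF CV e'(1)] coAlg_comp[OF e(1) f]])
      have "(\<epsilon> Y' \<cdot>\<^bsub>M\<^esub> far L (incl (Y', \<delta>'))) \<cdot>\<^bsub>M\<^esub> far L (far V f) =
          \<epsilon> Y' \<cdot>\<^bsub>M\<^esub> far L (far R (dat f) \<cdot>\<^bsub>N\<^esub> incl (Y, \<delta>))"
        using Ma[OF Lar[OF v(1)] Lar[OF i'(4)] eps[OF y'(1)]] Lcomp[OF v(1) i'(4)] v(2) by simp
      also have "\<dots> = (\<epsilon> Y' \<cdot>\<^bsub>M\<^esub> far L (far R (dat f))) \<cdot>\<^bsub>M\<^esub> far L (incl (Y, \<delta>))"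
        using Lcomp[OF i(4) Rar[OF d]] Ma[OF Lar[OF i(4)] Lar[OF Rar[OF d]] eps[OF y'(1)]] by simp
      also have "\<dots> = dat f \<cdot>\<^bsub>M\<^esub> (\<epsilon> Y \<cdot>\<^bsub>M\<^esub> far L (incl (Y, \<delta>)))"
        using eps_nat[OF d] Ma[OF Lar[OF i(4)] eps[OF y(1)] d] by simp
      finally show "dat (ccounit (Y', \<delta>') \<cdot>\<^bsub>coAlg M K\<^esub> far ?C (far V f)) = dat (f \<cdot>\<^bsub>coAlg M K\<^esub> ccounit (Y, \<delta>))"
        unfolding dat_coAlg e(2) e'(2) Can_simps .
    qed
    then show "ccounit B \<cdot>\<^bsub>coAlg M K\<^esub> far (?C \<circ>\<^sub>F V) f = far id_func f \<cdot>\<^bsub>coAlg M K\<^esub> ccounit A"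
      by (simp add: id_func_def comp_func_def)
  qed
  fix X assume X: "X \<in> Ob N"
  note c = Can_coalgebra[OF X]
  note i = incl[OF c] and u = cunit[OF X] and e = ccounit[OF c]
  have Cu: "far (Can N L \<eta>) (cunit X) \<in> Hom (coAlg M K) (?A X) (fob (Can N L \<eta>) (Vob (?A X)))"
    unfolding Can_simps using Can_ar[OF u(1)] .
  have "ccounit (?A X) \<cdot>\<^bsub>coAlg M K\<^esub> far (Can N L \<eta>) (cunit X) = Idt (coAlg M K) (?A X)"
  proof (rule coAlg_arrow_eqI[OF coAlg_comp[OF Cu e(1)] coAlg_id[OF c]])
    \<comment> \<open>The inclusion after \<open>cunit X\<close> is \<eta> \<open>X\<close>, so this
      triangle becomes the one of the original adjunction.\<close>
    have "(\<epsilon> (fob L X) \<cdot>\<^bsub>M\<^esub> far L (incl (?A X))) \<cdot>\<^bsub>M\<^esub> far L (cunit X) = \<epsilon> (fob L X) \<cdot>\<^bsub>M\<^esub> far L (\<eta> X)"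
      using Ma[OF Lar[OF u(1)] Lar[OF i(4)] eps[OF coalgD(1)[OF c]]] Lcomp[OF u(1) i(4)] u(2) by simp
    then show "dat (ccounit (?A X) \<cdot>\<^bsub>coAlg M K\<^esub> far (Can N L \<eta>) (cunit X)) = dat (Idt (coAlg M K) (?A X))"
      using triangle_L[OF X] unfolding dat_coAlg e(2) Can_simps by simp
  qed
  then show "ccounit (fob (Can N L \<eta>) X) \<cdot>\<^bsub>coAlg M K\<^esub> far (Can N L \<eta>) (cunit X) = Idt (coAlg M K) (fob (Can N L \<eta>) X)"
    unfolding Can_simps .
next
  fix A assume A': "A \<in> Ob (coAlg M K)"
  obtain Y \<delta> where A: "A = (Y, \<delta>)" by fastforce
  then have c: "is_coalgebra M K (Y, \<delta>)" using A' by (simp add: coAlg_def)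
  note i = incl[OF c] and u = cunit[OF incl(5)[OF c]] and e = ccounit[OF c]
  note v = V_ar[OF e(1)[unfolded Can_simps]]
  note i' = incl[OF Can_coalgebra[OF i(5)]]
  note d = dat_coAlg_Hom[OF e(1)[unfolded Can_simps], simplified]
  have "far V (ccounit (Y, \<delta>)) \<cdot>\<^bsub>N\<^esub> cunit (Vob (Y, \<delta>)) = Idt N (Vob (Y, \<delta>))"
  proof (rule incl_mono[OF c Nc[OF u(1) v(1)] Ni[OF i(5)]])
    \<comment> \<open>The inclusion moves past \<open>V\<close> of the counit and becomes the
      inclusion belonging to \<open>Can\<close> of \<open>V\<close>. That one absorbs the unit into
      \<eta>, and the adjunct formula \<open>e(3)\<close> applies.\<close>
    show "incl (Y, \<delta>) \<cdot>\<^bsub>N\<^esub> (far V (ccounit (Y, \<delta>)) \<cdot>\<^bsub>N\<^esub> cunit (Vob (Y, \<delta>))) =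
        incl (Y, \<delta>) \<cdot>\<^bsub>N\<^esub> Idt N (Vob (Y, \<delta>))"
      using Na[OF u(1) v(1) i(4)] v(2) Na[OF u(1) i'(4) Rar[OF d]] u(2) e(3)
        category_id_right[OF cats(1) i(4)] by simp
  qed
  then show "far V (ccounit A) \<cdot>\<^bsub>N\<^esub> cunit (fob V A) = Idt N (fob V A)"
    unfolding A V_ob .
qed (fact Can_functor V_functor)+

section \<open>Adjunctions with invertible unit\<close>

text \<open>The counit law of the coalgebra and the second triangle identity make the two arrows
  sections of \<open>R (\<epsilon> Y)\<close>. A retraction of the invertible arrow
  \<open>\<eta> (R Y)\<close> is its inverse, and an invertible arrow has only one section.\<close>

lemma coaction_eq_unit:
  assumes iso: "\<And>X. X \<in> Ob N \<Longrightarrow> is_iso N (\<eta> X)" and c: "is_coalgebra M K (Y, \<delta>)"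
  shows "far R \<delta> = \<eta> (fob R Y)"
proof -
  note i = incl[OF c] and y = coalgD[OF c]
  note Re = Rar[OF eps[OF y(1)]]
  obtain g where g: "g \<in> Hom N (fob R (fob L (fob R Y))) (fob R Y)"
    "\<eta> (fob R Y) \<cdot>\<^bsub>N\<^esub> g = Idt N (fob R (fob L (fob R Y)))"
    using is_isoE[OF iso[OF y(2)] i(3)] by metis
  have "far R (\<epsilon> Y) = far R (\<epsilon> Y) \<cdot>\<^bsub>N\<^esub> (\<eta> (fob R Y) \<cdot>\<^bsub>N\<^esub> g)"
    using g(2) category_id_right[OF cats(1) Re] by simp
  also have "\<dots> = g"
    using Na[OF g(1) i(3) Re] triangle_R[OF y(1)] category_id_left[OF cats(1) g(1)] by simp
  finally have Re_g: "far R (\<epsilon> Y) = g" .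
  have "far R \<delta> = \<eta> (fob R Y) \<cdot>\<^bsub>N\<^esub> (g \<cdot>\<^bsub>N\<^esub> far R \<delta>)"
    using Na[OF i(2) g(1) i(3)] g(2) category_id_left[OF cats(1) i(2)] by simp
  also have "g \<cdot>\<^bsub>N\<^esub> far R \<delta> = Idt N (fob R Y)"
    unfolding Re_g[symmetric] using Rcomp[OF y(3) eps[OF y(1)]] y(5) functor_id[OF functors(2) y(1)] by simp
  finally show ?thesis using category_id_right[OF cats(1) i(3)] by simp
qed

theorem comparison_adjoint_equivalence:
  assumes iso: "\<And>X. X \<in> Ob N \<Longrightarrow> is_iso N (\<eta> X)"
  shows "is_adjoint_equivalence N (coAlg M K) (Can N L \<eta>) V cunit ccounit"
  unfolding is_adjoint_equivalence_def
proof (intro conjI ballI)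
  show "is_adjunction N (coAlg M K) (Can N L \<eta>) V cunit ccounit" by (rule comparison_adjunction)
  fix X assume X: "X \<in> Ob N"
  note c = Can_coalgebra[OF X]
  note i = incl[OF c] and u = cunit[OF X]
  let ?i = "incl (fob L X, far L (\<eta> X))"
  obtain h where h: "h \<in> Hom N (fob R (fob L X)) X" "h \<cdot>\<^bsub>N\<^esub> \<eta> X = Idt N X"
    "\<eta> X \<cdot>\<^bsub>N\<^esub> h = Idt N (fob R (fob L X))"
    using is_isoE[OF iso[OF X] eta[OF X]] by metis
  show "is_iso N (cunit X)"
  \<comment> \<open>The inclusion after \<open>cunit X\<close> is \<eta> \<open>X\<close>, so
    following the inclusion by the inverse \<open>h\<close> of \<eta> \<open>X\<close> undoes
    \<open>cunit X\<close>.\<close>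
  proof (rule is_isoI[OF u(1) Nc[OF i(4) h(1)]])
    show "(h \<cdot>\<^bsub>N\<^esub> ?i) \<cdot>\<^bsub>N\<^esub> cunit X = Idt N X" using Na[OF u(1) i(4) h(1)] u(2) h(2) by simp
    note ui = Nc[OF Nc[OF i(4) h(1)] u(1)]
    show "cunit X \<cdot>\<^bsub>N\<^esub> (h \<cdot>\<^bsub>N\<^esub> ?i) = Idt N (Vob (fob L X, far L (\<eta> X)))"
    proof (rule incl_mono[OF c ui Ni[OF i(5)]])
      show "?i \<cdot>\<^bsub>N\<^esub> (cunit X \<cdot>\<^bsub>N\<^esub> (h \<cdot>\<^bsub>N\<^esub> ?i)) = ?i \<cdot>\<^bsub>N\<^esub> Idt N (Vob (fob L X, far L (\<eta> X)))"
        using Na[OF Nc[OF i(4) h(1)] u(1) i(4)] u(2) Na[OF i(4) h(1) eta[OF X]] h(3)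
          category_id_left[OF cats(1) i(4)] category_id_right[OF cats(1) i(4)] by simp
    qed
  qed
next
  fix A assume A': "A \<in> Ob (coAlg M K)"
  obtain Y \<delta> where A: "A = (Y, \<delta>)" by fastforce
  then have c: "is_coalgebra M K (Y, \<delta>)" using A' by (simp add: coAlg_def)
  note i = incl[OF c] and y = coalgD[OF c] and e = ccounit[OF c]
  note eY = eps[OF y(1)]
  have R\<delta>: "far R \<delta> = \<eta> (fob R Y)" by (rule coaction_eq_unit[OF iso c])
  have LRY: "fob L (fob R Y) \<in> Ob M" using functor_ob[OF functors(1) y(2)] .
  \<comment> \<open>Naturality of \<epsilon> at \<delta> rewrites the left side to \<epsilon> after
    \<open>L R \<delta>\<close>. With \<open>R \<delta>\<close> replaced by \<eta> this is the first
    triangle identity at \<open>R Y\<close>.\<close>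
  have "\<delta> \<cdot>\<^bsub>M\<^esub> \<epsilon> Y = Idt M (fob L (fob R Y))"
    using eps_nat[OF y(3)] R\<delta> triangle_L[OF y(2)] by simp
  then have "is_iso M (\<epsilon> Y)" using is_isoI[OF eY y(3)] y(5) by blast
  moreover have "is_iso N (incl (Y, \<delta>))"
    using equalizer_same_iso[OF cats(1) i(1)[unfolded R\<delta>] i(3)] .
  ultimately have "is_iso M (dat (ccounit (Y, \<delta>)))"
    unfolding e(2) using is_iso_comp[OF cats(2) Lar[OF i(4)] eY] functor_iso[OF functors(1) i(4)] by blast
  then show "is_iso (coAlg M K) (ccounit A)"
    unfolding A using coAlg_isoI[OF e(1)] by blast
qed

text \<open>\<open>is_equivalence\<close> asks for isomorphisms from the identity and to the
  identity, in the directions of an adjunction, so \<open>cunit\<close> and \<open>ccounit\<close>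
  serve unchanged.\<close>

corollary comonadic_of_unit_iso:
  assumes iso: "\<And>X. X \<in> Ob N \<Longrightarrow> is_iso N (\<eta> X)"
  shows "comonadic N M L R \<eta> \<epsilon>"
  using comparison_adjoint_equivalence[OF iso] V_functor Can_functor
  unfolding comonadic_def is_equivalence_def is_adjoint_equivalence_def is_adjunction_def is_natural_iso_def
  by blast

end

section \<open>Smash products of pointed simplicial sets\<close>

lemma psset_sact: "is_psset X \<Longrightarrow> \<theta> \<in> Delta m n \<Longrightarrow> x \<in> simp X n \<Longrightarrow> sact X m n \<theta> x \<in> simp X m"
  by (simp add: is_psset_def)

lemma psset_sact_id: "is_psset X \<Longrightarrow> x \<in> simp X n \<Longrightarrow> sact X n n (restrict id {..n}) x = x"
  by (simp add: is_psset_def)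

lemma psset_sact_comp:
  "is_psset X \<Longrightarrow> \<phi> \<in> Delta l m \<Longrightarrow> \<theta> \<in> Delta m n \<Longrightarrow> x \<in> simp X n \<Longrightarrow>
     sact X l n (compose {..l} \<theta> \<phi>) x = sact X l m \<phi> (sact X m n \<theta> x)"
  unfolding is_psset_def by blast

lemma psset_pt: "is_psset X \<Longrightarrow> pt X n \<in> simp X n"
  by (simp add: is_psset_def)

lemma psset_sact_pt: "is_psset X \<Longrightarrow> \<theta> \<in> Delta m n \<Longrightarrow> sact X m n \<theta> (pt X n) = pt X m"
  by (simp add: is_psset_def)

section \<open>Maps of pointed simplicial sets\<close>

lemma Hom_sSet_pt: "f \<in> Hom sSet_pt X Y \<longleftrightarrow> is_psmap f \<and> src f = X \<and> tgt f = Y"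
  by (auto simp: Hom_def sSet_pt_def)

lemma Cmp_sSet_pt [simp]: "g \<cdot>\<^bsub>sSet_pt\<^esub> f = g \<circ>\<^sub>s f"
  by (simp add: sSet_pt_def)

lemma psmapD:
  assumes "f \<in> Hom sSet_pt X Y"
  shows "is_psset X" "is_psset Y" "src f = X" "tgt f = Y"
    "x \<in> simp X n \<Longrightarrow> dat f n x \<in> simp Y n" "dat f n \<in> extensional (simp X n)"
    "dat f n (pt X n) = pt Y n"
    "\<theta> \<in> Delta m n \<Longrightarrow> x \<in> simp X n \<Longrightarrow> dat f m (sact X m n \<theta> x) = sact Y m n \<theta> (dat f n x)"
  using assms unfolding Hom_sSet_pt is_psmap_def by (auto simp: PiE_def Pi_def)

lemma psmapI:
  assumes "is_psset X" "is_psset Y" "src f = X" "tgt f = Y"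
    "\<And>n x. x \<in> simp X n \<Longrightarrow> dat f n x \<in> simp Y n" "\<And>n. dat f n \<in> extensional (simp X n)"
    "\<And>n. dat f n (pt X n) = pt Y n"
    "\<And>m n \<theta> x. \<theta> \<in> Delta m n \<Longrightarrow> x \<in> simp X n \<Longrightarrow> dat f m (sact X m n \<theta> x) = sact Y m n \<theta> (dat f n x)"
  shows "f \<in> Hom sSet_pt X Y"
  using assms unfolding Hom_sSet_pt is_psmap_def by (auto simp: PiE_def Pi_def)

lemma psmap_eqI:
  assumes "f \<in> Hom sSet_pt X Y" "g \<in> Hom sSet_pt X Y" "\<And>n x. x \<in> simp X n \<Longrightarrow> dat f n x = dat g n x"
  shows "f = g"
proof -
  have "dat f n = dat g n" for n
    by (rule extensionalityI[OF psmapD(6)[OF assms(1)] psmapD(6)[OF assms(2)] assms(3)])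
  then have "dat f = dat g" by blast
  then show ?thesis using psmapD(3,4)[OF assms(1)] psmapD(3,4)[OF assms(2)] by (cases f; cases g) simp
qed

lemma dat_psset_comp: "f \<in> Hom sSet_pt X Y \<Longrightarrow> x \<in> simp X n \<Longrightarrow> dat (g \<circ>\<^sub>s f) n x = dat g n (dat f n x)"
  using psmapD(3)[of f X Y] by (simp add: psset_comp_def compose_def)

lemma psset_comp_in: "f \<in> Hom sSet_pt X Y \<Longrightarrow> g \<in> Hom sSet_pt Y Z \<Longrightarrow> g \<circ>\<^sub>s f \<in> Hom sSet_pt X Z"
  by (rule psmapI) (auto simp: psmapD dat_psset_comp psset_pt psset_sact,
      auto simp: psset_comp_def psmapD compose_def)

lemma dat_psset_id: "x \<in> simp X n \<Longrightarrow> dat (psset_id X) n x = x"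
  by (simp add: psset_id_def)

lemma psset_id_in: "is_psset X \<Longrightarrow> psset_id X \<in> Hom sSet_pt X X"
  by (rule psmapI) (auto simp: psset_id_def psset_pt psset_sact)

lemma Ob_sSet_pt: "X \<in> Ob sSet_pt \<longleftrightarrow> is_psset X"
  by (simp add: sSet_pt_def)

lemma psset_comp_id:
  assumes "f \<in> Hom sSet_pt X Y"
  shows "f \<circ>\<^sub>s psset_id X = f" "psset_id Y \<circ>\<^sub>s f = f"
proof -
  note i = psset_id_in[OF psmapD(1)[OF assms]] psset_id_in[OF psmapD(2)[OF assms]]
  show "f \<circ>\<^sub>s psset_id X = f"
    by (rule psmap_eqI[OF psset_comp_in[OF i(1) assms] assms]) (simp add: dat_psset_comp[OF i(1)] dat_psset_id)
  show "psset_id Y \<circ>\<^sub>s f = f"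
    by (rule psmap_eqI[OF psset_comp_in[OF assms i(2)] assms])
      (simp add: dat_psset_comp[OF assms] dat_psset_id psmapD(5)[OF assms])
qed

lemma psset_comp_assoc:
  assumes "f \<in> Hom sSet_pt X Y" "g \<in> Hom sSet_pt Y Z" "h \<in> Hom sSet_pt Z W"
  shows "h \<circ>\<^sub>s (g \<circ>\<^sub>s f) = (h \<circ>\<^sub>s g) \<circ>\<^sub>s f"
  by (rule psmap_eqI[OF psset_comp_in[OF psset_comp_in[OF assms(1,2)] assms(3)]
        psset_comp_in[OF assms(1) psset_comp_in[OF assms(2,3)]]])
    (simp add: dat_psset_comp[OF assms(1)] dat_psset_comp[OF assms(2)]
      dat_psset_comp[OF psset_comp_in[OF assms(1,2)]] psmapD(5)[OF assms(1)])

lemma sSet_pt_category: "is_category sSet_pt"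
  unfolding is_category_def
  using psset_id_in psset_comp_in psset_comp_id psset_comp_assoc
  by (auto simp: Ob_sSet_pt) (auto simp: sSet_pt_def is_psmap_def)

section \<open>Binary smash products\<close>

lemma smash_elt_pt [simp]: "smash_elt X Y n (pt X n) y = Pt" "smash_elt X Y n x (pt Y n) = Pt"
  by (auto simp: smash_elt_def)

lemma smash_elt_in: "x \<in> simp X n \<Longrightarrow> y \<in> simp Y n \<Longrightarrow> smash_elt X Y n x y \<in> simp (smash X Y) n"
  by (auto simp: smash_def)

text \<open>The base point is also the image of a pair, so one form covers all simplices and
  computations run on representatives without a separate case for \<open>Pt\<close>.\<close>

lemma smash_cases:
  assumes "z \<in> simp (smash X Y) n"
  obtains x y where "z = smash_elt X Y n x y" "x \<in> simp X n" "y \<in> simp Y n"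
  using assms by (auto simp: smash_def)

lemma pt_smash [simp]: "pt (smash X Y) n = Pt"
  by (simp add: smash_def)

text \<open>Operators preserve base points, so a collapsed pair stays collapsed; a base point that
  arises only after applying the operator is collapsed by \<open>smash_elt\<close> on both
  sides.\<close>

lemma sact_smash:
  assumes "is_psset X" "is_psset Y" "\<theta> \<in> Delta m n"
  shows "sact (smash X Y) m n \<theta> (smash_elt X Y n x y) = smash_elt X Y m (sact X m n \<theta> x) (sact Y m n \<theta> y)"
  using assms by (auto simp: smash_def smash_elt_def psset_sact_pt)

lemma is_psset_smash:
  assumes X: "is_psset X" and Y: "is_psset Y"
  shows "is_psset (smash X Y)"
  unfolding is_psset_def
proof (intro conjI allI ballI)
  fix m n \<theta> z assume t: "\<theta> \<in> Delta m n" "z \<in> simp (smash X Y) n"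
  then show "sact (smash X Y) m n \<theta> z \<in> simp (smash X Y) m"
    by (elim smash_cases) (simp add: sact_smash[OF X Y] smash_elt_in psset_sact[OF X] psset_sact[OF Y])
next
  fix n z assume "z \<in> simp (smash X Y) n"
  moreover have "restrict id {..n} \<in> Delta n n" by (auto simp: Delta_def mono_on_def)
  ultimately show "sact (smash X Y) n n (restrict id {..n}) z = z"
    by (elim smash_cases) (simp add: sact_smash[OF X Y] psset_sact_id[OF X] psset_sact_id[OF Y])
next
  fix l m n \<phi> \<theta> z
  assume t: "\<phi> \<in> Delta l m" "\<theta> \<in> Delta m n" "z \<in> simp (smash X Y) n"
  then show "sact (smash X Y) l n (compose {..l} \<theta> \<phi>) z =
      sact (smash X Y) l m \<phi> (sact (smash X Y) m n \<theta> z)"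
    by (elim smash_cases) (simp add: sact_smash[OF X Y] Delta_compose psset_sact_comp[OF X] psset_sact_comp[OF Y])
next
  fix n
  show "pt (smash X Y) n \<in> simp (smash X Y) n"
    using smash_elt_in[OF psset_pt[OF X] psset_pt[OF Y], of n] by simp
qed (simp add: smash_def)

text \<open>Since \<open>f\<close> and \<open>g\<close> are pointed, the formula yields
  \<open>Pt\<close> on collapsed pairs, in agreement with the default branch of
  \<open>smash_map\<close>.\<close>

lemma dat_smash_map:
  assumes f: "f \<in> Hom sSet_pt X X'" and g: "g \<in> Hom sSet_pt Y Y'" and "x \<in> simp X n" "y \<in> simp Y n"
  shows "dat (smash_map f g) n (smash_elt X Y n x y) = smash_elt X' Y' n (dat f n x) (dat g n y)"
  using assms(3,4) psmapD(3,4,7)[OF f] psmapD(3,4,7)[OF g] smash_elt_in[of x X n y Y]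
  by (auto simp: smash_map_def smash_elt_def restrict_def)

lemma smash_map_in:
  assumes f: "f \<in> Hom sSet_pt X X'" and g: "g \<in> Hom sSet_pt Y Y'"
  shows "smash_map f g \<in> Hom sSet_pt (smash X Y) (smash X' Y')"
proof (rule psmapI)
  note F = psmapD[OF f] and G = psmapD[OF g]
  show "is_psset (smash X Y)" "is_psset (smash X' Y')" using F G by (auto intro: is_psset_smash)
  show "src (smash_map f g) = smash X Y" "tgt (smash_map f g) = smash X' Y'"
    using F G by (auto simp: smash_map_def)
  show "dat (smash_map f g) n \<in> extensional (simp (smash X Y) n)" for n
    using F G by (simp add: smash_map_def)
  show "dat (smash_map f g) n (pt (smash X Y) n) = pt (smash X' Y') n" for n
    using dat_smash_map[OF f g psset_pt[OF F(1)] psset_pt[OF G(1)], of n] F(7) by simp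
  fix n z assume "z \<in> simp (smash X Y) n"
  then obtain x y where z: "z = smash_elt X Y n x y" "x \<in> simp X n" "y \<in> simp Y n" by (rule smash_cases)
  show "dat (smash_map f g) n z \<in> simp (smash X' Y') n"
    using z F(5) G(5) by (simp add: dat_smash_map[OF f g] smash_elt_in)
  fix m \<theta> assume t: "\<theta> \<in> Delta m n"
  show "dat (smash_map f g) m (sact (smash X Y) m n \<theta> z) = sact (smash X' Y') m n \<theta> (dat (smash_map f g) n z)"
    using z t F(8) G(8) F(1,2) G(1,2) by (simp add: sact_smash dat_smash_map[OF f g] psset_sact)
qed

lemma psmap_smash_eqI:
  assumes f: "f \<in> Hom sSet_pt (smash X Y) Z" and g: "g \<in> Hom sSet_pt (smash X Y) Z"
    and "\<And>n x y. x \<in> simp X n \<Longrightarrow> y \<in> simp Y n \<Longrightarrow>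
           dat f n (smash_elt X Y n x y) = dat g n (smash_elt X Y n x y)"
  shows "f = g"
proof (rule psmap_eqI[OF f g])
  fix n z assume "z \<in> simp (smash X Y) n"
  then show "dat f n z = dat g n z" by (rule smash_cases) (simp add: assms(3))
qed

lemma smash_map_comp:
  assumes f: "f \<in> Hom sSet_pt X Y" and g: "g \<in> Hom sSet_pt Y Z"
    and f': "f' \<in> Hom sSet_pt X' Y'" and g': "g' \<in> Hom sSet_pt Y' Z'"
  shows "smash_map g g' \<circ>\<^sub>s smash_map f f' = smash_map (g \<circ>\<^sub>s f) (g' \<circ>\<^sub>s f')"
proof (rule psmap_smash_eqI[OF psset_comp_in[OF smash_map_in[OF f f'] smash_map_in[OF g g']]
      smash_map_in[OF psset_comp_in[OF f g] psset_comp_in[OF f' g']]])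
  fix n x y assume h: "x \<in> simp X n" "y \<in> simp X' n"
  then show "dat (smash_map g g' \<circ>\<^sub>s smash_map f f') n (smash_elt X X' n x y) =
      dat (smash_map (g \<circ>\<^sub>s f) (g' \<circ>\<^sub>s f')) n (smash_elt X X' n x y)"
    using dat_psset_comp[OF smash_map_in[OF f f'] smash_elt_in[OF h]] dat_smash_map[OF f f' h]
      dat_smash_map[OF g g' psmapD(5)[OF f h(1)] psmapD(5)[OF f' h(2)]]
      dat_smash_map[OF psset_comp_in[OF f g] psset_comp_in[OF f' g'] h]
      dat_psset_comp[OF f h(1)] dat_psset_comp[OF f' h(2)] by simp
qed

lemma smash_map_id:
  assumes X: "is_psset X" and Y: "is_psset Y"
  shows "smash_map (psset_id X) (psset_id Y) = psset_id (smash X Y)"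
proof (rule psmap_smash_eqI[OF smash_map_in[OF psset_id_in[OF X] psset_id_in[OF Y]] psset_id_in[OF is_psset_smash[OF X Y]]])
  fix n x y assume h: "x \<in> simp X n" "y \<in> simp Y n"
  then show "dat (smash_map (psset_id X) (psset_id Y)) n (smash_elt X Y n x y) =
      dat (psset_id (smash X Y)) n (smash_elt X Y n x y)"
    using dat_smash_map[OF psset_id_in[OF X] psset_id_in[OF Y] h] smash_elt_in[OF h] by (simp add: dat_psset_id)
qed

section \<open>Smash powers and their permutations\<close>

lemma tup_elt_in: "length ss = p \<Longrightarrow> set ss \<subseteq> simp S n \<Longrightarrow> tup_elt S n ss \<in> simp (smash_power S p) n"
  by (auto simp: smash_power_def)

text \<open>\<open>Pt\<close> is a case of its own because of \<open>p = 0\<close>, where the only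
  tuple is empty and its class \<open>Tup []\<close> is not the base point.\<close>

lemma smash_power_cases:
  assumes "z \<in> simp (smash_power S p) n"
  obtains "z = Pt" | ss where "z = tup_elt S n ss" "length ss = p" "set ss \<subseteq> simp S n"
  using assms by (auto simp: smash_power_def)

lemma pt_smash_power [simp]: "pt (smash_power S p) n = Pt"
  by (simp add: smash_power_def)

lemma sact_smash_power:
  assumes "is_psset S" "\<theta> \<in> Delta m n"
  shows "sact (smash_power S p) m n \<theta> (tup_elt S n ss) = tup_elt S m (map (sact S m n \<theta>) ss)"
    "sact (smash_power S p) m n \<theta> Pt = Pt"
  using assms psset_sact_pt[OF assms] by (auto simp: smash_power_def tup_elt_def image_iff) metis

lemma is_psset_smash_power:
  assumes S: "is_psset S"
  shows "is_psset (smash_power S p)"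
  unfolding is_psset_def
proof (intro conjI allI ballI)
  fix m n \<theta> z assume t: "\<theta> \<in> Delta m n" "z \<in> simp (smash_power S p) n"
  have "Pt \<in> simp (smash_power S p) m" by (simp add: smash_power_def)
  moreover have "tup_elt S m (map (sact S m n \<theta>) ss) \<in> simp (smash_power S p) m"
    if "length ss = p" "set ss \<subseteq> simp S n" for ss
    by (rule tup_elt_in) (use that t psset_sact[OF S] in auto)
  ultimately show "sact (smash_power S p) m n \<theta> z \<in> simp (smash_power S p) m"
    using t by (elim smash_power_cases[of z]) (simp_all add: sact_smash_power[OF S])
next
  fix n z assume "z \<in> simp (smash_power S p) n"
  moreover have "restrict id {..n} \<in> Delta n n" by (auto simp: Delta_def mono_on_def)
  moreover have "map (sact S n n (restrict id {..n})) ss = ss" if "set ss \<subseteq> simp S n" for ss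
    using that by (intro map_idI) (auto simp: psset_sact_id[OF S])
  ultimately show "sact (smash_power S p) n n (restrict id {..n}) z = z"
    by (elim smash_power_cases) (simp_all add: sact_smash_power[OF S])
next
  fix l m n \<phi> \<theta> z
  assume t: "\<phi> \<in> Delta l m" "\<theta> \<in> Delta m n" "z \<in> simp (smash_power S p) n"
  moreover have "tup_elt S l (map (sact S l n (compose {..l} \<theta> \<phi>)) ss) =
      tup_elt S l (map (sact S l m \<phi> \<circ> sact S m n \<theta>) ss)" if "set ss \<subseteq> simp S n" for ss
    using that by (intro arg_cong[where f="tup_elt S l"] map_cong) (auto simp: psset_sact_comp[OF S t(1,2)])
  ultimately show "sact (smash_power S p) l n (compose {..l} \<theta> \<phi>) z =
      sact (smash_power S p) l m \<phi> (sact (smash_power S p) m n \<theta> z)"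
    by (elim smash_power_cases) (simp_all add: sact_smash_power[OF S] Delta_compose)
qed (auto simp: smash_power_def)

text \<open>
  Since \<open>Pt\<close> is the base point of \<open>smash_power S p\<close> also for \<open>p = 0\<close>, every simplex of
  \<open>smash X (smash_power S p)\<close> has the form \<open>x \<and> s\<^sub>1 \<and> \<dots> \<and> s\<^sub>p\<close>.
\<close>

definition tup_smash :: "'a psset \<Rightarrow> 'a psset \<Rightarrow> nat \<Rightarrow> 'a elem \<Rightarrow> 'a elem list \<Rightarrow> 'a elem" where
  "tup_smash X S n x ss = (if x = pt X n \<or> pt S n \<in> set ss then Pt else Smash x (Tup ss))"

text \<open>All powers have base point \<open>Pt\<close>, so the right side does not mention
  \<open>p\<close>. Uses from right to left must therefore fix \<open>p\<close> explicitly.\<close>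

lemma tup_smash_elt: "smash_elt X (smash_power S p) n x (tup_elt S n ss) = tup_smash X S n x ss"
  by (simp add: smash_elt_def tup_elt_def tup_smash_def)

lemma tup_smash_pt [simp]: "tup_smash X S n (pt X n) ss = Pt"
  by (simp add: tup_smash_def)

lemma tup_smash_in:
  "x \<in> simp X n \<Longrightarrow> length ss = p \<Longrightarrow> set ss \<subseteq> simp S n \<Longrightarrow> tup_smash X S n x ss \<in> simp (smash X (smash_power S p)) n"
  unfolding tup_smash_elt[symmetric, where p=p] by (intro smash_elt_in tup_elt_in)

lemma smash_power_smash_cases:
  assumes X: "is_psset X" and S: "is_psset S" and z: "z \<in> simp (smash X (smash_power S p)) n"
  obtains x ss where "z = tup_smash X S n x ss" "x \<in> simp X n" "length ss = p" "set ss \<subseteq> simp S n"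
proof -
  \<comment> \<open>The first coordinate alone collapses this simplex, so the representation also
    works for \<open>p = 0\<close>, when the tuple is empty.\<close>
  have Pt: "Pt = tup_smash X S n (pt X n) (replicate p (pt S n))" by simp
  obtain x y where xy: "z = smash_elt X (smash_power S p) n x y" "x \<in> simp X n" "y \<in> simp (smash_power S p) n"
    using z by (rule smash_cases)
  from xy(3) show ?thesis
  proof (cases rule: smash_power_cases)
    case 1
    then have "z = tup_smash X S n (pt X n) (replicate p (pt S n))" using xy by (simp add: smash_elt_def)
    then show ?thesis by (rule that) (use psset_pt[OF X] psset_pt[OF S] in auto)
  next
    case (2 ss)
    then show ?thesis using that xy tup_smash_elt by metis
  qed
qed

lemma sact_tup_smash:
  assumes "is_psset X" "is_psset S" "\<theta> \<in> Delta m n"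
  shows "sact (smash X (smash_power S p)) m n \<theta> (tup_smash X S n x ss) = tup_smash X S m (sact X m n \<theta> x) (map (sact S m n \<theta>) ss)"
  unfolding tup_smash_elt[symmetric, where p=p]
  using assms by (simp add: sact_smash is_psset_smash_power sact_smash_power)

text \<open>Permuting a list keeps its set of entries, and hence whether the tuple is
  collapsed.\<close>

lemma dat_smash_power_perm:
  assumes \<pi>: "\<pi> permutes {..<p}" and "length ss = p" "set ss \<subseteq> simp S n"
  shows "dat (smash_power_perm S p \<pi>) n (tup_elt S n ss) = tup_elt S n (permute_list (inv_into UNIV \<pi>) ss)"
    "dat (smash_power_perm S p \<pi>) n Pt = Pt"
proof -
  have "set (permute_list (inv_into UNIV \<pi>) ss) = set ss"
    using permutes_inv[OF \<pi>] assms(2) by simp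
  then show "dat (smash_power_perm S p \<pi>) n (tup_elt S n ss) = tup_elt S n (permute_list (inv_into UNIV \<pi>) ss)"
    using tup_elt_in[OF assms(2,3)] by (auto simp: smash_power_perm_def tup_elt_def)
  show "dat (smash_power_perm S p \<pi>) n Pt = Pt" by (simp add: smash_power_perm_def smash_power_def)
qed

lemma smash_power_perm_in:
  assumes S: "is_psset S" and \<pi>: "\<pi> permutes {..<p}"
  shows "smash_power_perm S p \<pi> \<in> Hom sSet_pt (smash_power S p) (smash_power S p)"
proof (rule psmapI)
  let ?f = "smash_power_perm S p \<pi>" and ?P = "smash_power S p"
  have Pt: "dat ?f n Pt = Pt" "Pt \<in> simp ?P n" for n
    by (simp_all add: smash_power_perm_def smash_power_def)
  have inv: "inv_into UNIV \<pi> permutes {..<p}" by (rule permutes_inv[OF \<pi>])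
  show "is_psset ?P" "is_psset ?P" by (rule is_psset_smash_power[OF S])+
  show "src ?f = ?P" "tgt ?f = ?P" by (simp_all add: smash_power_perm_def)
  show "dat ?f n \<in> extensional (simp ?P n)" "dat ?f n (pt ?P n) = pt ?P n" for n
    by (simp_all add: smash_power_perm_def smash_power_def)
  fix n z assume z: "z \<in> simp ?P n"
  then show "dat ?f n z \<in> simp ?P n"
    by (cases rule: smash_power_cases)
      (use inv in \<open>auto simp: Pt dat_smash_power_perm[OF \<pi>] intro!: tup_elt_in\<close>)
  fix m \<theta> assume t: "\<theta> \<in> Delta m n"
  from z show "dat ?f m (sact ?P m n \<theta> z) = sact ?P m n \<theta> (dat ?f n z)"
  proof (cases rule: smash_power_cases)
    case 1
    then show ?thesis by (simp add: Pt sact_smash_power[OF S t])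
  next
    case (2 ss)
    have "set (map (sact S m n \<theta>) ss) \<subseteq> simp S m" using 2 psset_sact[OF S t] by auto
    then show ?thesis
      using 2 inv by (simp add: sact_smash_power[OF S t] dat_smash_power_perm[OF \<pi>] permute_list_map)
  qed
qed

lemma smash_power_perm_id: assumes S: "is_psset S" shows "smash_power_perm S p id = psset_id (smash_power S p)"
proof (rule psmap_eqI[OF smash_power_perm_in[OF S permutes_id] psset_id_in[OF is_psset_smash_power[OF S]]])
  fix n z assume z: "z \<in> simp (smash_power S p) n"
  then show "dat (smash_power_perm S p id) n z = dat (psset_id (smash_power S p)) n z"
  proof (cases rule: smash_power_cases)
    case 1
    then show ?thesis using z by (simp add: dat_psset_id smash_power_perm_def)
  next
    case (2 ss)
    then show ?thesis
      using z dat_psset_id[OF z] dat_smash_power_perm(1)[OF permutes_id 2(2,3)] by simp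
  qed
qed

lemma dat_smash_map_perm:
  assumes S: "is_psset S" and \<pi>: "\<pi> permutes {..<p}" and f: "f \<in> Hom sSet_pt X Y"
    and x: "x \<in> simp X n" "length ss = p" "set ss \<subseteq> simp S n"
  shows "dat (smash_map f (smash_power_perm S p \<pi>)) n (tup_smash X S n x ss) =
     tup_smash Y S n (dat f n x) (permute_list (inv_into UNIV \<pi>) ss)"
  unfolding tup_smash_elt[symmetric, where p=p]
  using dat_smash_map[OF f smash_power_perm_in[OF S \<pi>] x(1) tup_elt_in[OF x(2,3)]]
    dat_smash_power_perm[OF \<pi> x(2,3)] by simp

text \<open>The identity of a smash power is the action of the identity permutation.\<close>

lemma dat_smash_map_id:
  assumes S: "is_psset S" and f: "f \<in> Hom sSet_pt X Y" and x: "x \<in> simp X n" "length ss = p" "set ss \<subseteq> simp S n"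
  shows "dat (smash_map f (psset_id (smash_power S p))) n (tup_smash X S n x ss) = tup_smash Y S n (dat f n x) ss"
  using dat_smash_map_perm[OF S permutes_id f x] by (simp add: smash_power_perm_id[OF S])

text \<open>Turns equivariance of suspension spectra, naturality of the counit and the first
  triangle identity into computations with lists of factors.\<close>

lemma psmap_tup_smash_eqI:
  assumes f: "f \<in> Hom sSet_pt (smash X (smash_power S p)) Y" and g: "g \<in> Hom sSet_pt (smash X (smash_power S p)) Y"
    and XS: "is_psset X" "is_psset S"
    and "\<And>n x ss. x \<in> simp X n \<Longrightarrow> length ss = p \<Longrightarrow> set ss \<subseteq> simp S n \<Longrightarrow>
           dat f n (tup_smash X S n x ss) = dat g n (tup_smash X S n x ss)"
  shows "f = g"
proof (rule psmap_eqI[OF f g])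
  fix n z assume "z \<in> simp (smash X (smash_power S p)) n"
  then show "dat f n z = dat g n z" by (rule smash_power_smash_cases[OF XS]) (simp add: assms(5))
qed

section \<open>Suspension spectra\<close>

lemma spectrumD:
  assumes "is_spectrum S X"
  shows "is_psset (lev X n)" "str X n \<in> Hom sSet_pt (smash (lev X n) S) (lev X (Suc n))"
    "\<pi> permutes {..<n} \<Longrightarrow> perm X n \<pi> \<in> Hom sSet_pt (lev X n) (lev X n)"
    "perm X n id = psset_id (lev X n)"
    "\<pi> permutes {..<n} \<Longrightarrow> \<rho> permutes {..<n} \<Longrightarrow> perm X n (\<pi> \<circ> \<rho>) = perm X n \<pi> \<circ>\<^sub>s perm X n \<rho>"
    "\<pi> permutes {..<n} \<Longrightarrow> \<rho> permutes {..<p} \<Longrightarrow>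
        iter_str S X n p \<circ>\<^sub>s smash_map (perm X n \<pi>) (smash_power_perm S p \<rho>) =
        perm X (n + p) (block_perm n \<pi> \<rho>) \<circ>\<^sub>s iter_str S X n p"
  using assms unfolding is_spectrum_def Ob_sSet_pt by blast+

text \<open>Levels and structure maps suffice to iterate. Separating them from
  \<open>is_spectrum\<close> avoids a circle: its equivariance axiom mentions
  \<open>iter_str\<close>, whose properties are needed before suspension spectra are known to
  satisfy that axiom.\<close>

locale structured =
  fixes S :: "'a psset" and X :: "'a spectrum"
  assumes S: "is_psset S" and lev: "is_psset (lev X n)"
    and str: "str X n \<in> Hom sSet_pt (smash (lev X n) S) (lev X (Suc n))"
begin

abbreviation step where "step k n x s \<equiv> dat (str X n) k (smash_elt (lev X n) S k x s)"

lemma step_in: "x \<in> simp (lev X n) k \<Longrightarrow> s \<in> simp S k \<Longrightarrow> step k n x s \<in> simp (lev X (Suc n)) k"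
  using psmapD(5)[OF str] smash_elt_in by blast

lemma step_pt: "step k n (pt (lev X n) k) s = pt (lev X (Suc n)) k" "step k n x (pt S k) = pt (lev X (Suc n)) k"
  using psmapD(7)[OF str, of n k] by simp_all

lemma iter_elt_in:
  "x \<in> simp (lev X n) k \<Longrightarrow> set ss \<subseteq> simp S k \<Longrightarrow> iter_elt S X k n x ss \<in> simp (lev X (n + length ss)) k"
proof (induction ss arbitrary: n x)
  case (Cons s ss)
  then show ?case using Cons.IH[OF step_in, of x n s] by simp
qed simp

lemma iter_elt_pt: "iter_elt S X k n (pt (lev X n) k) ss = pt (lev X (n + length ss)) k"
proof (induction ss arbitrary: n)
  case (Cons s ss)
  show ?case using Cons.IH[of "Suc n"] by (simp only: iter_elt.simps step_pt) simp
qed simp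

text \<open>The first factor that is a base point sends the iteration to the base point of the next
  level, and \<open>iter_elt_pt\<close> carries it through the remaining factors.\<close>

lemma iter_elt_pt': "pt S k \<in> set ss \<Longrightarrow> iter_elt S X k n x ss = pt (lev X (n + length ss)) k"
proof (induction ss arbitrary: n x)
  case (Cons s ss)
  show ?case
  proof (cases "s = pt S k")
    case True
    then show ?thesis using iter_elt_pt[of k "Suc n" ss] by (simp only: iter_elt.simps step_pt) simp
  next
    case False
    then show ?thesis using Cons.IH[of "Suc n"] Cons.prems by simp
  qed
qed simp

text \<open>\<open>iter_elt\<close> consumes factors from the front, whereas a suspension spectrum
  adds them at the end. The structure square of the counit needs the last step isolated.\<close>

lemma iter_elt_snoc: "iter_elt S X k n x (ss @ [s]) = step k (n + length ss) (iter_elt S X k n x ss) s"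
  by (induction ss arbitrary: n x) simp_all

lemma iter_elt_sact:
  assumes t: "\<theta> \<in> Delta m k"
  shows "x \<in> simp (lev X n) k \<Longrightarrow> set ss \<subseteq> simp S k \<Longrightarrow>
    iter_elt S X m n (sact (lev X n) m k \<theta> x) (map (sact S m k \<theta>) ss) =
    sact (lev X (n + length ss)) m k \<theta> (iter_elt S X k n x ss)"
proof (induction ss arbitrary: n x)
  case (Cons s ss)
  then have "step m n (sact (lev X n) m k \<theta> x) (sact S m k \<theta> s) = sact (lev X (Suc n)) m k \<theta> (step k n x s)"
    using psmapD(8)[OF str t smash_elt_in[of x "lev X n" k s S]] sact_smash[OF lev S t] by simp
  then show ?case using Cons.IH[OF step_in, of x n s] Cons.prems by simp
qed simp

text \<open>On a collapsed simplex \<open>iter_str\<close> takes its default branch, and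
  \<open>iter_elt\<close> agrees with it because it ends in the base point too. Hence one formula
  serves all representatives.\<close>

lemma dat_iter_str:
  assumes "x \<in> simp (lev X n) k" "length ss = p" "set ss \<subseteq> simp S k"
  shows "dat (iter_str S X n p) k (tup_smash (lev X n) S k x ss) = iter_elt S X k n x ss"
proof (cases "x = pt (lev X n) k \<or> pt S k \<in> set ss")
  case True
  then have "iter_elt S X k n x ss = pt (lev X (n + p)) k"
    using iter_elt_pt[of k n ss] iter_elt_pt'[of k ss n x] assms(2) by auto
  then show ?thesis using True tup_smash_in[OF assms] by (simp add: iter_str_def tup_smash_def)
next
  case False
  then show ?thesis using tup_smash_in[OF assms] by (simp add: iter_str_def tup_smash_def)
qed

lemma iter_str_in: "iter_str S X n p \<in> Hom sSet_pt (smash (lev X n) (smash_power S p)) (lev X (n + p))"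
proof (rule psmapI)
  let ?P = "smash (lev X n) (smash_power S p)" and ?f = "iter_str S X n p"
  show P: "is_psset ?P" "is_psset (lev X (n + p))" by (auto intro: is_psset_smash lev is_psset_smash_power S)
  show "src ?f = ?P" "tgt ?f = lev X (n + p)" "dat ?f k \<in> extensional (simp ?P k)" for k
    by (simp_all add: iter_str_def)
  show "dat ?f k (pt ?P k) = pt (lev X (n + p)) k" for k
    using psset_pt[OF P(1), of k] by (simp add: iter_str_def)
  fix k z assume "z \<in> simp ?P k"
  then obtain x ss where z: "z = tup_smash (lev X n) S k x ss" "x \<in> simp (lev X n) k" "length ss = p" "set ss \<subseteq> simp S k"
    by (rule smash_power_smash_cases[OF lev S])
  show "dat ?f k z \<in> simp (lev X (n + p)) k"
    using z iter_elt_in[OF z(2,4)] by (simp add: dat_iter_str)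
  fix m \<theta> assume t: "\<theta> \<in> Delta m k"
  have "set (map (sact S m k \<theta>) ss) \<subseteq> simp S m" using z psset_sact[OF S t] by auto
  then show "dat ?f m (sact ?P m k \<theta> z) = sact (lev X (n + p)) m k \<theta> (dat ?f k z)"
    using z iter_elt_sact[OF t z(2,4)] by (simp add: sact_tup_smash[OF lev S t] dat_iter_str psset_sact[OF lev t])
qed

end

lemma spectrum_structured: "is_psset S \<Longrightarrow> is_spectrum S X \<Longrightarrow> structured S X"
  by unfold_locales (auto simp: spectrumD)

section \<open>Structure maps of a suspension spectrum\<close>

lemma susp_simps [simp]:
  "lev (susp_spectrum S X) n = smash X (smash_power S n)"
  "perm (susp_spectrum S X) n \<pi> = smash_map (psset_id X) (smash_power_perm S n \<pi>)"
  by (simp_all add: susp_spectrum_def)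

lemma dat_susp_str:
  assumes "x \<in> simp X k" "length ss = n" "set ss \<subseteq> simp S k" "s \<in> simp S k"
  shows "dat (str (susp_spectrum S X) n) k (smash_elt (smash X (smash_power S n)) S k (tup_smash X S k x ss) s) =
    tup_smash X S k x (ss @ [s])"
  using smash_elt_in[OF tup_smash_in[OF assms(1-3)] assms(4)]
  by (auto simp: susp_spectrum_def tup_smash_def smash_elt_def)

lemma susp_str_in:
  assumes X: "is_psset X" and S: "is_psset S"
  shows "str (susp_spectrum S X) n \<in> Hom sSet_pt (smash (smash X (smash_power S n)) S) (smash X (smash_power S (Suc n)))"
proof (rule psmapI)
  let ?XS = "smash X (smash_power S n)"
  let ?P = "smash ?XS S" and ?Q = "smash X (smash_power S (Suc n))" and ?f = "str (susp_spectrum S X) n"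
  show XS: "is_psset ?P" "is_psset ?Q" by (intro is_psset_smash is_psset_smash_power X S)+
  have XS': "is_psset ?XS" by (intro is_psset_smash is_psset_smash_power X S)
  show "src ?f = ?P" "tgt ?f = ?Q" "dat ?f k \<in> extensional (simp ?P k)" for k
    by (simp_all add: susp_spectrum_def)
  show "dat ?f k (pt ?P k) = pt ?Q k" for k
    using psset_pt[OF XS(1), of k] by (simp add: susp_spectrum_def)
  fix k z assume "z \<in> simp ?P k"
  then obtain w s where w: "z = smash_elt ?XS S k w s" "w \<in> simp ?XS k" "s \<in> simp S k" by (rule smash_cases)
  obtain x ss where x: "w = tup_smash X S k x ss" "x \<in> simp X k" "length ss = n" "set ss \<subseteq> simp S k"
    using w(2) by (rule smash_power_smash_cases[OF X S])
  show "dat ?f k z \<in> simp ?Q k"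
    unfolding w x(1) dat_susp_str[OF x(2-4) w(3)] by (rule tup_smash_in) (use w x in auto)
  fix m \<theta> assume t: "\<theta> \<in> Delta m k"
  have "set (map (sact S m k \<theta>) ss) \<subseteq> simp S m" using x psset_sact[OF S t] by auto
  then show "dat ?f m (sact ?P m k \<theta> z) = sact ?Q m k \<theta> (dat ?f k z)"
    unfolding w x(1) dat_susp_str[OF x(2-4) w(3)]
    using x w by (simp add: sact_smash[OF XS' S t] sact_tup_smash[OF X S t] dat_susp_str psset_sact[OF X t] psset_sact[OF S t])
qed

lemma susp_structured: "is_psset X \<Longrightarrow> is_psset S \<Longrightarrow> structured S (susp_spectrum S X)"
  by unfold_locales (auto intro: susp_str_in is_psset_smash is_psset_smash_power)

text \<open>Each structure map appends one factor, so iterating concatenates. The list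
  \<open>ts\<close> collects the factors absorbed so far and has to vary in the induction.\<close>

lemma iter_elt_susp:
  assumes "x \<in> simp X k" "set ss \<subseteq> simp S k"
  shows "set ts \<subseteq> simp S k \<Longrightarrow> length ts = n \<Longrightarrow>
    iter_elt S (susp_spectrum S X) k n (tup_smash X S k x ts) ss = tup_smash X S k x (ts @ ss)"
  using assms(2)
proof (induction ss arbitrary: ts n)
  case (Cons s ss)
  then show ?case using Cons.IH[of "ts @ [s]" "Suc n"] by (simp add: dat_susp_str[OF assms(1)])
qed simp

section \<open>Block permutations and equivariance\<close>

lemma block_perm_permutes:
  assumes "\<pi> permutes {..<n}" "\<rho> permutes {..<p}"
  shows "block_perm n \<pi> \<rho> permutes {..<n + p}"
    and "inv_into UNIV (block_perm n \<pi> \<rho>) = block_perm n (inv_into UNIV \<pi>) (inv_into UNIV \<rho>)"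
proof -
  \<comment> \<open>The inner permutation must keep the first block inside itself, so that the outer
    one takes the matching branch. Indices of the second block are shifted by \<open>n\<close> and
    remain at least \<open>n\<close> in any case.\<close>
  have cancel: "block_perm n \<sigma> \<tau> \<circ> block_perm n \<sigma>' \<tau>' = id"
    if "\<sigma>' permutes {..<n}" "\<sigma> \<circ> \<sigma>' = id" "\<tau> \<circ> \<tau>' = id" for \<sigma> \<tau> \<sigma>' \<tau>'
    using that permutes_in_image[OF that(1)] by (auto simp: block_perm_def fun_eq_iff)
  note c = cancel[OF assms(1) permutes_inv_o(2)[OF assms(1)] permutes_inv_o(2)[OF assms(2)]]
    cancel[OF permutes_inv[OF assms(1)] permutes_inv_o(1)[OF assms(1)] permutes_inv_o(1)[OF assms(2)]]
  have "bij (block_perm n \<pi> \<rho>)" using o_bij[OF c] .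
  moreover have "block_perm n \<pi> \<rho> i = i" if "i \<notin> {..<n + p}" for i
    using that permutes_not_in[OF assms(2), of "i - n"] by (auto simp: block_perm_def)
  ultimately show "block_perm n \<pi> \<rho> permutes {..<n + p}"
    by (simp add: permutes_def bij_iff)
  show "inv_into UNIV (block_perm n \<pi> \<rho>) = block_perm n (inv_into UNIV \<pi>) (inv_into UNIV \<rho>)"
    using inv_unique_comp[OF c(2,1)] .
qed

text \<open>Each permutation keeps indices within its own block, so the two halves of the
  concatenation are read separately.\<close>

lemma permute_list_block_perm:
  assumes "\<pi> permutes {..<length ts}" "\<rho> permutes {..<length ss}"
  shows "permute_list (block_perm (length ts) \<pi> \<rho>) (ts @ ss) = permute_list \<pi> ts @ permute_list \<rho> ss"
proof (rule nth_equalityI)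
  fix i assume "i < length (permute_list (block_perm (length ts) \<pi> \<rho>) (ts @ ss))"
  then show "permute_list (block_perm (length ts) \<pi> \<rho>) (ts @ ss) ! i = (permute_list \<pi> ts @ permute_list \<rho> ss) ! i"
    using permutes_in_image[OF assms(1), of i] permutes_in_image[OF assms(2), of "i - length ts"]
    by (auto simp: permute_list_def block_perm_def nth_append)
qed simp

text \<open>Permutations read the list of factors through their inverses, and iterated structure
  maps concatenate lists. The equivariance axiom thus becomes the compatibility of
  \<open>permute_list\<close> with \<open>@\<close> and block permutations.\<close>

lemma is_spectrum_susp:
  assumes X: "is_psset X" and S: "is_psset S"
  shows "is_spectrum S (susp_spectrum S X)"
  unfolding is_spectrum_def
proof (intro conjI allI impI)
  let ?T = "susp_spectrum S X"
  interpret T: structured S ?T by (rule susp_structured[OF X S])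
  note iX = psset_id_in[OF X]
  show "lev ?T n \<in> Ob sSet_pt" for n using T.lev by (simp add: Ob_sSet_pt)
  show "str ?T n \<in> Hom sSet_pt (smash (lev ?T n) S) (lev ?T (Suc n))" for n by (rule T.str)
  have perm_in: "perm ?T n \<pi> \<in> Hom sSet_pt (lev ?T n) (lev ?T n)" if "\<pi> permutes {..<n}" for n \<pi>
    using smash_map_in[OF iX smash_power_perm_in[OF S that]] by simp
  then show "\<pi> permutes {..<n} \<Longrightarrow> perm ?T n \<pi> \<in> Hom sSet_pt (lev ?T n) (lev ?T n)" for n \<pi> .
  have dat_perm: "dat (perm ?T n \<pi>) k (tup_smash X S k x ss) = tup_smash X S k x (permute_list (inv_into UNIV \<pi>) ss)"
    if "\<pi> permutes {..<n}" "x \<in> simp X k" "length ss = n" "set ss \<subseteq> simp S k" for n \<pi> k x ss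
    using dat_smash_map_perm[OF S that(1) iX that(2-4)] that by (simp add: dat_psset_id)
  show "perm ?T n id = psset_id (lev ?T n)" for n
  proof (rule psmap_tup_smash_eqI[OF perm_in[OF permutes_id, unfolded susp_simps(1)] _ X S])
    show "psset_id (lev ?T n) \<in> Hom sSet_pt (smash X (smash_power S n)) (smash X (smash_power S n))"
      using psset_id_in[OF T.lev[of n]] by simp
    fix k x ss assume h: "x \<in> simp X k" "length ss = n" "set ss \<subseteq> simp S k"
    show "dat (perm ?T n id) k (tup_smash X S k x ss) = dat (psset_id (lev ?T n)) k (tup_smash X S k x ss)"
      unfolding dat_perm[OF permutes_id h] using h tup_smash_in[OF h] by (simp add: dat_psset_id)
  qed
  show "perm ?T n (\<pi> \<circ> \<rho>) = perm ?T n \<pi> \<circ>\<^sub>s perm ?T n \<rho>"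
    if "\<pi> permutes {..<n} \<and> \<rho> permutes {..<n}" for n \<pi> \<rho>
  proof -
    have p: "\<pi> permutes {..<n}" "\<rho> permutes {..<n}" using that by auto
    have c: "\<pi> \<circ> \<rho> permutes {..<n}" using permutes_compose p by blast
    show ?thesis
    proof (rule psmap_tup_smash_eqI[OF perm_in[OF c, unfolded susp_simps(1)] psset_comp_in[OF perm_in[OF p(2)] perm_in[OF p(1)], unfolded susp_simps(1)] X S])
      fix k x ss assume h: "x \<in> simp X k" "length ss = n" "set ss \<subseteq> simp S k"
      have inv: "inv_into UNIV \<pi> permutes {..<length ss}" "inv_into UNIV \<rho> permutes {..<length ss}"
        using permutes_inv p h by auto
      \<comment> \<open>Two reversals of order cancel: inverting a composite reverses it, and
        \<open>permute_list\<close> acts from the right. Hence reading through the inverse gives a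
        left action.\<close>
      have "inv_into UNIV (\<pi> \<circ> \<rho>) = inv_into UNIV \<rho> \<circ> inv_into UNIV \<pi>"
        using permutes_bij p by (intro o_inv_distrib) blast+
      then have "permute_list (inv_into UNIV (\<pi> \<circ> \<rho>)) ss = permute_list (inv_into UNIV \<pi>) (permute_list (inv_into UNIV \<rho>) ss)"
        using permute_list_compose[OF inv(1)] by simp
      moreover have "dat (perm ?T n \<pi> \<circ>\<^sub>s perm ?T n \<rho>) k (tup_smash X S k x ss) =
          dat (perm ?T n \<pi>) k (dat (perm ?T n \<rho>) k (tup_smash X S k x ss))"
        using dat_psset_comp[OF perm_in[OF p(2)], unfolded susp_simps(1), OF tup_smash_in[OF h]] .
      ultimately show "dat (perm ?T n (\<pi> \<circ> \<rho>)) k (tup_smash X S k x ss) =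
          dat (perm ?T n \<pi> \<circ>\<^sub>s perm ?T n \<rho>) k (tup_smash X S k x ss)"
        using dat_perm[OF c h] dat_perm[OF p(2) h] dat_perm[OF p(1) h(1), of "permute_list (inv_into UNIV \<rho>) ss"] h inv
        by simp
    qed
  qed
  show "iter_str S ?T n p \<circ>\<^sub>s smash_map (perm ?T n \<pi>) (smash_power_perm S p \<rho>) =
        perm ?T (n + p) (block_perm n \<pi> \<rho>) \<circ>\<^sub>s iter_str S ?T n p"
    if "\<pi> permutes {..<n} \<and> \<rho> permutes {..<p}" for n p \<pi> \<rho>
  proof -
    have p: "\<pi> permutes {..<n}" "\<rho> permutes {..<p}" using that by auto
    note b = block_perm_permutes[OF p]
    note sm = smash_map_in[OF perm_in[OF p(1)] smash_power_perm_in[OF S p(2)]]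
    show ?thesis
    proof (rule psmap_tup_smash_eqI[OF psset_comp_in[OF sm T.iter_str_in] psset_comp_in[OF T.iter_str_in perm_in[OF b(1)]] T.lev S])
      fix k w ss assume w: "w \<in> simp (lev ?T n) k" and ss: "length ss = p" "set ss \<subseteq> simp S k"
      \<comment> \<open>A simplex of level \<open>n\<close> is itself some \<open>x\<close> with
        factors \<open>ts\<close>, so both sides can be evaluated on the concatenation of
        \<open>ts\<close> and \<open>ss\<close>.\<close>
      obtain x ts where x: "w = tup_smash X S k x ts" "x \<in> simp X k" "length ts = n" "set ts \<subseteq> simp S k"
        using w[unfolded susp_simps(1)] by (rule smash_power_smash_cases[OF X S])
      have inv: "inv_into UNIV \<pi> permutes {..<length ts}" "inv_into UNIV \<rho> permutes {..<length ss}"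
        using permutes_inv p x ss by auto
      let ?z = "tup_smash (lev ?T n) S k w ss"
      note z = tup_smash_in[OF w ss]
      have w': "dat (perm ?T n \<pi>) k w = tup_smash X S k x (permute_list (inv_into UNIV \<pi>) ts)"
        using dat_perm[OF p(1) x(2-4)] x(1) by simp
      have "dat (iter_str S ?T n p \<circ>\<^sub>s smash_map (perm ?T n \<pi>) (smash_power_perm S p \<rho>)) k ?z =
          dat (iter_str S ?T n p) k (tup_smash (lev ?T n) S k (dat (perm ?T n \<pi>) k w) (permute_list (inv_into UNIV \<rho>) ss))"
        using dat_psset_comp[OF sm z] dat_smash_map_perm[OF S p(2) perm_in[OF p(1)] w ss] by simp
      also have "\<dots> = iter_elt S ?T k n (dat (perm ?T n \<pi>) k w) (permute_list (inv_into UNIV \<rho>) ss)"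
        by (rule T.dat_iter_str) (use psmapD(5)[OF perm_in[OF p(1)] w] ss inv in auto)
      also have "\<dots> = tup_smash X S k x (permute_list (inv_into UNIV \<pi>) ts @ permute_list (inv_into UNIV \<rho>) ss)"
        unfolding w' by (rule iter_elt_susp) (use x ss inv in auto)
      \<comment> \<open>Inversion respects the two blocks, so the separately permuted lists form one
        permuted list.\<close>
      also have "\<dots> = tup_smash X S k x (permute_list (inv_into UNIV (block_perm n \<pi> \<rho>)) (ts @ ss))"
        unfolding b(2) using permute_list_block_perm[OF inv] x(3) by simp
      also have "\<dots> = dat (perm ?T (n + p) (block_perm n \<pi> \<rho>)) k (tup_smash X S k x (ts @ ss))"
        by (rule dat_perm[OF b(1), symmetric]) (use x ss in auto)
      also have "\<dots> = dat (perm ?T (n + p) (block_perm n \<pi> \<rho>)) k (dat (iter_str S ?T n p) k ?z)"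
        using T.dat_iter_str[OF w ss] iter_elt_susp[OF x(2) ss(2) x(4,3)] x(1) by simp
      also have "\<dots> = dat (perm ?T (n + p) (block_perm n \<pi> \<rho>) \<circ>\<^sub>s iter_str S ?T n p) k ?z"
        using dat_psset_comp[OF T.iter_str_in z] by simp
      finally show "dat (iter_str S ?T n p \<circ>\<^sub>s smash_map (perm ?T n \<pi>) (smash_power_perm S p \<rho>)) k ?z =
          dat (perm ?T (n + p) (block_perm n \<pi> \<rho>) \<circ>\<^sub>s iter_str S ?T n p) k ?z" .
    qed
  qed
qed

section \<open>The category of symmetric spectra\<close>

lemma Hom_Sp_Sigma: "f \<in> Hom (Sp_Sigma S) X Y \<longleftrightarrow> is_spmap S f \<and> src f = X \<and> tgt f = Y"
  by (auto simp: Hom_def Sp_Sigma_def)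

lemma spmapD:
  assumes "f \<in> Hom (Sp_Sigma S) X Y"
  shows "is_spectrum S X" "is_spectrum S Y" "src f = X" "tgt f = Y"
    "dat f n \<in> Hom sSet_pt (lev X n) (lev Y n)"
    "\<pi> permutes {..<n} \<Longrightarrow> dat f n \<circ>\<^sub>s perm X n \<pi> = perm Y n \<pi> \<circ>\<^sub>s dat f n"
    "dat f (Suc n) \<circ>\<^sub>s str X n = str Y n \<circ>\<^sub>s smash_map (dat f n) (psset_id S)"
  using assms unfolding Hom_Sp_Sigma is_spmap_def by auto

lemma spmapI:
  assumes "is_spectrum S X" "is_spectrum S Y" "src f = X" "tgt f = Y"
    "\<And>n. dat f n \<in> Hom sSet_pt (lev X n) (lev Y n)"
    "\<And>n \<pi>. \<pi> permutes {..<n} \<Longrightarrow> dat f n \<circ>\<^sub>s perm X n \<pi> = perm Y n \<pi> \<circ>\<^sub>s dat f n"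
    "\<And>n. dat f (Suc n) \<circ>\<^sub>s str X n = str Y n \<circ>\<^sub>s smash_map (dat f n) (psset_id S)"
  shows "f \<in> Hom (Sp_Sigma S) X Y"
  using assms unfolding Hom_Sp_Sigma is_spmap_def by auto

lemma spmap_eqI:
  assumes "f \<in> Hom (Sp_Sigma S) X Y" "g \<in> Hom (Sp_Sigma S) X Y" "\<And>n. dat f n = dat g n"
  shows "f = g"
  using spmapD(3,4)[OF assms(1)] spmapD(3,4)[OF assms(2)] assms(3) by (cases f; cases g) auto

lemma Sp_Sigma_simps:
  "X \<in> Ob (Sp_Sigma S) \<longleftrightarrow> is_spectrum S X" "dat (Idt (Sp_Sigma S) X) n = psset_id (lev X n)"
  "dat (g \<cdot>\<^bsub>Sp_Sigma S\<^esub> f) n = dat g n \<circ>\<^sub>s dat f n"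
  by (auto simp: Sp_Sigma_def)

lemma Sp_Sigma_id:
  assumes S: "is_psset S" and X: "is_spectrum S X"
  shows "Idt (Sp_Sigma S) X \<in> Hom (Sp_Sigma S) X X"
proof (rule spmapI[OF X X])
  note x = spectrumD[OF X]
  show "src (Idt (Sp_Sigma S) X) = X" "tgt (Idt (Sp_Sigma S) X) = X" by (auto simp: Sp_Sigma_def)
  show "dat (Idt (Sp_Sigma S) X) n \<in> Hom sSet_pt (lev X n) (lev X n)" for n
    using psset_id_in[OF x(1)] by (simp add: Sp_Sigma_simps)
  show "dat (Idt (Sp_Sigma S) X) n \<circ>\<^sub>s perm X n \<pi> = perm X n \<pi> \<circ>\<^sub>s dat (Idt (Sp_Sigma S) X) n"
    if "\<pi> permutes {..<n}" for n \<pi>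
    using psset_comp_id[OF x(3)[OF that]] by (simp add: Sp_Sigma_simps)
  show "dat (Idt (Sp_Sigma S) X) (Suc n) \<circ>\<^sub>s str X n = str X n \<circ>\<^sub>s smash_map (dat (Idt (Sp_Sigma S) X) n) (psset_id S)" for n
    using psset_comp_id[OF x(2)] smash_map_id[OF x(1) S] by (simp add: Sp_Sigma_simps)
qed

text \<open>The structure squares of \<open>f\<close> and \<open>g\<close> paste because smashing
  with the identity of \<open>S\<close> is functorial.\<close>

lemma Sp_Sigma_comp:
  assumes S: "is_psset S" and f: "f \<in> Hom (Sp_Sigma S) X Y" and g: "g \<in> Hom (Sp_Sigma S) Y Z"
  shows "g \<cdot>\<^bsub>Sp_Sigma S\<^esub> f \<in> Hom (Sp_Sigma S) X Z"
proof (rule spmapI[OF spmapD(1)[OF f] spmapD(2)[OF g]])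
  note F = spmapD[OF f] and G = spmapD[OF g]
  note x = spectrumD[OF F(1)] and y = spectrumD[OF F(2)] and z = spectrumD[OF G(2)]
  note iS = psset_id_in[OF S]
  let ?h = "g \<cdot>\<^bsub>Sp_Sigma S\<^esub> f"
  show "src ?h = X" "tgt ?h = Z" using F G by (auto simp: Sp_Sigma_def)
  show "dat ?h n \<in> Hom sSet_pt (lev X n) (lev Z n)" for n
    using psset_comp_in[OF F(5) G(5)] by (simp add: Sp_Sigma_simps)
  show "dat ?h n \<circ>\<^sub>s perm X n \<pi> = perm Z n \<pi> \<circ>\<^sub>s dat ?h n" if p: "\<pi> permutes {..<n}" for n \<pi>
  proof -
    have "(dat g n \<circ>\<^sub>s dat f n) \<circ>\<^sub>s perm X n \<pi> = dat g n \<circ>\<^sub>s (perm Y n \<pi> \<circ>\<^sub>s dat f n)"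
      using psset_comp_assoc[OF x(3)[OF p] F(5) G(5)] F(6)[OF p] by simp
    also have "\<dots> = perm Z n \<pi> \<circ>\<^sub>s (dat g n \<circ>\<^sub>s dat f n)"
      using psset_comp_assoc[OF F(5) y(3)[OF p] G(5)] psset_comp_assoc[OF F(5) G(5) z(3)[OF p]] G(6)[OF p] by simp
    finally show ?thesis by (simp add: Sp_Sigma_simps)
  qed
  fix n
  note sf = smash_map_in[OF F(5)[of n] iS] and sg = smash_map_in[OF G(5)[of n] iS]
  have "(dat g (Suc n) \<circ>\<^sub>s dat f (Suc n)) \<circ>\<^sub>s str X n = dat g (Suc n) \<circ>\<^sub>s (str Y n \<circ>\<^sub>s smash_map (dat f n) (psset_id S))"
    using psset_comp_assoc[OF x(2) F(5) G(5)] F(7) by simp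
  also have "\<dots> = str Z n \<circ>\<^sub>s (smash_map (dat g n) (psset_id S) \<circ>\<^sub>s smash_map (dat f n) (psset_id S))"
    using psset_comp_assoc[OF sf y(2) G(5)] psset_comp_assoc[OF sf sg z(2)] G(7) by simp
  also have "\<dots> = str Z n \<circ>\<^sub>s smash_map (dat g n \<circ>\<^sub>s dat f n) (psset_id S)"
    using smash_map_comp[OF F(5) G(5) iS iS] psset_comp_id[OF iS] by simp
  finally show "dat ?h (Suc n) \<circ>\<^sub>s str X n = str Z n \<circ>\<^sub>s smash_map (dat ?h n) (psset_id S)"
    by (simp add: Sp_Sigma_simps)
qed

lemma Sp_Sigma_category:
  assumes S: "is_psset S"
  shows "is_category (Sp_Sigma S)"
  unfolding is_category_def
proof (intro conjI ballI)
  fix f assume "f \<in> Ar (Sp_Sigma S)"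
  then show "Dm (Sp_Sigma S) f \<in> Ob (Sp_Sigma S)" "Cd (Sp_Sigma S) f \<in> Ob (Sp_Sigma S)"
    by (auto simp: Sp_Sigma_def is_spmap_def)
next
  fix X assume "X \<in> Ob (Sp_Sigma S)"
  then show "Idt (Sp_Sigma S) X \<in> Hom (Sp_Sigma S) X X" by (simp add: Sp_Sigma_simps Sp_Sigma_id[OF S])
next
  fix X Y Z f g assume "f \<in> Hom (Sp_Sigma S) X Y" "g \<in> Hom (Sp_Sigma S) Y Z"
  then show "g \<cdot>\<^bsub>Sp_Sigma S\<^esub> f \<in> Hom (Sp_Sigma S) X Z" by (rule Sp_Sigma_comp[OF S])
next
  fix X Y f assume f: "f \<in> Hom (Sp_Sigma S) X Y"
  note i = Sp_Sigma_id[OF S]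
  show "f \<cdot>\<^bsub>Sp_Sigma S\<^esub> Idt (Sp_Sigma S) X = f"
    by (rule spmap_eqI[OF Sp_Sigma_comp[OF S i[OF spmapD(1)[OF f]] f] f])
      (simp add: Sp_Sigma_simps psset_comp_id[OF spmapD(5)[OF f]])
  show "Idt (Sp_Sigma S) Y \<cdot>\<^bsub>Sp_Sigma S\<^esub> f = f"
    by (rule spmap_eqI[OF Sp_Sigma_comp[OF S f i[OF spmapD(2)[OF f]]] f])
      (simp add: Sp_Sigma_simps psset_comp_id[OF spmapD(5)[OF f]])
next
  fix X Y Z W f g h
  assume f: "f \<in> Hom (Sp_Sigma S) X Y" and g: "g \<in> Hom (Sp_Sigma S) Y Z" and h: "h \<in> Hom (Sp_Sigma S) Z W"
  show "h \<cdot>\<^bsub>Sp_Sigma S\<^esub> (g \<cdot>\<^bsub>Sp_Sigma S\<^esub> f) = h \<cdot>\<^bsub>Sp_Sigma S\<^esub> g \<cdot>\<^bsub>Sp_Sigma S\<^esub> f"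
    by (rule spmap_eqI[OF Sp_Sigma_comp[OF S Sp_Sigma_comp[OF S f g] h] Sp_Sigma_comp[OF S f Sp_Sigma_comp[OF S g h]]])
      (simp add: Sp_Sigma_simps psset_comp_assoc[OF spmapD(5)[OF f] spmapD(5)[OF g] spmapD(5)[OF h]])
qed

section \<open>The suspension adjunction\<close>

lemma Susp_simps:
  "fob (Susp S) X = susp_spectrum S X" "dat (far (Susp S) f) n = smash_map f (psset_id (smash_power S n))"
  by (simp_all add: Susp_def)

text \<open>\<open>f\<close> acts on the first factor, while permutations and structure maps act on
  the sphere factors, so they commute.\<close>

lemma Susp_ar:
  assumes S: "is_psset S" and f: "f \<in> Hom sSet_pt X Y"
  shows "far (Susp S) f \<in> Hom (Sp_Sigma S) (susp_spectrum S X) (susp_spectrum S Y)"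
proof (rule spmapI)
  note F = psmapD[OF f]
  note iX = psset_id_in[OF F(1)] and iY = psset_id_in[OF F(2)] and iS = psset_id_in[OF S]
  note iP = psset_id_in[OF is_psset_smash_power[OF S]]
  let ?X = "susp_spectrum S X" and ?Y = "susp_spectrum S Y" and ?f = "far (Susp S) f"
  show "is_spectrum S ?X" "is_spectrum S ?Y" using F is_spectrum_susp[OF _ S] by auto
  show "src ?f = ?X" "tgt ?f = ?Y" using F by (simp_all add: Susp_def)
  show f_in: "dat ?f n \<in> Hom sSet_pt (lev ?X n) (lev ?Y n)" for n
    using smash_map_in[OF f iP] by (simp add: Susp_simps)
  show "dat ?f n \<circ>\<^sub>s perm ?X n \<pi> = perm ?Y n \<pi> \<circ>\<^sub>s dat ?f n" if p: "\<pi> permutes {..<n}" for n \<pi>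
  proof -
    note q = smash_power_perm_in[OF S p]
    \<comment> \<open>Both composites equal the smash product of \<open>f\<close> with the
      permutation map.\<close>
    show ?thesis
      using smash_map_comp[OF iX f q iP] smash_map_comp[OF f iY iP q] psset_comp_id[OF f] psset_comp_id[OF q]
      by (simp add: Susp_simps)
  qed
  fix n
  let ?P = "smash X (smash_power S n)"
  note sf = smash_map_in[OF f_in[of n, unfolded susp_simps] iS]
  note strX = susp_str_in[OF F(1) S, of n] and strY = susp_str_in[OF F(2) S, of n]
  show "dat ?f (Suc n) \<circ>\<^sub>s str ?X n = str ?Y n \<circ>\<^sub>s smash_map (dat ?f n) (psset_id S)"
  proof (rule psmap_smash_eqI[OF psset_comp_in[OF strX f_in[of "Suc n", unfolded susp_simps]] psset_comp_in[OF sf strY]])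
    fix k w s assume w: "w \<in> simp ?P k" and s: "s \<in> simp S k"
    obtain x ss where x: "w = tup_smash X S k x ss" "x \<in> simp X k" "length ss = n" "set ss \<subseteq> simp S k"
      using w by (rule smash_power_smash_cases[OF F(1) S])
    let ?z = "smash_elt ?P S k w s"
    note z = smash_elt_in[OF w s]
    have "dat (dat ?f (Suc n) \<circ>\<^sub>s str ?X n) k ?z = dat (dat ?f (Suc n)) k (tup_smash X S k x (ss @ [s]))"
      using dat_psset_comp[OF strX z] dat_susp_str[OF x(2-4) s] x(1) by simp
    also have "\<dots> = tup_smash Y S k (dat f k x) (ss @ [s])"
      unfolding Susp_simps by (rule dat_smash_map_id[OF S f x(2)]) (use x s in auto)
    also have "\<dots> = dat (str ?Y n) k (smash_elt (smash Y (smash_power S n)) S k (tup_smash Y S k (dat f k x) ss) s)"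
      using dat_susp_str[OF F(5)[OF x(2)] x(3,4) s] by simp
    also have "\<dots> = dat (str ?Y n) k (dat (smash_map (dat ?f n) (psset_id S)) k ?z)"
      using dat_smash_map[OF f_in[of n, unfolded susp_simps] iS w s] dat_smash_map_id[OF S f x(2-4)] x(1) s
      by (simp add: Susp_simps dat_psset_id)
    also have "\<dots> = dat (str ?Y n \<circ>\<^sub>s smash_map (dat ?f n) (psset_id S)) k ?z"
      using dat_psset_comp[OF sf z] by simp
    finally show "dat (dat ?f (Suc n) \<circ>\<^sub>s str ?X n) k ?z = dat (str ?Y n \<circ>\<^sub>s smash_map (dat ?f n) (psset_id S)) k ?z" .
  qed
qed

lemma Susp_functor:
  assumes S: "is_psset S"
  shows "is_functor sSet_pt (Sp_Sigma S) (Susp S)"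
proof (rule is_functorI[OF sSet_pt_category Sp_Sigma_category[OF S]])
  note P = is_psset_smash_power[OF S]
  fix X :: "'a psset" assume "X \<in> Ob sSet_pt"
  then have X: "is_psset X" by (simp add: Ob_sSet_pt)
  show "fob (Susp S) X \<in> Ob (Sp_Sigma S)" by (simp add: Susp_simps Sp_Sigma_simps is_spectrum_susp[OF X S])
  have "far (Susp S) (psset_id X) = Idt (Sp_Sigma S) (susp_spectrum S X)"
    by (rule spmap_eqI[OF Susp_ar[OF S psset_id_in[OF X]] Sp_Sigma_id[OF S is_spectrum_susp[OF X S]]])
      (simp add: Susp_simps Sp_Sigma_simps smash_map_id[OF X P])
  then show "far (Susp S) (Idt sSet_pt X) = Idt (Sp_Sigma S) (fob (Susp S) X)"
    by (simp add: Susp_simps sSet_pt_def)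
next
  fix X Y :: "'a psset" and f assume "f \<in> Hom sSet_pt X Y"
  then show "far (Susp S) f \<in> Hom (Sp_Sigma S) (fob (Susp S) X) (fob (Susp S) Y)"
    unfolding Susp_simps by (rule Susp_ar[OF S])
next
  fix X Y Z :: "'a psset" and f g assume f: "f \<in> Hom sSet_pt X Y" and g: "g \<in> Hom sSet_pt Y Z"
  note iP = psset_id_in[OF is_psset_smash_power[OF S]]
  show "far (Susp S) (g \<cdot>\<^bsub>sSet_pt\<^esub> f) = far (Susp S) g \<cdot>\<^bsub>Sp_Sigma S\<^esub> far (Susp S) f"
    unfolding Cmp_sSet_pt
    by (rule spmap_eqI[OF Susp_ar[OF S psset_comp_in[OF f g]] Sp_Sigma_comp[OF S Susp_ar[OF S f] Susp_ar[OF S g]]])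
      (simp add: Susp_simps Sp_Sigma_simps smash_map_comp[OF f g iP iP] psset_comp_id[OF iP])
qed

lemma Ev0_functor:
  assumes S: "is_psset S"
  shows "is_functor (Sp_Sigma S) sSet_pt Ev0"
  by (rule is_functorI[OF Sp_Sigma_category[OF S] sSet_pt_category])
    (auto simp: Ev0_def Sp_Sigma_simps Ob_sSet_pt intro: spectrumD spmapD, simp add: sSet_pt_def)

section \<open>The unit and its invertibility\<close>

lemma dat_susp_unit:
  "x \<in> simp X n \<Longrightarrow> dat (susp_unit S X) n x = tup_smash X S n x []"
  by (simp add: susp_unit_def smash_elt_def tup_smash_def)

lemma susp_unit_in:
  assumes X: "is_psset X" and S: "is_psset S"
  shows "susp_unit S X \<in> Hom sSet_pt X (smash X (smash_power S 0))"
proof (rule psmapI)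
  let ?f = "susp_unit S X"
  show "is_psset X" "is_psset (smash X (smash_power S 0))" by (auto intro: X S is_psset_smash is_psset_smash_power)
  show "src ?f = X" "tgt ?f = smash X (smash_power S 0)" "dat ?f n \<in> extensional (simp X n)" for n
    by (simp_all add: susp_unit_def)
  show "dat ?f n (pt X n) = pt (smash X (smash_power S 0)) n" for n
    by (simp add: dat_susp_unit psset_pt[OF X])
  fix n x assume x: "x \<in> simp X n"
  show "dat ?f n x \<in> simp (smash X (smash_power S 0)) n"
    unfolding dat_susp_unit[OF x] by (rule tup_smash_in[OF x]) auto
  fix m \<theta> assume t: "\<theta> \<in> Delta m n"
  show "dat ?f m (sact X m n \<theta> x) = sact (smash X (smash_power S 0)) m n \<theta> (dat ?f n x)"
    by (simp add: dat_susp_unit x psset_sact[OF X t] sact_tup_smash[OF X S t])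
qed

text \<open>The inverse functions are compatible with operators: apply \<open>f\<close> to an
  operator on the preimage, then cancel \<open>f\<close> in the lower dimension.\<close>

lemma psmap_bij_iso:
  assumes f: "f \<in> Hom sSet_pt X Y" and bij: "\<And>n. bij_betw (dat f n) (simp X n) (simp Y n)"
  shows "is_iso sSet_pt f"
proof -
  note F = psmapD[OF f]
  define g where "g = \<lparr>src = Y, tgt = X, dat = (\<lambda>n. restrict (inv_into (simp X n) (dat f n)) (simp Y n))\<rparr>"
  have g: "dat g n y \<in> simp X n" "dat f n (dat g n y) = y" if "y \<in> simp Y n" for n y
    using that bij_betw_inv_into_right[OF bij that] bij_betwE[OF bij_betw_inv_into[OF bij]] by (auto simp: g_def)
  have gf: "dat g n (dat f n x) = x" if "x \<in> simp X n" for n x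
    using that F(5) bij_betw_inv_into_left[OF bij that] by (simp add: g_def)
  have "g \<in> Hom sSet_pt Y X"
  proof (rule psmapI[OF F(2,1)])
    show "src g = Y" "tgt g = X" "dat g n \<in> extensional (simp Y n)" for n by (simp_all add: g_def)
    show "dat g n (pt Y n) = pt X n" for n using gf[OF psset_pt[OF F(1)], of n] F(7) by simp
    fix n y assume y: "y \<in> simp Y n"
    then show "dat g n y \<in> simp X n" by (rule g)
    fix m \<theta> assume t: "\<theta> \<in> Delta m n"
    show "dat g m (sact Y m n \<theta> y) = sact X m n \<theta> (dat g n y)"
      using F(8)[OF t g(1)[OF y]] gf[OF psset_sact[OF F(1) t g(1)[OF y]]] g(2)[OF y] by simp
  qed
  moreover from this have "g \<circ>\<^sub>s f = psset_id X" "f \<circ>\<^sub>s g = psset_id Y"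
    using psmap_eqI[OF psset_comp_in[OF f] psset_id_in[OF F(1)], of g]
      psmap_eqI[OF psset_comp_in[OF _ f] psset_id_in[OF F(2)], of g]
    by (auto simp: dat_psset_comp[OF f] dat_psset_comp[of g Y X] dat_psset_id gf g(2))
  ultimately show ?thesis using is_isoI[OF f] by (simp add: sSet_pt_def)
qed

text \<open>In each dimension the 0-fold power has only \<open>Pt\<close> and \<open>Tup []\<close>,
  so smashing with it neither identifies nor adds simplices. Only the base point goes to
  \<open>Pt\<close>, and every list of length 0 is the empty one.\<close>

lemma susp_unit_iso:
  assumes X: "is_psset X" and S: "is_psset S"
  shows "is_iso sSet_pt (susp_unit S X)"
proof (rule psmap_bij_iso[OF susp_unit_in[OF X S]])
  fix n
  have "inj_on (dat (susp_unit S X) n) (simp X n)"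
    by (rule inj_onI) (auto simp: dat_susp_unit tup_smash_def split: if_splits)
  moreover have "simp (smash X (smash_power S 0)) n \<subseteq> dat (susp_unit S X) n ` simp X n"
  proof
    fix z assume "z \<in> simp (smash X (smash_power S 0)) n"
    then obtain x and ss :: "'a elem list" where "z = tup_smash X S n x ss" "x \<in> simp X n" "length ss = 0"
      by (rule smash_power_smash_cases[OF X S])
    then show "z \<in> dat (susp_unit S X) n ` simp X n" using dat_susp_unit[of x X n S] by force
  qed
  ultimately show "bij_betw (dat (susp_unit S X) n) (simp X n) (simp (smash X (smash_power S 0)) n)"
    using psmapD(5)[OF susp_unit_in[OF X S]] by (auto simp: bij_betw_def)
qed

section \<open>The counit and the triangle identities\<close>

lemma block_perm_0 [simp]: "block_perm 0 \<pi> \<rho> = \<rho>"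
  by (simp add: block_perm_def fun_eq_iff)

lemma dat_susp_counit: "dat (susp_counit S Y) n = iter_str S Y 0 n"
  by (simp add: susp_counit_def)

text \<open>Equivariance is the spectrum axiom with an empty first block, for which
  \<open>block_perm\<close> is its second argument. The structure square is
  \<open>iter_elt_snoc\<close>: absorbing an appended factor is one more structure map at the
  end.\<close>

lemma susp_counit_in:
  assumes S: "is_psset S" and Y: "is_spectrum S Y"
  shows "susp_counit S Y \<in> Hom (Sp_Sigma S) (susp_spectrum S (lev Y 0)) Y"
proof (rule spmapI[OF is_spectrum_susp[OF spectrumD(1)[OF Y] S] Y])
  interpret structured S Y by (rule spectrum_structured[OF S Y])
  let ?X = "lev Y 0"
  let ?T = "susp_spectrum S ?X"
  \<comment> \<open>\<open>iter_str\<close> from level 0 ends in level \<open>0 + n\<close>, which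
    must be rewritten to \<open>n\<close> to match the levels of a spectrum map.\<close>
  note it = iter_str_in[of 0, unfolded add_0]
  note iS = psset_id_in[OF S]
  show "src (susp_counit S Y) = ?T" "tgt (susp_counit S Y) = Y" by (simp_all add: susp_counit_def)
  show "dat (susp_counit S Y) n \<in> Hom sSet_pt (lev ?T n) (lev Y n)" for n
    unfolding dat_susp_counit susp_simps by (rule it)
  show "dat (susp_counit S Y) n \<circ>\<^sub>s perm ?T n \<pi> = perm Y n \<pi> \<circ>\<^sub>s dat (susp_counit S Y) n"
    if "\<pi> permutes {..<n}" for n \<pi>
    using spectrumD(6)[OF Y permutes_id that, of 0] by (simp add: dat_susp_counit spectrumD(4)[OF Y])
  fix n
  let ?P = "smash ?X (smash_power S n)"
  note strT = susp_str_in[OF lev S, of 0 n] and sit = smash_map_in[OF it iS, of n]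
  show "dat (susp_counit S Y) (Suc n) \<circ>\<^sub>s str ?T n = str Y n \<circ>\<^sub>s smash_map (dat (susp_counit S Y) n) (psset_id S)"
    unfolding dat_susp_counit
  proof (rule psmap_smash_eqI[OF psset_comp_in[OF strT it] psset_comp_in[OF sit str]])
    fix k w s assume w: "w \<in> simp ?P k" and s: "s \<in> simp S k"
    obtain x ss where x: "w = tup_smash ?X S k x ss" "x \<in> simp ?X k" "length ss = n" "set ss \<subseteq> simp S k"
      using w by (rule smash_power_smash_cases[OF lev S])
    let ?z = "smash_elt ?P S k w s"
    note z = smash_elt_in[OF w s]
    have "dat (iter_str S Y 0 (Suc n) \<circ>\<^sub>s str ?T n) k ?z = dat (iter_str S Y 0 (Suc n)) k (tup_smash ?X S k x (ss @ [s]))"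
      using dat_psset_comp[OF strT z] dat_susp_str[OF x(2-4) s] x(1) by simp
    also have "\<dots> = iter_elt S Y k 0 x (ss @ [s])"
      by (rule dat_iter_str) (use x s in auto)
    also have "\<dots> = step k n (iter_elt S Y k 0 x ss) s"
      unfolding iter_elt_snoc using x(3) by simp
    also have "\<dots> = dat (str Y n) k (dat (smash_map (iter_str S Y 0 n) (psset_id S)) k ?z)"
      using dat_smash_map[OF it iS w s] dat_iter_str[OF x(2-4)] x(1) s by (simp add: dat_psset_id)
    also have "\<dots> = dat (str Y n \<circ>\<^sub>s smash_map (iter_str S Y 0 n) (psset_id S)) k ?z"
      using dat_psset_comp[OF sit z] by simp
    finally show "dat (iter_str S Y 0 (Suc n) \<circ>\<^sub>s str ?T n) k ?z =
        dat (str Y n \<circ>\<^sub>s smash_map (iter_str S Y 0 n) (psset_id S)) k ?z" .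
  qed
qed

text \<open>A map of spectra commutes with each structure map, hence with their iterates. The case
  \<open>n = 0\<close> is the naturality of the counit.\<close>

lemma iter_elt_spmap:
  assumes S: "is_psset S" and f: "f \<in> Hom (Sp_Sigma S) X Y"
  shows "x \<in> simp (lev X n) k \<Longrightarrow> set ss \<subseteq> simp S k \<Longrightarrow>
    dat (dat f (n + length ss)) k (iter_elt S X k n x ss) = iter_elt S Y k n (dat (dat f n) k x) ss"
proof (induction ss arbitrary: n x)
  case (Cons s ss)
  note F = spmapD[OF f]
  interpret structured S X by (rule spectrum_structured[OF S F(1)])
  have s: "s \<in> simp S k" using Cons.prems by simp
  note z = smash_elt_in[OF Cons.prems(1) s]
  have "dat (dat f (Suc n)) k (step k n x s) = dat (dat f (Suc n) \<circ>\<^sub>s str X n) k (smash_elt (lev X n) S k x s)"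
    using dat_psset_comp[OF str z] by simp
  also have "\<dots> = dat (str Y n) k (dat (smash_map (dat f n) (psset_id S)) k (smash_elt (lev X n) S k x s))"
    unfolding F(7) using dat_psset_comp[OF smash_map_in[OF F(5) psset_id_in[OF S]] z] by simp
  also have "\<dots> = dat (str Y n) k (smash_elt (lev Y n) S k (dat (dat f n) k x) s)"
    using dat_smash_map[OF F(5) psset_id_in[OF S] Cons.prems(1) s] s by (simp add: dat_psset_id)
  finally show ?case using Cons.IH[OF step_in[OF Cons.prems(1) s]] Cons.prems by simp
qed simp

theorem susp_adjunction:
  assumes S: "is_psset S"
  shows "is_adjunction sSet_pt (Sp_Sigma S) (Susp S) Ev0 (susp_unit S) (susp_counit S)"
  unfolding is_adjunction_def
proof (intro conjI ballI)
  note func = Susp_functor[OF S] Ev0_functor[OF S]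
  note P = is_psset_smash_power[OF S]
  show "is_natural sSet_pt sSet_pt id_func (Ev0 \<circ>\<^sub>F Susp S) (susp_unit S)"
  proof (rule is_naturalI[OF id_functor[OF sSet_pt_category] functor_compose[OF func]])
    fix X :: "'a psset" assume "X \<in> Ob sSet_pt"
    then show "susp_unit S X \<in> Hom sSet_pt (fob id_func X) (fob (Ev0 \<circ>\<^sub>F Susp S) X)"
      using susp_unit_in[OF _ S] by (simp add: id_func_def comp_func_def Ev0_def Susp_simps Ob_sSet_pt)
  next
    fix X Y :: "'a psset" and f assume f: "f \<in> Hom sSet_pt X Y"
    note F = psmapD[OF f]
    note uX = susp_unit_in[OF F(1) S] and uY = susp_unit_in[OF F(2) S]
    note sf = smash_map_in[OF f psset_id_in[OF P]]
    have "susp_unit S Y \<circ>\<^sub>s f = smash_map f (psset_id (smash_power S 0)) \<circ>\<^sub>s susp_unit S X"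
      by (rule psmap_eqI[OF psset_comp_in[OF f uY] psset_comp_in[OF uX sf]])
        (simp add: dat_psset_comp[OF f] dat_psset_comp[OF uX] dat_susp_unit F(5) dat_smash_map_id[OF S f])
    then show "susp_unit S Y \<cdot>\<^bsub>sSet_pt\<^esub> far id_func f = far (Ev0 \<circ>\<^sub>F Susp S) f \<cdot>\<^bsub>sSet_pt\<^esub> susp_unit S X"
      by (simp add: id_func_def comp_func_def Ev0_def Susp_simps)
  qed
  show "is_natural (Sp_Sigma S) (Sp_Sigma S) (Susp S \<circ>\<^sub>F Ev0) id_func (susp_counit S)"
  proof (rule is_naturalI[OF functor_compose[OF func(2,1)] id_functor[OF Sp_Sigma_category[OF S]]])
    fix Y assume "Y \<in> Ob (Sp_Sigma S)"
    then show "susp_counit S Y \<in> Hom (Sp_Sigma S) (fob (Susp S \<circ>\<^sub>F Ev0) Y) (fob id_func Y)"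
      using susp_counit_in[OF S] by (simp add: id_func_def comp_func_def Ev0_def Susp_simps Sp_Sigma_simps)
  next
    fix Y Z f assume f: "f \<in> Hom (Sp_Sigma S) Y Z"
    note F = spmapD[OF f]
    interpret Y: structured S Y by (rule spectrum_structured[OF S F(1)])
    interpret Z: structured S Z by (rule spectrum_structured[OF S F(2)])
    note cY = susp_counit_in[OF S F(1)] and cZ = susp_counit_in[OF S F(2)] and sf = Susp_ar[OF S F(5)[of 0]]
    have "susp_counit S Z \<cdot>\<^bsub>Sp_Sigma S\<^esub> far (Susp S) (dat f 0) = f \<cdot>\<^bsub>Sp_Sigma S\<^esub> susp_counit S Y"
    proof (rule spmap_eqI[OF Sp_Sigma_comp[OF S sf cZ] Sp_Sigma_comp[OF S cY f]], unfold Sp_Sigma_simps dat_susp_counit Susp_simps)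
      fix n
      note itY = Y.iter_str_in[of 0 n, unfolded add_0] and itZ = Z.iter_str_in[of 0 n, unfolded add_0]
      note sm = smash_map_in[OF F(5)[of 0] psset_id_in[OF P, of n]]
      show "iter_str S Z 0 n \<circ>\<^sub>s smash_map (dat f 0) (psset_id (smash_power S n)) = dat f n \<circ>\<^sub>s iter_str S Y 0 n"
      proof (rule psmap_tup_smash_eqI[OF psset_comp_in[OF sm itZ] psset_comp_in[OF itY F(5)] Y.lev S])
        fix k x ss assume h: "x \<in> simp (lev Y 0) k" "length ss = n" "set ss \<subseteq> simp S k"
        note z = tup_smash_in[OF h]
        show "dat (iter_str S Z 0 n \<circ>\<^sub>s smash_map (dat f 0) (psset_id (smash_power S n))) k (tup_smash (lev Y 0) S k x ss) =
            dat (dat f n \<circ>\<^sub>s iter_str S Y 0 n) k (tup_smash (lev Y 0) S k x ss)"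
          using dat_psset_comp[OF sm z] dat_psset_comp[OF itY z] dat_smash_map_id[OF S F(5) h]
            Z.dat_iter_str[OF psmapD(5)[OF F(5) h(1)] h(2,3)] Y.dat_iter_str[OF h]
            iter_elt_spmap[OF S f h(1,3)] h(2) by simp
      qed
    qed
    then show "susp_counit S Z \<cdot>\<^bsub>Sp_Sigma S\<^esub> far (Susp S \<circ>\<^sub>F Ev0) f = far id_func f \<cdot>\<^bsub>Sp_Sigma S\<^esub> susp_counit S Y"
      by (simp add: id_func_def comp_func_def Ev0_def)
  qed
  fix X :: "'a psset" assume "X \<in> Ob sSet_pt"
  then have X: "is_psset X" by (simp add: Ob_sSet_pt)
  let ?T = "susp_spectrum S X"
  interpret T: structured S ?T by (rule susp_structured[OF X S])
  note T = is_spectrum_susp[OF X S]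
  note u = susp_unit_in[OF X S]
  note Lu = Susp_ar[OF S u] and c = susp_counit_in[OF S T, unfolded susp_simps]
  have "susp_counit S ?T \<cdot>\<^bsub>Sp_Sigma S\<^esub> far (Susp S) (susp_unit S X) = Idt (Sp_Sigma S) ?T"
  proof (rule spmap_eqI[OF Sp_Sigma_comp[OF S Lu c] Sp_Sigma_id[OF S T]], unfold Sp_Sigma_simps dat_susp_counit Susp_simps susp_simps)
    fix n
    note it = T.iter_str_in[of 0 n, unfolded add_0 susp_simps]
    note sm = smash_map_in[OF u psset_id_in[OF P, of n]]
    \<comment> \<open>The unit places the empty tuple before \<open>ss\<close>, and iterating the
      structure maps concatenates, which gives \<open>ss\<close> back.\<close>
    show "iter_str S ?T 0 n \<circ>\<^sub>s smash_map (susp_unit S X) (psset_id (smash_power S n)) = psset_id (smash X (smash_power S n))"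
    proof (rule psmap_tup_smash_eqI[OF psset_comp_in[OF sm it] psset_id_in[OF is_psset_smash[OF X P]] X S])
      fix k x ss assume h: "x \<in> simp X k" "length ss = n" "set ss \<subseteq> simp S k"
      note z = tup_smash_in[OF h]
      show "dat (iter_str S ?T 0 n \<circ>\<^sub>s smash_map (susp_unit S X) (psset_id (smash_power S n))) k (tup_smash X S k x ss) =
          dat (psset_id (smash X (smash_power S n))) k (tup_smash X S k x ss)"
        using dat_psset_comp[OF sm z] dat_smash_map_id[OF S u h] dat_susp_unit[OF h(1)]
          T.dat_iter_str[of _ 0 k ss n, unfolded susp_simps, OF psmapD(5)[OF u h(1)] h(2,3)]
          iter_elt_susp[OF h(1,3), of "[]" 0] z by (simp add: dat_psset_id)
    qed
  qed
  then show "susp_counit S (fob (Susp S) X) \<cdot>\<^bsub>Sp_Sigma S\<^esub> far (Susp S) (susp_unit S X) = Idt (Sp_Sigma S) (fob (Susp S) X)"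
    by (simp add: Susp_simps)
next
  fix Y assume "Y \<in> Ob (Sp_Sigma S)"
  then have Y: "is_spectrum S Y" by (simp add: Sp_Sigma_simps)
  interpret structured S Y by (rule spectrum_structured[OF S Y])
  note u = susp_unit_in[OF lev S, of 0] and it = iter_str_in[of 0 0, unfolded add_0]
  \<comment> \<open>At level 0 no structure map is applied, so the counit merely drops the empty
    tuple that the unit introduced.\<close>
  have "iter_str S Y 0 0 \<circ>\<^sub>s susp_unit S (lev Y 0) = psset_id (lev Y 0)"
    by (rule psmap_eqI[OF psset_comp_in[OF u it] psset_id_in[OF lev]])
      (simp add: dat_psset_comp[OF u] dat_psset_id dat_susp_unit dat_iter_str)
  then show "far Ev0 (susp_counit S Y) \<cdot>\<^bsub>sSet_pt\<^esub> susp_unit S (fob Ev0 Y) = Idt sSet_pt (fob Ev0 Y)"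
    by (simp add: Ev0_def dat_susp_counit sSet_pt_def)
qed (fact Susp_functor[OF S] Ev0_functor[OF S])+

theorem corollary2p2p4:
  fixes S :: "'a psset"
  assumes "circle_model S"
  shows "is_adjunction sSet_pt (Sp_Sigma S) (Susp S) Ev0 (susp_unit S) (susp_counit S) \<and>
    comonadic sSet_pt (Sp_Sigma S) (Susp S) Ev0 (susp_unit S) (susp_counit S) \<and>
    is_adjoint_equivalence sSet_pt
      (coAlg (Sp_Sigma S) (adj_comonad (Susp S) Ev0 (susp_unit S) (susp_counit S)))
      (Can sSet_pt (Susp S) (susp_unit S))
      (V_func sSet_pt psset_equalizer Ev0 (susp_unit S))
      (comparison_unit sSet_pt psset_equalizer (Susp S) Ev0 (susp_unit S))
      (comparison_counit sSet_pt (Sp_Sigma S) psset_equalizer (Susp S) Ev0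
         (susp_unit S) (susp_counit S))"
proof -
  have S: "is_psset S" using assms by (simp add: circle_model_def)
  \<comment> \<open>The simplicial subsets on which two maps agree supply the chosen equalizers
    \<open>E\<close>.\<close>
  interpret comparison sSet_pt "Sp_Sigma S" "Susp S" Ev0 "susp_unit S" "susp_counit S" psset_equalizer
    by unfold_locales (fact susp_adjunction[OF S] psset_equalizer_is_equalizer)+
  have iso: "is_iso sSet_pt (susp_unit S X)" if "X \<in> Ob sSet_pt" for X
    using that susp_unit_iso[OF _ S] by (simp add: Ob_sSet_pt)
  show ?thesis
    using adj comonadic_of_unit_iso[OF iso] comparison_adjoint_equivalence[OF iso] by blast
qed

end
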